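(* Let $k$ be a finite field, $X$ a smooth projective variety of dimension $r$ over $k$, $\mathcal D=\{D_1,\dots,D_r\}$ an ordered set of properly intersecting effective $k$-rational divisors on $X$, $D=\sum_iD_i$, $\mathcal P\subseteq\cap_iD_i$ a finite set of $k$-rational points, and $G$ a $k$-rational divisor on $X$ whose support is disjoint from $\mathcal P$. Suppose that $\theta$ is $(\mathcal D,\mathcal P)$-rectifying and that $h\in k(X)$ is regular at every $P\in\cap_iD_i$. Then for any $\omega\in\Omega^r(X)$ such that, at every $P\in\cap_iD_i$, with $f_1,\dots,f_r$ local equations of $D_1,\dots,D_r$ at $P$ and $\mathbf x=\{x_1,\dots,x_r\}$ local parameters at $P$, the function $f_1f_2\cdots f_r\,\omega/(\theta\,d\mathbf x)$ is regular at $P$ (in particular when $\omega\in\Omega^r(D-G-(\theta)^+)$), one has for every $P\in\cap_iD_i$ $$Res_P\begin{bmatrix}h\omega \\ D_1,\dots,D_r\end{bmatrix}=h(P)\,Res_P\begin{bmatrix}\omega \\ D_1,\dots,D_r\end{bmatrix}.$$ Moreover, for $P\notin\mathcal P$, $$Res_P\begin{bmatrix}\omega \\ D_1,\dots,D_r\end{bmatrix}=0.$$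
   Context: A variety over $k$ is a geometrically integral separated scheme of finite type over $k$. $\mathcal O_P$ is the local ring at $P$ and $m_P$ its maximal ideal; local parameters at $P$ are a minimal set of generators of $m_P$. $\Omega^r(X)$ is the space of $k$-rational (meromorphic) $r$-differential forms on $X$ (one-dimensional over $k(X)$). For $\omega\in\Omega^r(X)$ and local parameters $\mathbf x$, with $d\mathbf x=dx_1\wedge\dots\wedge dx_r$, $\omega/d\mathbf x$ denotes the rational function $w$ with $\omega=w\,d\mathbf x$. $(f)$, $(\omega)$ denote divisors; a divisor $H$ is written $H=H^+-H^-$ with $H^\pm$ effective without common components; $(\theta)^+$ is the positive part of $(\theta)$. $\Omega^r(H)=\{0\ne\omega\in\Omega^r(X): (\omega)+H\ge0\}\cup\{0\}$. Effective divisors $D_1,\dots,D_r$ intersect properly if $\cap_i D_i$ (set-theoretic intersection of supports) is zero-dimensional, i.e. finite; it is assumed throughout that all points of $\cap_i D_i$ are $k$-rational. Residues. Let $P\in X(k)$, $\mathbf x=\{x_1,\dots,x_r\}$ a set of generators of $m_P$. If $\omega$ is regular near $P$, write $\omega=\sum_{I\in\mathbb N^r}c_I\mathbf x^I\,d\mathbf x$, and for $a_i>0$ set $Res_P\begin{bmatrix}\omega \\ x_1^{a_1},\dots,x_r^{a_r}\end{bmatrix}=c_{(a_1-1,\dots,a_r-1)}$. If $\mathbf f=\{f_1,\dots,f_r\}$ is a system of parameters at $P$ and $a>0$ is such that $x_i^a\in(f_1,\dots,f_r)$ for all $i$, write $x_i^a=\sum_j r_{ij}f_j$ with $r_{ij}\in\mathcal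 O_P$, put $R_P(\mathbf x,\mathbf f,a)=\det[r_{ij}]$ (well defined modulo $(x_1^a,\dots,x_r^a)$), and define $Res_P\begin{bmatrix}\omega \\ f_1,\dots,f_r\end{bmatrix}=Res_P\begin{bmatrix}R_P(\mathbf x,\mathbf f,a)\,\omega \\ x_1^a,\dots,x_r^a\end{bmatrix}$ (independent of choices). If $f_i$ are local equations of $D_i$ at $P\in\cap_lD_l$ and $f_1\cdots f_r\omega$ is regular near $P$, set $Res_P\begin{bmatrix}\omega \\ D_1,\dots,D_r\end{bmatrix}=Res_P\begin{bmatrix}f_1\cdots f_r\omega \\ f_1,\dots,f_r\end{bmatrix}$; it is set to $0$ if $P\notin\cap_lD_l$. Rectifying functions. Given $\mathcal P\subseteq\cap_lD_l$, for each $P_i\in\cap_lD_l$ fix generators $\mathbf x_i=\{x_{i1},\dots,x_{ir}\}$ of $m_{P_i}$, local equations $\mathbf f_i=\{f_{i1},\dots,f_{ir}\}$ of $D_1,\dots,D_r$ at $P_i$, and $a_i\in\mathbb N$ with $x_{ij}^{a_i}\in(f_{i1},\dots,f_{ir})$ for all $j$. A function $\theta\in k(X)^*$ regular at each point of $\cap_lD_l$ is $(\mathcal D,\mathcal P)$-rectifying if, $\theta_i$ being its power series expansion in $\mathbf x_i$ at $P_i$: (1) for $P_i\in\mathcal P$, $R_{P_i}(\mathbf x_i,\mathbf f_i,a_i)\theta_i\equiv c_i x_{i1}^{a_i-1}\cdots x_{ir}^{a_i-1}\pmod{x_{i1}^{a_i},\dots,x_{ir}^{a_i}}$ for some $c_i\in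 k$; (2) for $P_i\in\cap_lD_l-\mathcal P$, $R_{P_i}(\mathbf x_i,\mathbf f_i,a_i)\theta_i\equiv0\pmod{x_{i1}^{a_i},\dots,x_{ir}^{a_i}}$. (This does not depend on the choices.)
   Formalization: The clause "in particular when ω∈Ω^r(D−G−(θ)^+)" fails at P∉𝒫 where G is not effective (P^1, D_1=[0]+[∞], 𝒫={∞}, G=−[0], θ=z/(z−1), ω=dz/z); regularity is claimed only at P∈∩D_i lying in 𝒫 or where G is effective. *)

theory Defs
  imports
    "HOL-Library.Poly_Mapping"
    "HOL-Algebra.Algebraic_Closure_Type"
    "Jordan_Normal_Form.Determinant"
begin

text \<open>
  An integral projective scheme over a field k is described by its function field, a type 'K with
  an embedding \<open>\<iota>\<close> of k, together with its generic point, an (n+1)-tuple of homogeneous coordinates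
  in 'K. As V is integral and separated, a (scheme-theoretic) point P of V is determined by its
  local ring inside 'K, so a point \<^emph>\<open>is\<close> a subring of 'K. The closure of Q consists of the P with
  \<open>P \<subseteq> Q\<close>; the generic point is \<open>UNIV\<close>. Such a set of local rings is called a projective model
  by Zariski and Samuel (Commutative Algebra II, Chapter VI, Section 17).
\<close>

section \<open>Subrings, polynomials\<close>

definition subring_of :: "'a::comm_ring_1 set \<Rightarrow> 'a ring" where
  "subring_of A = \<lparr>carrier = A, monoid.mult = (*), one = 1, ring.zero = 0, add = (+)\<rparr>"

definition ideal_gen :: "'a::comm_ring_1 set \<Rightarrow> 'a set \<Rightarrow> 'a set" where
  "ideal_gen A S = genideal (subring_of A) S"

definition prime_in :: "'a::comm_ring_1 set \<Rightarrow> 'a set \<Rightarrow> bool" where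
  "prime_in A q \<longleftrightarrow> primeideal q (subring_of A)"

type_synonym 'k mpol = "(nat \<Rightarrow>\<^sub>0 nat) \<Rightarrow>\<^sub>0 'k"

definition in_vars :: "nat \<Rightarrow> 'k::zero mpol \<Rightarrow> bool" where
  "in_vars n F \<longleftrightarrow> (\<forall>I\<in>Poly_Mapping.keys F. Poly_Mapping.keys I \<subseteq> {..<n})"

definition mdeg :: "(nat \<Rightarrow>\<^sub>0 nat) \<Rightarrow> nat" where
  "mdeg I = (\<Sum>i\<in>Poly_Mapping.keys I. Poly_Mapping.lookup I i)"

definition homogeneous :: "'k::zero mpol \<Rightarrow> bool" where
  "homogeneous F \<longleftrightarrow> (\<exists>d. \<forall>I\<in>Poly_Mapping.keys F. mdeg I = d)"

definition monom_at :: "(nat \<Rightarrow> 'a::comm_monoid_mult) \<Rightarrow> (nat \<Rightarrow>\<^sub>0 nat) \<Rightarrow> 'a" where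
  "monom_at t I = (\<Prod>i\<in>Poly_Mapping.keys I. t i ^ Poly_Mapping.lookup I i)"

definition eval_at :: "('k::zero \<Rightarrow> 'a::comm_semiring_1) \<Rightarrow> (nat \<Rightarrow> 'a) \<Rightarrow> 'k mpol \<Rightarrow> 'a" where
  "eval_at \<iota> t F = (\<Sum>I\<in>Poly_Mapping.keys F. \<iota> (Poly_Mapping.lookup F I) * monom_at t I)"

definition partial :: "nat \<Rightarrow> 'k::comm_semiring_1 mpol \<Rightarrow> 'k mpol" where
  "partial i F = (\<Sum>I\<in>Poly_Mapping.keys F.
     Poly_Mapping.single (I - Poly_Mapping.single i 1) (of_nat (Poly_Mapping.lookup I i) * Poly_Mapping.lookup F I))"

section \<open>Projective varieties\<close>

definition field_embedding :: "('k::field \<Rightarrow> 'K::field) \<Rightarrow> bool" where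
  "field_embedding \<iota> \<longleftrightarrow> \<iota> 1 = 1 \<and> (\<forall>a b. \<iota> (a + b) = \<iota> a + \<iota> b) \<and> (\<forall>a b. \<iota> (a * b) = \<iota> a * \<iota> b)"

text \<open>The coordinate ring of the affine chart where the i-th homogeneous coordinate is nonzero.\<close>

definition chart_ring :: "('k::field \<Rightarrow> 'K::field) \<Rightarrow> nat \<Rightarrow> (nat \<Rightarrow> 'K) \<Rightarrow> nat \<Rightarrow> 'K set" where
  "chart_ring \<iota> n t i = {eval_at \<iota> (\<lambda>j. t j / t i) F |F. in_vars (Suc n) F}"

definition localization :: "'K::field set \<Rightarrow> 'K set \<Rightarrow> 'K set" where
  "localization A q = {a / b |a b. a \<in> A \<and> b \<in> A - q}"

definition proj_points :: "('k::field \<Rightarrow> 'K::field) \<Rightarrow> nat \<Rightarrow> (nat \<Rightarrow> 'K) \<Rightarrow> 'K set set" where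
  "proj_points \<iota> n t = {localization (chart_ring \<iota> n t i) q |i q.
     i \<le> n \<and> t i \<noteq> 0 \<and> prime_in (chart_ring \<iota> n t i) q}"

text \<open>The second conjunct says that 'K is the function field of V, the field of fractions of a
  chart ring.\<close>

definition integral_projective :: "('k::field \<Rightarrow> 'K::field) \<Rightarrow> nat \<Rightarrow> (nat \<Rightarrow> 'K) \<Rightarrow> bool" where
  "integral_projective \<iota> n t \<longleftrightarrow> field_embedding \<iota> \<and>
     (\<exists>i\<le>n. t i \<noteq> 0 \<and> (\<forall>z. \<exists>a\<in>chart_ring \<iota> n t i. \<exists>b\<in>chart_ring \<iota> n t i. b \<noteq> 0 \<and> z = a / b))"

text \<open>The homogeneous ideal of V generates the homogeneous ideal of the base change of V to the
  algebraic closure of k; that base change is integral iff the ideal is prime.\<close>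

definition geom_integral :: "('k::field \<Rightarrow> 'K::field) \<Rightarrow> nat \<Rightarrow> (nat \<Rightarrow> 'K) \<Rightarrow> bool" where
  "geom_integral \<iota> n t \<longleftrightarrow>
     prime_in {F :: 'k alg_closure mpol. in_vars (Suc n) F}
       (ideal_gen {F. in_vars (Suc n) F}
          {Poly_Mapping.map to_ac F |F.
             in_vars (Suc n) F \<and> homogeneous F \<and> eval_at \<iota> t F = 0})"

text \<open>Krull dimension, a chain of specializations being an ascending chain of local rings.\<close>

definition krull_dim_is :: "'K set set \<Rightarrow> nat \<Rightarrow> bool" where
  "krull_dim_is V r \<longleftrightarrow>
     (\<exists>Q. \<forall>i\<le>r. Q i \<in> V \<and> (i < r \<longrightarrow> Q i < Q (Suc i))) \<and>
     \<not> (\<exists>Q. \<forall>i\<le>Suc r. Q i \<in> V \<and> (i < Suc r \<longrightarrow> Q i < Q (Suc i)))"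

definition runits :: "'K::field set \<Rightarrow> 'K set" where
  "runits P = {u \<in> P. u \<noteq> 0 \<and> 1 / u \<in> P}"

definition maxid :: "'K::field set \<Rightarrow> 'K set" where
  "maxid P = P - runits P"

text \<open>
  Smoothness of relative dimension r over k at P: near P, V is isomorphic to an open part of
  Spec of \<open>k[T_0,...,T_(m-1)]/(F_0,...,F_(m-r-1))\<close>, the Jacobian matrix of the F's having rank
  m-r at P. Since everything is of finite presentation, such a local isomorphism amounts to an
  isomorphism of local rings: in the third line P is identified with a localization of
  \<open>k[s_0,...,s_(m-1)]\<close>, and the fourth says that the relations between the s's are generated by the
  F's locally at P.
\<close>

definition smooth_at :: "('k::field \<Rightarrow> 'K::field) \<Rightarrow> nat \<Rightarrow> 'K set \<Rightarrow> bool" where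
  "smooth_at \<iota> r P \<longleftrightarrow> (\<exists>m (s :: nat \<Rightarrow> 'K) (F :: nat \<Rightarrow> 'k mpol).
     r \<le> m \<and> (\<forall>j<m. s j \<in> P) \<and> (\<forall>l<m - r. in_vars m (F l) \<and> eval_at \<iota> s (F l) = 0) \<and>
     P = {eval_at \<iota> s G / eval_at \<iota> s H |G H.
            in_vars m G \<and> in_vars m H \<and> eval_at \<iota> s H \<notin> maxid P} \<and>
     (\<forall>G. in_vars m G \<and> eval_at \<iota> s G = 0 \<longrightarrow>
        (\<exists>H. in_vars m H \<and> eval_at \<iota> s H \<notin> maxid P \<and>
           H * G \<in> ideal_gen {F. in_vars m F} (F ` {..<m - r}))) \<and>
     (\<exists>\<sigma>. inj_on \<sigma> {..<m - r} \<and> \<sigma> ` {..<m - r} \<subseteq> {..<m} \<and>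
        det (mat (m - r) (m - r) (\<lambda>(l, j). eval_at \<iota> s (partial (\<sigma> j) (F l)))) \<notin> maxid P))"

definition smooth_projective_variety ::
    "('k::field \<Rightarrow> 'K::field) \<Rightarrow> nat \<Rightarrow> (nat \<Rightarrow> 'K) \<Rightarrow> nat \<Rightarrow> bool" where
  "smooth_projective_variety \<iota> n t r \<longleftrightarrow>
     integral_projective \<iota> n t \<and> geom_integral \<iota> n t \<and>
     krull_dim_is (proj_points \<iota> n t) r \<and> (\<forall>P\<in>proj_points \<iota> n t. smooth_at \<iota> r P)"

section \<open>Rational points, local parameters, expansions\<close>

definition rational_point :: "('k::field \<Rightarrow> 'K::field) \<Rightarrow> 'K set \<Rightarrow> bool" where
  "rational_point \<iota> P \<longleftrightarrow> (\<forall>g\<in>P. \<exists>c. g - \<iota> c \<in> maxid P)"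

definition value_at :: "('k::field \<Rightarrow> 'K::field) \<Rightarrow> 'K set \<Rightarrow> 'K \<Rightarrow> 'k" where
  "value_at \<iota> P h = (THE c. h - \<iota> c \<in> maxid P)"

text \<open>At a rational point of a smooth variety of dimension r, a generating set of the maximal ideal
  is minimal iff it has r elements.\<close>

definition local_params :: "nat \<Rightarrow> 'K::field set \<Rightarrow> (nat \<Rightarrow> 'K) \<Rightarrow> bool" where
  "local_params r P x \<longleftrightarrow> x ` {..<r} \<subseteq> P \<and> maxid P = ideal_gen P (x ` {..<r})"

definition maxid_power :: "'K::field set \<Rightarrow> nat \<Rightarrow> 'K set" where
  "maxid_power P N = ideal_gen P {\<Prod>i<N. y i |y. \<forall>i<N. y i \<in> maxid P}"

text \<open>A power series in r variables is given by its coefficients, which vanish off the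
  multi-indices supported in \<open>{..<r}\<close>.\<close>

definition expands_to ::
    "('k::field \<Rightarrow> 'K::field) \<Rightarrow> nat \<Rightarrow> 'K set \<Rightarrow> (nat \<Rightarrow> 'K) \<Rightarrow> 'K \<Rightarrow> ((nat \<Rightarrow>\<^sub>0 nat) \<Rightarrow> 'k) \<Rightarrow> bool" where
  "expands_to \<iota> r P x g c \<longleftrightarrow> (\<forall>I. \<not> Poly_Mapping.keys I \<subseteq> {..<r} \<longrightarrow> c I = 0) \<and>
     (\<forall>N. g - (\<Sum>I | Poly_Mapping.keys I \<subseteq> {..<r} \<and> mdeg I < N. \<iota> (c I) * monom_at x I) \<in> maxid_power P N)"

definition expansion ::
    "('k::field \<Rightarrow> 'K::field) \<Rightarrow> nat \<Rightarrow> 'K set \<Rightarrow> (nat \<Rightarrow> 'K) \<Rightarrow> 'K \<Rightarrow> ((nat \<Rightarrow>\<^sub>0 nat) \<Rightarrow> 'k)" where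
  "expansion \<iota> r P x g = (THE c. expands_to \<iota> r P x g c)"

text \<open>Congruence of power series modulo the ideal of \<open>k[[x_0,...,x_(r-1)]]\<close> generated by the a-th
  powers of the variables: the difference is the sum of the products of \<open>x_j^a\<close> and \<open>q_j\<close>.\<close>

definition ps_cong ::
    "nat \<Rightarrow> nat \<Rightarrow> ((nat \<Rightarrow>\<^sub>0 nat) \<Rightarrow> 'k::field) \<Rightarrow> ((nat \<Rightarrow>\<^sub>0 nat) \<Rightarrow> 'k) \<Rightarrow> bool" where
  "ps_cong r a s s' \<longleftrightarrow> (\<exists>q :: nat \<Rightarrow> (nat \<Rightarrow>\<^sub>0 nat) \<Rightarrow> 'k. \<forall>I. Poly_Mapping.keys I \<subseteq> {..<r} \<longrightarrow>
     s I - s' I =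
       (\<Sum>j<r. if a \<le> Poly_Mapping.lookup I j then q j (I - Poly_Mapping.single j a) else 0))"

text \<open>The multi-index \<open>(a_0 - 1, ..., a_(r-1) - 1)\<close>.\<close>

definition top_index :: "nat \<Rightarrow> (nat \<Rightarrow> nat) \<Rightarrow> (nat \<Rightarrow>\<^sub>0 nat)" where
  "top_index r a = (\<Sum>i<r. Poly_Mapping.single i (a i - 1))"

section \<open>Rational differential forms\<close>

text \<open>
  The r-th exterior power of the module of differentials of 'K over k is identified with the space
  of alternating 'K-multilinear forms in r derivations of 'K over k; the wedge product of
  \<open>dx_0,...,dx_(r-1)\<close> becomes \<open>\<delta> \<mapsto> det (\<delta>_i x_j)\<close>. The arguments are a family indexed by nat, of
  which only the first r members count; for equality of forms to be equality of functions, a form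
  is 0 outside its domain.
\<close>

definition Der :: "('k::field \<Rightarrow> 'K::field) \<Rightarrow> ('K \<Rightarrow> 'K) set" where
  "Der \<iota> = {\<delta>. (\<forall>a b. \<delta> (a + b) = \<delta> a + \<delta> b) \<and> (\<forall>a b. \<delta> (a * b) = a * \<delta> b + b * \<delta> a) \<and>
               (\<forall>c. \<delta> (\<iota> c) = 0)}"

type_synonym 'K dform = "(nat \<Rightarrow> 'K \<Rightarrow> 'K) \<Rightarrow> 'K"

definition forms :: "('k::field \<Rightarrow> 'K::field) \<Rightarrow> nat \<Rightarrow> 'K dform set" where
  "forms \<iota> r = {\<omega>.
     (\<forall>\<delta> \<delta>'. (\<forall>i<r. \<delta> i = \<delta>' i) \<longrightarrow> \<omega> \<delta> = \<omega> \<delta>') \<and>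
     (\<forall>\<delta>. (\<exists>i<r. \<delta> i \<notin> Der \<iota>) \<longrightarrow> \<omega> \<delta> = 0) \<and>
     (\<forall>\<delta> i D E. i < r \<and> D \<in> Der \<iota> \<and> E \<in> Der \<iota> \<longrightarrow>
        \<omega> (\<delta>(i := (\<lambda>z. D z + E z))) = \<omega> (\<delta>(i := D)) + \<omega> (\<delta>(i := E))) \<and>
     (\<forall>\<delta> i D a. i < r \<and> D \<in> Der \<iota> \<longrightarrow> \<omega> (\<delta>(i := (\<lambda>z. a * D z))) = a * \<omega> (\<delta>(i := D))) \<and>
     (\<forall>\<delta> i j. i < r \<and> j < r \<and> i \<noteq> j \<and> \<delta> i = \<delta> j \<longrightarrow> \<omega> \<delta> = 0)}"

definition dwedge :: "('k::field \<Rightarrow> 'K::field) \<Rightarrow> nat \<Rightarrow> (nat \<Rightarrow> 'K) \<Rightarrow> 'K dform" where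
  "dwedge \<iota> r x = (\<lambda>\<delta>. if \<forall>i<r. \<delta> i \<in> Der \<iota> then det (mat r r (\<lambda>(i, j). \<delta> i (x j))) else 0)"

definition fscale :: "'K::field \<Rightarrow> 'K dform \<Rightarrow> 'K dform" where
  "fscale g \<omega> = (\<lambda>\<delta>. g * \<omega> \<delta>)"

definition form_quot :: "('k::field \<Rightarrow> 'K::field) \<Rightarrow> nat \<Rightarrow> 'K dform \<Rightarrow> (nat \<Rightarrow> 'K) \<Rightarrow> 'K" where
  "form_quot \<iota> r \<omega> x = (THE w. \<omega> = fscale w (dwedge \<iota> r x))"

definition regular_forms :: "('k::field \<Rightarrow> 'K::field) \<Rightarrow> nat \<Rightarrow> 'K set \<Rightarrow> 'K dform set" where
  "regular_forms \<iota> r P = {(\<lambda>\<delta>. \<Sum>l<N. a l * dwedge \<iota> r (b l) \<delta>) |(N::nat) a b.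
     \<forall>l<N. a l \<in> P \<and> (\<forall>i<r. b l i \<in> P)}"

section \<open>Divisors\<close>

text \<open>The sets of those points at which finitely many given rational functions are regular form a
  basis of the Zariski topology.\<close>

definition zariski_open :: "'K set set \<Rightarrow> 'K set set \<Rightarrow> bool" where
  "zariski_open V U \<longleftrightarrow> U \<subseteq> V \<and> (\<forall>P\<in>U. \<exists>S. finite S \<and> S \<subseteq> P \<and> {Q \<in> V. S \<subseteq> Q} \<subseteq> U)"

text \<open>A Cartier divisor, given by the set of its local equations at each point.\<close>

type_synonym 'K cdiv = "'K set \<Rightarrow> 'K set"

definition cdivisor :: "'K::field set set \<Rightarrow> 'K cdiv \<Rightarrow> bool" where
  "cdivisor V D \<longleftrightarrow> (\<forall>P. P \<notin> V \<longrightarrow> D P = {}) \<and>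
     (\<forall>P\<in>V. \<exists>f. f \<noteq> 0 \<and> D P = {f * u |u. u \<in> runits P}) \<and>
     (\<forall>P\<in>V. \<forall>f\<in>D P. \<exists>U. zariski_open V U \<and> P \<in> U \<and> (\<forall>Q\<in>U. f \<in> D Q))"

definition effective :: "'K::field set set \<Rightarrow> 'K cdiv \<Rightarrow> bool" where
  "effective V D \<longleftrightarrow> (\<forall>P\<in>V. D P \<subseteq> P)"

definition supp :: "'K::field set set \<Rightarrow> 'K cdiv \<Rightarrow> 'K set set" where
  "supp V D = {P \<in> V. 1 \<notin> D P}"

definition div_add :: "'K::field cdiv \<Rightarrow> 'K cdiv \<Rightarrow> 'K cdiv" where
  "div_add D E = (\<lambda>P. {f * g |f g. f \<in> D P \<and> g \<in> E P})"

definition div_diff :: "'K::field cdiv \<Rightarrow> 'K cdiv \<Rightarrow> 'K cdiv" where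
  "div_diff D E = (\<lambda>P. {f / g |f g. f \<in> D P \<and> g \<in> E P})"

definition div_fun :: "'K::field set set \<Rightarrow> 'K \<Rightarrow> 'K cdiv" where
  "div_fun V g = (\<lambda>P. if P \<in> V then {g * u |u. u \<in> runits P} else {})"

definition div_sum :: "'K::field set set \<Rightarrow> nat \<Rightarrow> (nat \<Rightarrow> 'K cdiv) \<Rightarrow> 'K cdiv" where
  "div_sum V r D = (\<lambda>P. if P \<in> V then {(\<Prod>i<r. f i) * u |f u. (\<forall>i<r. f i \<in> D i P) \<and> u \<in> runits P} else {})"

text \<open>A local equation at P of the divisor of a form \<open>\<omega>\<close> is the quotient of \<open>\<omega>\<close> by a generator of
  the module of forms regular at P.\<close>

definition div_form :: "('k::field \<Rightarrow> 'K::field) \<Rightarrow> nat \<Rightarrow> 'K set set \<Rightarrow> 'K dform \<Rightarrow> 'K cdiv" where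
  "div_form \<iota> r V \<omega> = (\<lambda>P. if P \<in> V then
     {w. \<exists>\<eta>. regular_forms \<iota> r P = {fscale a \<eta> |a. a \<in> P} \<and> \<omega> = fscale w \<eta>} else {})"

text \<open>Generic points of the irreducible components of a closed set.\<close>

definition components :: "'K set set \<Rightarrow> 'K set set" where
  "components Z = {Q \<in> Z. \<forall>Q'\<in>Z. Q \<subseteq> Q' \<longrightarrow> Q' = Q}"

definition positive_part :: "'K::field set set \<Rightarrow> 'K cdiv \<Rightarrow> 'K cdiv \<Rightarrow> bool" where
  "positive_part V H Hp \<longleftrightarrow> (\<exists>Hn. cdivisor V Hp \<and> effective V Hp \<and> cdivisor V Hn \<and> effective V Hn \<and>
     H = div_diff Hp Hn \<and> components (supp V Hp) \<inter> components (supp V Hn) = {})"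

definition Omega_of :: "('k::field \<Rightarrow> 'K::field) \<Rightarrow> nat \<Rightarrow> 'K set set \<Rightarrow> 'K cdiv \<Rightarrow> 'K dform set" where
  "Omega_of \<iota> r V H =
     {\<omega> \<in> forms \<iota> r. \<omega> \<noteq> (\<lambda>_. 0) \<and> effective V (div_add (div_form \<iota> r V \<omega>) H)} \<union> {\<lambda>_. 0}"

definition common_points :: "'K::field set set \<Rightarrow> nat \<Rightarrow> (nat \<Rightarrow> 'K cdiv) \<Rightarrow> 'K set set" where
  "common_points V r D = {P \<in> V. \<forall>i<r. P \<in> supp V (D i)}"

section \<open>Residues\<close>

text \<open>
  The residue symbols are defined through choices of local equations, local parameters, an exponent
  and a transition matrix, of which they are independent. Each \<open>SOME\<close> below makes such a choice; it
  depends on the point and the divisors only, not on the form.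
\<close>

definition residue_monomial ::
    "('k::field \<Rightarrow> 'K::field) \<Rightarrow> nat \<Rightarrow> 'K set \<Rightarrow> (nat \<Rightarrow> 'K) \<Rightarrow> (nat \<Rightarrow> nat) \<Rightarrow> 'K dform \<Rightarrow> 'k" where
  "residue_monomial \<iota> r P x a \<omega> = expansion \<iota> r P x (form_quot \<iota> r \<omega> x) (top_index r a)"

definition transition_det :: "nat \<Rightarrow> 'K::field set \<Rightarrow> (nat \<Rightarrow> 'K) \<Rightarrow> (nat \<Rightarrow> 'K) \<Rightarrow> nat \<Rightarrow> 'K" where
  "transition_det r P x f a = det (SOME M. M \<in> carrier_mat r r \<and>
     (\<forall>i<r. (\<forall>j<r. M $$ (i, j) \<in> P) \<and> x i ^ a = (\<Sum>j<r. M $$ (i, j) * f j)))"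

definition admissible_exponent ::
    "nat \<Rightarrow> 'K::field set \<Rightarrow> (nat \<Rightarrow> 'K) \<Rightarrow> (nat \<Rightarrow> 'K) \<Rightarrow> nat \<Rightarrow> bool" where
  "admissible_exponent r P x f a \<longleftrightarrow> a > 0 \<and> (\<forall>i<r. x i ^ a \<in> ideal_gen P (f ` {..<r}))"

definition residue_params ::
    "('k::field \<Rightarrow> 'K::field) \<Rightarrow> nat \<Rightarrow> 'K set \<Rightarrow> (nat \<Rightarrow> 'K) \<Rightarrow> 'K dform \<Rightarrow> 'k" where
  "residue_params \<iota> r P f \<omega> =
     (let (x, a) = (SOME (x, a). local_params r P x \<and> admissible_exponent r P x f a)
      in residue_monomial \<iota> r P x (\<lambda>_. a) (fscale (transition_det r P x f a) \<omega>))"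

definition residue ::
    "('k::field \<Rightarrow> 'K::field) \<Rightarrow> nat \<Rightarrow> 'K set set \<Rightarrow> (nat \<Rightarrow> 'K cdiv) \<Rightarrow> 'K set \<Rightarrow> 'K dform \<Rightarrow> 'k" where
  "residue \<iota> r V D P \<omega> =
     (if P \<in> common_points V r D
      then let f = (SOME f. \<forall>j<r. f j \<in> D j P) in residue_params \<iota> r P f (fscale (\<Prod>j<r. f j) \<omega>)
      else 0)"

section \<open>Rectifying functions\<close>

definition local_data ::
    "nat \<Rightarrow> 'K::field set set \<Rightarrow> (nat \<Rightarrow> 'K cdiv) \<Rightarrow>
     ('K set \<Rightarrow> nat \<Rightarrow> 'K) \<Rightarrow> ('K set \<Rightarrow> nat \<Rightarrow> 'K) \<Rightarrow> ('K set \<Rightarrow> nat) \<Rightarrow> bool" where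
  "local_data r V D x f a \<longleftrightarrow> (\<forall>P\<in>common_points V r D.
     local_params r P (x P) \<and> (\<forall>j<r. f P j \<in> D j P) \<and> admissible_exponent r P (x P) (f P) (a P))"

definition rectifying ::
    "('k::field \<Rightarrow> 'K::field) \<Rightarrow> nat \<Rightarrow> 'K set set \<Rightarrow> (nat \<Rightarrow> 'K cdiv) \<Rightarrow> 'K set set \<Rightarrow>
     ('K set \<Rightarrow> nat \<Rightarrow> 'K) \<Rightarrow> ('K set \<Rightarrow> nat \<Rightarrow> 'K) \<Rightarrow> ('K set \<Rightarrow> nat) \<Rightarrow> 'K \<Rightarrow> bool" where
  "rectifying \<iota> r V D PP x f a \<theta> \<longleftrightarrow> \<theta> \<noteq> 0 \<and>
     (\<forall>P\<in>common_points V r D. \<theta> \<in> P \<and>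
        (let s = expansion \<iota> r P (x P) (transition_det r P (x P) (f P) (a P) * \<theta>) in
           (P \<in> PP \<longrightarrow> (\<exists>c. ps_cong r (a P) s (\<lambda>I. if I = top_index r (\<lambda>_. a P) then c else 0))) \<and>
           (P \<notin> PP \<longrightarrow> ps_cong r (a P) s (\<lambda>_. 0))))"

definition regular_quot ::
    "('k::field \<Rightarrow> 'K::field) \<Rightarrow> nat \<Rightarrow> (nat \<Rightarrow> 'K cdiv) \<Rightarrow> 'K \<Rightarrow> 'K dform \<Rightarrow> 'K set \<Rightarrow> bool" where
  "regular_quot \<iota> r D \<theta> \<omega> P \<longleftrightarrow> (\<exists>f x. (\<forall>j<r. f j \<in> D j P) \<and> local_params r P x \<and>
     (\<Prod>j<r. f j) * form_quot \<iota> r \<omega> x / \<theta> \<in> P)"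

end

(*
  Let P be a rational point of a smooth variety with local parameters x and maximal ideal m, let
  x^a = M f and R = det M. The condition on theta says that R theta m lies in (x^a), and that R theta
  does if P is not in PP. The residue of omega is the top coefficient modulo (x^a) of R g theta with g
  regular, and h - h(P) lies in m, so both claims follow if one choice of x, f, a, M serves everywhere.

  The rectifying data and the residue use different choices, so one needs: if R z lies in (x^a) for one
  choice, then also for every other one. After passing to large powers this says that det M is
  determined modulo (x^b) by x^b = M f. Changing the i-th row of M changes det M by some w with f_l w in
  (x_k^b : k not i) for all l, by Cramer's rule; hence x_i^b w lies in that ideal, and that w lies in
  (x^b) can be read off the power series expansion of w.

  Existence and uniqueness of expansions come from smoothness: near P the variety is cut out of affine
  m-space by m - r equations F, so F and lifts of x are parameters of affine space, and Hensel's lemma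
  yields truncated power series at which F vanishes and x takes the values X. The same Jacobian matrix,
  inverted over the local ring, gives a basis of the derivations that is dual to x modulo m.
*)

theory Submission
  imports Defs
begin


section \<open>Evaluation of polynomials\<close>

text \<open>All the algebra of residues rests on two facts about expansions: membership in (x_i^b)
  is visible in the coefficients whose exponents are all below b, and a monomial factor shifts
  coefficients. Both come from \<open>hsum_leading\<close>: a form of degree d in the parameters
  with value in m^(d+1) has zero coefficients, so the associated graded ring is a polynomial ring.
  Polynomials modulo high order play the part of power series there. The colon property behind the
  comparison of matrices is applied to powers of x, where expansions decide it.

  The passage to large powers is forced. x_i^a need not lie in (x0^a0), but x_i^(a+e) does once e
  exceeds r a0, and is then a combination of the f in two ways, through x0^a0 and through x_i^a. The
  price is the factor given by the product of all x_i^e, which is cancelled at the end.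

  What travels between two choices is membership in (x^a), not the value of a residue: each claim is
  reduced to an element of (x^a), and its top coefficient vanishes because all exponents of the top
  index equal a - 1.\<close>

abbreviation mcon :: "'k::zero \<Rightarrow> 'k mpol" where
  "mcon \<equiv> Poly_Mapping.single 0"

definition mvar :: "nat \<Rightarrow> 'k::zero_neq_one mpol" where
  "mvar j = Poly_Mapping.single (Poly_Mapping.single j 1) 1"

lemma keys_add_nat:
  fixes I J :: "nat \<Rightarrow>\<^sub>0 nat"
  shows "Poly_Mapping.keys (I + J) = Poly_Mapping.keys I \<union> Poly_Mapping.keys J"
  by (auto simp: in_keys_iff lookup_add)

lemma monom_at_superset:
  assumes "finite A" "Poly_Mapping.keys I \<subseteq> A"
  shows "monom_at t I = (\<Prod>i\<in>A. t i ^ Poly_Mapping.lookup I i)"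
  unfolding monom_at_def using assms
  by (intro prod.mono_neutral_left) (auto simp: in_keys_iff)

lemma monom_at_zero [simp]: "monom_at t 0 = 1"
  by (simp add: monom_at_def)

lemma monom_at_single [simp]: "monom_at t (Poly_Mapping.single j a) = t j ^ a"
  by (cases "a = 0") (simp_all add: monom_at_def)

lemma monom_at_add: "monom_at t (I + J) = monom_at t I * monom_at t J"
proof -
  let ?A = "Poly_Mapping.keys I \<union> Poly_Mapping.keys J"
  show ?thesis
    by (simp add: monom_at_superset[of ?A] keys_add_nat lookup_add power_add prod.distrib)
qed

lemma mdeg_superset:
  assumes "finite A" "Poly_Mapping.keys I \<subseteq> A"
  shows "mdeg I = (\<Sum>i\<in>A. Poly_Mapping.lookup I i)"
  unfolding mdeg_def using assms
  by (intro sum.mono_neutral_left) (auto simp: in_keys_iff)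

lemma mdeg_zero [simp]: "mdeg 0 = 0"
  by (simp add: mdeg_def)

lemma mdeg_single [simp]: "mdeg (Poly_Mapping.single j a) = a"
  by (cases "a = 0") (simp_all add: mdeg_def)

lemma mdeg_add: "mdeg (I + J) = mdeg I + mdeg J"
  by (simp add: mdeg_superset[of "Poly_Mapping.keys I \<union> Poly_Mapping.keys J"]
      keys_add_nat lookup_add sum.distrib)

lemma mdeg_eq_0_iff: "mdeg I = 0 \<longleftrightarrow> I = 0"
proof
  assume "mdeg I = 0"
  then have "\<forall>i\<in>Poly_Mapping.keys I. Poly_Mapping.lookup I i = 0"
    unfolding mdeg_def by (subst (asm) sum_eq_0_iff) auto
  then show "I = 0" by (intro poly_mapping_eqI) (auto simp: in_keys_iff)
qed simp

lemma lookup_le_mdeg: "Poly_Mapping.lookup I i \<le> mdeg I"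
proof (cases "i \<in> Poly_Mapping.keys I")
  case True
  then show ?thesis unfolding mdeg_def by (intro member_le_sum) auto
qed (simp add: in_keys_iff)

lemma mpol_decompose:
  "F = (\<Sum>I\<in>Poly_Mapping.keys F. Poly_Mapping.single I (Poly_Mapping.lookup F I))"
  by (rule poly_mapping_eqI) (auto simp: lookup_sum lookup_single when_def in_keys_iff)

lemma eval_at_superset:
  assumes "finite A" "Poly_Mapping.keys F \<subseteq> A" "\<iota> 0 = 0"
  shows "eval_at \<iota> t F = (\<Sum>I\<in>A. \<iota> (Poly_Mapping.lookup F I) * monom_at t I)"
  unfolding eval_at_def using assms
  by (intro sum.mono_neutral_left) (auto simp: in_keys_iff)

context comm_ring_hom
begin

lemma eval_single [simp]: "eval_at hom t (Poly_Mapping.single I c) = hom c * monom_at t I"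
  by (cases "c = 0") (simp_all add: eval_at_def)

lemma eval_zero [simp]: "eval_at hom t 0 = 0"
  by (simp add: eval_at_def)

lemma eval_one [simp]: "eval_at hom t 1 = 1"
  using eval_single[of t 0 1] by simp

lemma eval_var [simp]: "eval_at hom t (mvar j) = t j"
  by (simp add: mvar_def)

lemma eval_add: "eval_at hom t (F + G) = eval_at hom t F + eval_at hom t G"
proof -
  let ?A = "Poly_Mapping.keys F \<union> Poly_Mapping.keys G"
  have "Poly_Mapping.keys (F + G) \<subseteq> ?A" by (rule keys_add)
  then show ?thesis
    by (simp add: eval_at_superset[of ?A] lookup_add hom_add ring_distribs sum.distrib)
qed

lemma eval_sum: "eval_at hom t (\<Sum>i\<in>A. F i) = (\<Sum>i\<in>A. eval_at hom t (F i))"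
  by (induction A rule: infinite_finite_induct) (simp_all add: eval_add)

lemma eval_mult: "eval_at hom t (F * G) = eval_at hom t F * eval_at hom t G"
proof -
  let ?s = "\<lambda>F I. Poly_Mapping.single I (Poly_Mapping.lookup F I)"
  have "F * G = (\<Sum>I\<in>Poly_Mapping.keys F. ?s F I) * (\<Sum>J\<in>Poly_Mapping.keys G. ?s G J)"
    using mpol_decompose[of F] mpol_decompose[of G] by simp
  also have "\<dots> = (\<Sum>I\<in>Poly_Mapping.keys F. \<Sum>J\<in>Poly_Mapping.keys G.
      Poly_Mapping.single (I + J) (Poly_Mapping.lookup F I * Poly_Mapping.lookup G J))"
    by (simp add: sum_product mult_single)
  also have "eval_at hom t \<dots> = eval_at hom t F * eval_at hom t G"
    by (simp only: eval_sum eval_single) (simp add: eval_at_def sum_product monom_at_add hom_mult mult_ac)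
  finally show ?thesis .
qed

lemma eval_uminus: "eval_at hom t (- F) = - eval_at hom t F"
  using eval_add[of t F "- F"] by (simp add: eq_neg_iff_add_eq_0 add.commute)

lemma eval_minus: "eval_at hom t (F - G) = eval_at hom t F - eval_at hom t G"
  using eval_add[of t F "- G"] by (simp add: eval_uminus)

end

lemma in_vars_zero [simp]: "in_vars m 0"
  by (simp add: in_vars_def)

lemma in_vars_con [simp]: "in_vars m (mcon c)"
  by (simp add: in_vars_def)

lemma in_vars_one [simp]: "in_vars m 1"
  by (simp add: in_vars_def)

lemma in_vars_var [simp]: "j < m \<Longrightarrow> in_vars m (mvar j)"
  by (simp add: in_vars_def mvar_def)

lemma in_vars_add [intro]: "in_vars m F \<Longrightarrow> in_vars m G \<Longrightarrow> in_vars m (F + G)"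
  using keys_add[of F G] unfolding in_vars_def by blast

lemma in_vars_mult [intro]:
  fixes F G :: "'k::semiring_0 mpol"
  shows "in_vars m F \<Longrightarrow> in_vars m G \<Longrightarrow> in_vars m (F * G)"
  using keys_mult[of F G] unfolding in_vars_def by (fastforce simp: keys_add_nat)

lemma in_vars_uminus [intro]:
  fixes F :: "'k::ab_group_add mpol"
  shows "in_vars m F \<Longrightarrow> in_vars m (- F)"
  unfolding in_vars_def by (simp add: in_keys_iff)

lemma in_vars_minus [intro]:
  fixes F G :: "'k::ab_group_add mpol"
  shows "in_vars m F \<Longrightarrow> in_vars m G \<Longrightarrow> in_vars m (F - G)"
  using in_vars_add[of m F "- G"] in_vars_uminus[of m G] by simp

lemma in_vars_sum [intro]:
  "(\<And>i. i \<in> A \<Longrightarrow> in_vars m (F i)) \<Longrightarrow> in_vars m (\<Sum>i\<in>A. F i)"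
  by (induction A rule: infinite_finite_induct) (auto intro: in_vars_add)

lemma mcon_hom: "comm_ring_hom (mcon :: 'k::comm_ring_1 \<Rightarrow> 'k mpol)"
  by unfold_locales (simp_all add: mult_single single_add)

lemma id_hom: "comm_ring_hom (\<lambda>c :: 'k::comm_ring_1. c)"
  by unfold_locales simp_all

lemma pCons_hom:
  assumes "comm_ring_hom (\<iota> :: 'k::comm_ring_1 \<Rightarrow> 'K::comm_ring_1)"
  shows "comm_ring_hom (\<lambda>c. [:\<iota> c:])"
proof -
  interpret comm_ring_hom \<iota> by fact
  show ?thesis by unfold_locales (simp_all add: hom_add hom_mult)
qed

lemma monom_at_mvar: "monom_at mvar I = Poly_Mapping.single I (1::'k::comm_semiring_1)"
proof -
  have 1: "mvar i ^ a = Poly_Mapping.single (Poly_Mapping.single i a) (1::'k)" for i a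
    by (induction a) (simp_all add: mvar_def mult_single flip: single_add)
  have 2: "(\<Prod>i\<in>A. Poly_Mapping.single (f i) (1::'k)) = Poly_Mapping.single (\<Sum>i\<in>A. f i) 1"
    for A and f :: "nat \<Rightarrow> nat \<Rightarrow>\<^sub>0 nat"
    by (induction A rule: infinite_finite_induct) (simp_all add: mult_single)
  have "(\<Sum>i\<in>Poly_Mapping.keys I. Poly_Mapping.single i (Poly_Mapping.lookup I i)) = I"
    by (rule poly_mapping_eqI) (auto simp: lookup_sum lookup_single when_def in_keys_iff)
  then show ?thesis by (simp add: monom_at_def 1 2)
qed

text \<open>Constants and variables generate the polynomials in m variables, so statements
  compatible with sum and product can be proved without a look at coefficients.\<close>

lemma mpol_induct [consumes 1, case_names con var add mult]:
  fixes F :: "'k::comm_ring_1 mpol"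
  assumes "in_vars m F"
    and con: "\<And>c. P (mcon c)" and var: "\<And>j. j < m \<Longrightarrow> P (mvar j)"
    and add: "\<And>F G. in_vars m F \<Longrightarrow> in_vars m G \<Longrightarrow> P F \<Longrightarrow> P G \<Longrightarrow> P (F + G)"
    and mult: "\<And>F G. in_vars m F \<Longrightarrow> in_vars m G \<Longrightarrow> P F \<Longrightarrow> P G \<Longrightarrow> P (F * G)"
  shows "P F"
proof -
  have pow: "P (mvar j ^ a) \<and> in_vars m (mvar j ^ a :: 'k mpol)" if "j < m" for j a
    using that con[of 1] by (induction a) (auto intro!: mult var)
  have monom: "P (Poly_Mapping.single I 1) \<and> in_vars m (Poly_Mapping.single I (1::'k))"
    if "Poly_Mapping.keys I \<subseteq> {..<m}" for I
  proof -
    have "P (\<Prod>i\<in>A. mvar i ^ Poly_Mapping.lookup I i) \<and>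
        in_vars m (\<Prod>i\<in>A. mvar i ^ Poly_Mapping.lookup I i :: 'k mpol)"
      if "finite A" "A \<subseteq> {..<m}" for A
      using that con[of 1] by (induction A) (auto intro!: mult simp: pow)
    from this[of "Poly_Mapping.keys I"] that show ?thesis by (simp add: monom_at_def flip: monom_at_mvar)
  qed
  have trm: "P (Poly_Mapping.single I c) \<and> in_vars m (Poly_Mapping.single I c)"
    if "Poly_Mapping.keys I \<subseteq> {..<m}" for I and c :: 'k
    using monom[OF that] mult[of "mcon c" "Poly_Mapping.single I 1"] con[of c]
      in_vars_mult[of m "mcon c" "Poly_Mapping.single I 1"] by (simp add: mult_single)
  have "P (\<Sum>I\<in>A. Poly_Mapping.single I (Poly_Mapping.lookup F I)) \<and>
      in_vars m (\<Sum>I\<in>A. Poly_Mapping.single I (Poly_Mapping.lookup F I))"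
    if "finite A" "A \<subseteq> Poly_Mapping.keys F" for A
    using that
  proof (induction A)
    case empty
    then show ?case using con[of 0] by simp
  next
    case (insert I A)
    then have "Poly_Mapping.keys I \<subseteq> {..<m}" using assms(1) by (auto simp: in_vars_def)
    then show ?case using insert trm[of I] by (auto intro!: add)
  qed
  from this[of "Poly_Mapping.keys F"] show ?thesis using mpol_decompose[of F] by simp
qed

text \<open>The derivative of \<open>F\<close> at \<open>s\<close> in direction \<open>v\<close>, as the linear coefficient of \<open>F\<close> along
  the line \<open>s + v T\<close>.\<close>

definition ddir :: "('k::comm_ring_1 \<Rightarrow> 'K::comm_ring_1) \<Rightarrow> (nat \<Rightarrow> 'K) \<Rightarrow> (nat \<Rightarrow> 'K) \<Rightarrow> 'k mpol \<Rightarrow> 'K" where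
  "ddir \<iota> s v F = Polynomial.coeff (eval_at (\<lambda>c. [:\<iota> c:]) (\<lambda>j. [:s j, v j:]) F) 1"

context comm_ring_hom
begin

lemma ddir_con [simp]: "ddir hom s v (mcon c) = 0"
  using comm_ring_hom.eval_single[OF pCons_hom[OF comm_ring_hom_axioms], of _ 0 c] by (simp add: ddir_def)

lemma ddir_zero [simp]: "ddir hom s v 0 = 0"
  using ddir_con[of s v 0] by simp

lemma ddir_var [simp]: "ddir hom s v (mvar j) = v j"
  by (simp add: ddir_def comm_ring_hom.eval_var[OF pCons_hom[OF comm_ring_hom_axioms]])

lemma ddir_add: "ddir hom s v (F + G) = ddir hom s v F + ddir hom s v G"
  by (simp add: ddir_def comm_ring_hom.eval_add[OF pCons_hom[OF comm_ring_hom_axioms]])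

lemma ddir_minus: "ddir hom s v (F - G) = ddir hom s v F - ddir hom s v G"
  by (simp add: ddir_def comm_ring_hom.eval_minus[OF pCons_hom[OF comm_ring_hom_axioms]])

lemma ddir_sum: "ddir hom s v (\<Sum>i\<in>A. F i) = (\<Sum>i\<in>A. ddir hom s v (F i))"
  by (induction A rule: infinite_finite_induct) (simp_all add: ddir_add)

text \<open>The constant term along a line is the value at its starting point. Hence the product
  rule \<open>ddir_mult\<close> is the formula for the linear coefficient of a product of
  polynomials in T.\<close>

lemma coeff_0_line:
  "Polynomial.coeff (eval_at (\<lambda>c. [:hom c:]) (\<lambda>j. [:s j, v j:]) F) 0 = eval_at hom s F"
proof -
  have 1: "Polynomial.coeff p 0 = poly p 0" for p :: "'b poly"
    by (simp add: poly_0_coeff_0)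
  have "poly (monom_at (\<lambda>j. [:s j, v j:]) I) 0 = monom_at s I" for I
    by (simp add: monom_at_def poly_prod)
  then show ?thesis
    by (simp add: 1 eval_at_def poly_sum)
qed

lemma ddir_mult:
  "ddir hom s v (F * G) = eval_at hom s F * ddir hom s v G + eval_at hom s G * ddir hom s v F"
  by (simp add: ddir_def comm_ring_hom.eval_mult[OF pCons_hom[OF comm_ring_hom_axioms]]
      coeff_mult coeff_0_line mult.commute)

lemma ddir_linear:
  assumes "in_vars m F"
  shows "ddir hom s (\<lambda>j. \<Sum>k\<in>A. b k * v k j) F = (\<Sum>k\<in>A. b k * ddir hom s (v k) F)"
  using assms
proof (induction F rule: mpol_induct)
  case (mult F G)
  then show ?case by (simp add: ddir_mult sum_distrib_left sum.distrib algebra_simps)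
qed (simp_all add: ddir_add sum.distrib algebra_simps)

lemma ddir_cong:
  assumes "in_vars m F" "\<And>j. j < m \<Longrightarrow> v j = w j"
  shows "ddir hom s v F = ddir hom s w F"
  using assms(1)
  by (induction F rule: mpol_induct) (simp_all add: ddir_add ddir_mult assms(2))

end

abbreviation unitv :: "nat \<Rightarrow> nat \<Rightarrow> 'a::zero_neq_one" where
  "unitv j \<equiv> (\<lambda>i. if i = j then 1 else 0)"

text \<open>Derivatives in the directions \<open>unitv j\<close> serve as partial derivatives and
  hence as entries of the Jacobian matrices.\<close>

lemma (in comm_ring_hom) ddir_expand:
  assumes "in_vars m F"
  shows "ddir hom s v F = (\<Sum>j<m. v j * ddir hom s (unitv j) F)"
proof -
  have "ddir hom s v F = ddir hom s (\<lambda>i. \<Sum>j<m. v j * unitv j i) F"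
    using assms by (rule ddir_cong) (simp add: if_distrib cong: if_cong)
  then show ?thesis by (simp only: ddir_linear[OF assms])
qed


section \<open>Subrings and ideals\<close>

text \<open>Closure conditions on subsets keep the arithmetic in the ambient type;
  \<open>ideal_subring_of\<close> connects them with the records behind \<open>ideal_gen\<close> and
  \<open>prime_in\<close>.\<close>

definition is_subring :: "'a::comm_ring_1 set \<Rightarrow> bool" where
  "is_subring A \<longleftrightarrow> 0 \<in> A \<and> 1 \<in> A \<and> (\<forall>a\<in>A. \<forall>b\<in>A. a + b \<in> A \<and> a * b \<in> A) \<and> (\<forall>a\<in>A. - a \<in> A)"

definition is_ideal :: "'a::comm_ring_1 set \<Rightarrow> 'a set \<Rightarrow> bool" where
  "is_ideal A J \<longleftrightarrow> J \<subseteq> A \<and> 0 \<in> J \<and> (\<forall>a\<in>J. \<forall>b\<in>J. a + b \<in> J) \<and> (\<forall>a\<in>A. \<forall>b\<in>J. a * b \<in> J)"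

lemma is_subringD:
  assumes "is_subring A"
  shows "0 \<in> A" "1 \<in> A" "a \<in> A \<Longrightarrow> b \<in> A \<Longrightarrow> a + b \<in> A" "a \<in> A \<Longrightarrow> b \<in> A \<Longrightarrow> a * b \<in> A"
    "a \<in> A \<Longrightarrow> - a \<in> A" "a \<in> A \<Longrightarrow> b \<in> A \<Longrightarrow> a - b \<in> A"
  using assms unfolding is_subring_def by (auto simp only: diff_conv_add_uminus)

lemma is_subring_sum:
  assumes "is_subring A" "\<And>i. i \<in> S \<Longrightarrow> g i \<in> A"
  shows "(\<Sum>i\<in>S. g i) \<in> A"
  using assms by (induction S rule: infinite_finite_induct) (auto intro: is_subringD)

lemma is_subring_prod:
  assumes "is_subring A" "\<And>i. i \<in> S \<Longrightarrow> g i \<in> A"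
  shows "(\<Prod>i\<in>S. g i) \<in> A"
  using assms by (induction S rule: infinite_finite_induct) (auto intro: is_subringD)

lemma is_subring_power:
  assumes "is_subring A" "g \<in> A"
  shows "g ^ n \<in> A"
  using assms by (induction n) (auto intro: is_subringD)

lemma is_idealD:
  assumes "is_ideal A J"
  shows "J \<subseteq> A" "0 \<in> J" "a \<in> J \<Longrightarrow> b \<in> J \<Longrightarrow> a + b \<in> J"
    "a \<in> A \<Longrightarrow> b \<in> J \<Longrightarrow> a * b \<in> J" "b \<in> A \<Longrightarrow> a \<in> J \<Longrightarrow> a * b \<in> J"
  using assms unfolding is_ideal_def by (auto simp: mult.commute)

lemma is_ideal_uminus: "is_subring A \<Longrightarrow> is_ideal A J \<Longrightarrow> a \<in> J \<Longrightarrow> - a \<in> J"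
  using is_idealD(4)[of A J "- 1" a] is_subringD(2,5)[of A] by simp

lemma is_ideal_diff: "is_subring A \<Longrightarrow> is_ideal A J \<Longrightarrow> a \<in> J \<Longrightarrow> b \<in> J \<Longrightarrow> a - b \<in> J"
  using is_ideal_uminus[of A J b] is_idealD(3)[of A J a "- b"] by simp

lemma is_ideal_sum:
  assumes "is_ideal A J" "\<And>i. i \<in> S \<Longrightarrow> g i \<in> J"
  shows "(\<Sum>i\<in>S. g i) \<in> J"
  using assms by (induction S rule: infinite_finite_induct) (auto intro: is_idealD)

lemma cring_subring_of: "is_subring A \<Longrightarrow> cring (subring_of A)"
  unfolding subring_of_def
  by (intro cringI abelian_groupI comm_monoidI)
    (auto simp: is_subring_def ring_distribs mult_ac add_ac intro: exI[of _ "- x" for x] intro!: bexI[of _ "- x" for x])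

lemma ideal_subring_of:
  assumes "is_subring A"
  shows "ideal J (subring_of A) \<longleftrightarrow> is_ideal A J"
proof
  interpret R: cring "subring_of A" using assms by (rule cring_subring_of)
  assume "ideal J (subring_of A)"
  then interpret I: ideal J "subring_of A" .
  show "is_ideal A J"
    using I.a_subset I.zero_closed I.a_closed I.I_l_closed
    by (auto simp: is_ideal_def subring_of_def)
next
  interpret R: cring "subring_of A" using assms by (rule cring_subring_of)
  assume J: "is_ideal A J"
  have minus: "\<ominus>\<^bsub>subring_of A\<^esub> a = - a" if "a \<in> A" for a
    using that is_subringD(5)[OF assms that]
    by (intro R.minus_equality) (auto simp: subring_of_def)
  have minus': "inv\<^bsub>\<lparr>carrier = A, monoid.mult = (+), one = 0\<rparr>\<^esub> a = - a" if "a \<in> J" for a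
    using minus[of a] that is_idealD(1)[OF J] by (auto simp: a_inv_def subring_of_def)
  show "ideal J (subring_of A)"
  proof (rule idealI)
    show "ring (subring_of A)" by (rule R.ring_axioms)
    show "subgroup J (add_monoid (subring_of A))"
      using J is_ideal_uminus[OF assms J] is_idealD(1)[OF J]
      by unfold_locales (auto simp: subring_of_def is_ideal_def minus')
  qed (use is_idealD(4,5)[OF J] in \<open>auto simp: subring_of_def\<close>)
qed

context
  fixes A :: "'a::comm_ring_1 set" and S :: "'a set"
  assumes A: "is_subring A" and S: "S \<subseteq> A"
begin

lemma ideal_gen_ideal: "is_ideal A (ideal_gen A S)"
proof -
  interpret R: cring "subring_of A" using A by (rule cring_subring_of)
  show ?thesis
    unfolding ideal_gen_def ideal_subring_of[OF A, symmetric]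
    by (rule R.genideal_ideal) (use S in \<open>simp add: subring_of_def\<close>)
qed

lemma ideal_gen_superset: "S \<subseteq> ideal_gen A S"
proof -
  interpret R: cring "subring_of A" using A by (rule cring_subring_of)
  show ?thesis
    unfolding ideal_gen_def
    by (rule R.genideal_self) (use S in \<open>simp add: subring_of_def\<close>)
qed

lemma ideal_gen_least: "is_ideal A J \<Longrightarrow> S \<subseteq> J \<Longrightarrow> ideal_gen A S \<subseteq> J"
proof -
  interpret R: cring "subring_of A" using A by (rule cring_subring_of)
  show "is_ideal A J \<Longrightarrow> S \<subseteq> J \<Longrightarrow> ideal_gen A S \<subseteq> J"
    unfolding ideal_gen_def ideal_subring_of[OF A, symmetric]
    by (rule R.genideal_minimal)
qed

end

text \<open>The coefficients run over any set, not only over a ring: with coefficients in m^N and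
  the parameters as \<open>y\<close> this is m^(N+1).\<close>

definition span_of :: "'a::comm_ring_1 set \<Rightarrow> (nat \<Rightarrow> 'a) \<Rightarrow> nat \<Rightarrow> 'a set" where
  "span_of A y n = {\<Sum>j<n. b j * y j |b. \<forall>j<n. b j \<in> A}"

lemma span_of_ideal:
  assumes J: "is_ideal A J" and A: "is_subring A" and y: "\<forall>j<n. y j \<in> A"
  shows "is_ideal A (span_of J y n)"
proof -
  have JA: "J \<subseteq> A" using is_idealD(1)[OF J] .
  show ?thesis
    unfolding is_ideal_def
  proof (intro conjI ballI)
    show "span_of J y n \<subseteq> A"
      using JA y by (auto simp: span_of_def intro!: is_subring_sum[OF A] is_subringD(4)[OF A])
    show "0 \<in> span_of J y n"
      using is_idealD(2)[OF J] by (auto simp: span_of_def intro!: exI[of _ "\<lambda>_. 0"])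
    fix u w assume "u \<in> span_of J y n" "w \<in> span_of J y n"
    then obtain b c where "\<forall>j<n. b j \<in> J" "u = (\<Sum>j<n. b j * y j)"
      "\<forall>j<n. c j \<in> J" "w = (\<Sum>j<n. c j * y j)" by (auto simp: span_of_def)
    then show "u + w \<in> span_of J y n"
      by (auto simp: span_of_def sum.distrib ring_distribs is_idealD(3)[OF J]
          intro!: exI[of _ "\<lambda>j. b j + c j"])
  next
    fix u w assume "u \<in> A" "w \<in> span_of J y n"
    then obtain c where "\<forall>j<n. c j \<in> J" "w = (\<Sum>j<n. c j * y j)" by (auto simp: span_of_def)
    then show "u * w \<in> span_of J y n"
      using \<open>u \<in> A\<close> by (auto simp: span_of_def sum_distrib_left mult_ac is_idealD(4)[OF J]
          intro!: exI[of _ "\<lambda>j. u * c j"])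
  qed
qed

lemma is_ideal_self: "is_subring A \<Longrightarrow> is_ideal A A"
  by (simp add: is_ideal_def is_subring_def)

lemma span_ofI: "(\<And>j. j < n \<Longrightarrow> b j \<in> A) \<Longrightarrow> (\<Sum>j<n. b j * y j) \<in> span_of A y n"
  by (auto simp: span_of_def)

lemma span_ofE:
  assumes "u \<in> span_of A y n"
  obtains b where "\<And>j. j < n \<Longrightarrow> b j \<in> A" "u = (\<Sum>j<n. b j * y j)"
  using assms by (auto simp: span_of_def)

lemma span_of_generator:
  assumes "0 \<in> A" "b \<in> A" "j < n"
  shows "b * y j \<in> span_of A y n"
proof -
  have "(\<Sum>i<n. (if i = j then b else 0) * y i) = b * y j"
    using assms(3) by (simp add: if_distrib[of "\<lambda>c. c * _"] cong: if_cong)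
  then show ?thesis using span_ofI[of n "\<lambda>i. if i = j then b else 0" A y] assms(1,2) by simp
qed

lemma ideal_gen_image:
  assumes A: "is_subring A" and y: "\<forall>j<n. y j \<in> A"
  shows "ideal_gen A (y ` {..<n}) = span_of A y n"
proof
  have sub: "y ` {..<n} \<subseteq> A" using y by auto
  show "ideal_gen A (y ` {..<n}) \<subseteq> span_of A y n"
    using span_of_ideal[OF is_ideal_self[OF A] A y] span_of_generator[of A 1 _ n y] is_subringD(1,2)[OF A]
    by (intro ideal_gen_least[OF A sub]) auto
  show "span_of A y n \<subseteq> ideal_gen A (y ` {..<n})"
    using ideal_gen_ideal[OF A sub] ideal_gen_superset[OF A sub]
    by (auto simp: span_of_def intro!: is_ideal_sum is_idealD(4))
qed

lemma span_of_mono: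
  assumes A: "is_subring A" and y: "\<forall>j<n. y j \<in> A" and z: "\<forall>j<m. z j \<in> span_of A y n"
  shows "span_of A z m \<subseteq> span_of A y n"
  using is_idealD(4)[OF span_of_ideal[OF is_ideal_self[OF A] A y]] z
  by (auto elim!: span_ofE intro!: is_ideal_sum[OF span_of_ideal[OF is_ideal_self[OF A] A y]])

lemma prod_diff_ideal:
  assumes A: "is_subring A" and J: "is_ideal A J"
    and "\<And>i. i \<in> S \<Longrightarrow> g i \<in> A" "\<And>i. i \<in> S \<Longrightarrow> h i \<in> A" "\<And>i. i \<in> S \<Longrightarrow> g i - h i \<in> J"
  shows "(\<Prod>i\<in>S. g i) - (\<Prod>i\<in>S. h i) \<in> J"
  using assms(3-)
proof (induction S rule: infinite_finite_induct)
  case (insert i S)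
  have "(\<Prod>i\<in>insert i S. g i) - (\<Prod>i\<in>insert i S. h i)
      = g i * (prod g S - prod h S) + (g i - h i) * prod h S"
    using insert by (simp add: algebra_simps)
  moreover have "g i * (prod g S - prod h S) \<in> J" "(g i - h i) * prod h S \<in> J"
    using insert is_subring_prod[OF A, of S h] is_idealD(4,5)[OF J] by simp_all
  ultimately show ?case using is_idealD(3)[OF J] by simp
qed (use is_idealD(2)[OF J] in simp_all)

section \<open>Determinants and adjugates over a subring\<close>

lemma signof_in: "is_subring A \<Longrightarrow> signof p \<in> A"
  by (simp add: is_subringD sign_def)

lemma det_in_subring:
  assumes A: "is_subring A" and M: "M \<in> carrier_mat n n" "\<And>i j. i < n \<Longrightarrow> j < n \<Longrightarrow> M $$ (i, j) \<in> A"
  shows "det M \<in> A"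
  unfolding det_def'[OF M(1)]
  by (auto intro!: is_subring_sum[OF A] is_subringD(4)[OF A] signof_in[OF A] is_subring_prod[OF A] M
      dest: permutes_in_image)

lemma det_diff_ideal:
  assumes A: "is_subring A" and J: "is_ideal A J"
    and M: "M \<in> carrier_mat n n" "\<And>i j. i < n \<Longrightarrow> j < n \<Longrightarrow> M $$ (i, j) \<in> A"
    and N: "N \<in> carrier_mat n n" "\<And>i j. i < n \<Longrightarrow> j < n \<Longrightarrow> N $$ (i, j) \<in> A"
    and MN: "\<And>i j. i < n \<Longrightarrow> j < n \<Longrightarrow> M $$ (i, j) - N $$ (i, j) \<in> J"
  shows "det M - det N \<in> J"
proof -
  have "p i < n" if "p permutes {0..<n}" "i \<in> {0..<n}" for p i
    using permutes_in_image[OF that(1), of i] that by simp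
  then show ?thesis
    unfolding det_def'[OF M(1)] det_def'[OF N(1)] sum_subtractf[symmetric] right_diff_distrib[symmetric]
    by (intro is_ideal_sum[OF J] is_idealD(4)[OF J] signof_in[OF A] prod_diff_ideal[OF A J])
      (auto intro: M(2) N(2) MN)
qed

lemma adj_mat_in_subring:
  assumes A: "is_subring A" and M: "M \<in> carrier_mat n n" "\<And>i j. i < n \<Longrightarrow> j < n \<Longrightarrow> M $$ (i, j) \<in> A"
    and ij: "i < n" "j < n"
  shows "adj_mat M $$ (i, j) \<in> A"
proof -
  have "mat_delete M j i $$ (i', j') \<in> A" if "i' < n - 1" "j' < n - 1" for i' j'
    using that M ij by (auto simp: mat_delete_def)
  moreover have "mat_delete M j i \<in> carrier_mat (n - 1) (n - 1)" using M by (auto simp: mat_delete_def)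
  ultimately have "det (mat_delete M j i) \<in> A" by (intro det_in_subring[OF A])
  moreover have "(- 1) ^ (j + i) \<in> A" using is_subringD(2,5)[OF A] by (intro is_subring_power[OF A])
  ultimately show ?thesis
    using M ij by (simp add: adj_mat_def cofactor_def is_subringD(4)[OF A])
qed

lemma det_scale_rows:
  "det (mat n n (\<lambda>(i, j). d i * M i j)) = (\<Prod>i<n. d i) * det (mat n n (\<lambda>(i, j). M i j))"
proof -
  have "p i < n" if "p permutes {0..<n}" "i < n" for p i
    using permutes_in_image[OF that(1), of i] that by simp
  then show ?thesis
    by (simp add: det_def'[of _ n] sum_distrib_left prod.distrib mult_ac lessThan_atLeast0)
qed

lemma det_scale_cols:
  "det (mat n n (\<lambda>(i, j). d j * M i j)) = (\<Prod>i<n. d i) * det (mat n n (\<lambda>(i, j). M i j))"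
proof -
  have "det (mat n n (\<lambda>(i, j). d j * M i j)) = det (mat n n (\<lambda>(i, j). d i * M j i))"
    by (subst det_transpose[symmetric, of _ n]) (auto intro!: arg_cong[of _ _ det])
  also have "\<dots> = (\<Prod>i<n. d i) * det (mat n n (\<lambda>(i, j). M j i))" by (rule det_scale_rows)
  also have "det (mat n n (\<lambda>(i, j). M j i)) = det (mat n n (\<lambda>(i, j). M i j))"
    by (subst det_transpose[symmetric, of _ n]) (auto intro!: arg_cong[of _ _ det])
  finally show ?thesis .
qed

lemma adj_mat_mult_index:
  assumes M: "M \<in> carrier_mat n n" and "i < n" "j < n"
  shows "(\<Sum>k<n. adj_mat M $$ (i, k) * M $$ (k, j)) = (if i = j then det M else 0)"
proof -
  have "(adj_mat M * M) $$ (i, j) = (\<Sum>k<n. adj_mat M $$ (i, k) * M $$ (k, j))"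
    using assms adj_mat(1)[OF M] by (simp add: scalar_prod_def lessThan_atLeast0)
  moreover have "(adj_mat M * M) $$ (i, j) = (if i = j then det M else 0)"
    using assms by (simp add: adj_mat(3)[OF M])
  ultimately show ?thesis by simp
qed

text \<open>Cramer's rule without division, from adj(M) M = det M. As the adjugate has entries in
  the ring, an ideal that contains the entries of M f contains det M times each entry of f.\<close>

lemma cramer_sum:
  assumes M: "M \<in> carrier_mat n n" and "i < n"
  shows "det M * f i = (\<Sum>k<n. adj_mat M $$ (i, k) * (\<Sum>j<n. M $$ (k, j) * f j))"
proof -
  have "(\<Sum>k<n. adj_mat M $$ (i, k) * (\<Sum>j<n. M $$ (k, j) * f j))
      = (\<Sum>j<n. (\<Sum>k<n. adj_mat M $$ (i, k) * M $$ (k, j)) * f j)"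
    by (subst sum_distrib_left, subst sum.swap) (simp add: sum_distrib_right mult.assoc)
  also have "\<dots> = (\<Sum>j<n. (if i = j then det M else 0) * f j)"
    by (intro sum.cong refl) (simp add: adj_mat_mult_index[OF M \<open>i < n\<close>])
  also have "\<dots> = det M * f i" using \<open>i < n\<close> by (simp add: if_distrib[of "\<lambda>c. c * _"] cong: if_cong)
  finally show ?thesis ..
qed


section \<open>Rational points with local parameters\<close>

definition hom_idx :: "nat \<Rightarrow> nat \<Rightarrow> (nat \<Rightarrow>\<^sub>0 nat) set" where
  "hom_idx r d = {I. Poly_Mapping.keys I \<subseteq> {..<r} \<and> mdeg I = d}"

definition low_idx :: "nat \<Rightarrow> nat \<Rightarrow> (nat \<Rightarrow>\<^sub>0 nat) set" where
  "low_idx r N = {I. Poly_Mapping.keys I \<subseteq> {..<r} \<and> mdeg I < N}"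

lemma finite_low_idx [simp]: "finite (low_idx r N)"
proof (rule finite_imageD)
  have "Poly_Mapping.lookup ` low_idx r N \<subseteq>
      {f. \<forall>i. (i \<in> {..<r} \<longrightarrow> f i \<in> {..<N}) \<and> (i \<notin> {..<r} \<longrightarrow> f i = 0)}"
    by (auto simp: low_idx_def in_keys_iff subset_iff intro: le_less_trans[OF lookup_le_mdeg])
  then show "finite (Poly_Mapping.lookup ` low_idx r N)"
    by (rule finite_subset) (rule finite_set_of_finite_funs; simp)
qed (rule inj_onI, rule poly_mapping_eqI, simp)

lemma hom_idx_subset: "hom_idx r d \<subseteq> low_idx r (Suc d)"
  by (auto simp: hom_idx_def low_idx_def)

lemma finite_hom_idx [simp]: "finite (hom_idx r d)"
  using finite_subset[OF hom_idx_subset] by simp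

lemma low_idx_0 [simp]: "low_idx r 0 = {}"
  by (simp add: low_idx_def)

lemma low_idx_Suc: "low_idx r (Suc N) = low_idx r N \<union> hom_idx r N" "low_idx r N \<inter> hom_idx r N = {}"
  by (auto simp: low_idx_def hom_idx_def)

lemma sum_low_idx_Suc: "(\<Sum>I\<in>low_idx r (Suc N). g I) = (\<Sum>I\<in>low_idx r N. g I) + (\<Sum>I\<in>hom_idx r N. g I)"
  by (simp add: low_idx_Suc sum.union_disjoint)

lemma hom_idx_0: "hom_idx r 0 = {0}"
  by (auto simp: hom_idx_def mdeg_eq_0_iff)

text \<open>The coefficients after multiplication of a series by the monomial of index
  \<open>K\<close>. The range test matters because subtraction of multi-indices is
  truncated.\<close>

definition shift :: "(nat \<Rightarrow>\<^sub>0 nat) \<Rightarrow> ((nat \<Rightarrow>\<^sub>0 nat) \<Rightarrow> 'k::zero) \<Rightarrow> (nat \<Rightarrow>\<^sub>0 nat) \<Rightarrow> 'k" where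
  "shift K c L = (if L \<in> range ((+) K) then c (L - K) else 0)"

lemma shift_add [simp]: "shift K c (K + M) = c M"
  by (simp add: shift_def)

lemma sum_shift:
  assumes "finite B" "\<And>M. K + M \<in> B \<longleftrightarrow> M \<in> A" "\<iota> 0 = (0::'a::comm_semiring_1)"
  shows "(\<Sum>L\<in>B. \<iota> (shift K c L) * monom_at x L) = monom_at x K * (\<Sum>I\<in>A. \<iota> (c I) * monom_at x I)"
proof -
  have "(\<Sum>L\<in>B. \<iota> (shift K c L) * monom_at x L) = (\<Sum>L\<in>(+) K ` A. \<iota> (shift K c L) * monom_at x L)"
    using assms by (intro sum.mono_neutral_right) (auto simp: shift_def image_iff)
  also have "\<dots> = (\<Sum>I\<in>A. \<iota> (c I) * monom_at x (K + I))"
    by (subst sum.reindex) (auto simp: inj_on_def)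
  finally show ?thesis by (simp add: monom_at_add sum_distrib_left mult_ac)
qed

lemma sum_shift_low:
  assumes "Poly_Mapping.keys K \<subseteq> {..<r}" "\<iota> 0 = (0::'a::comm_semiring_1)"
  shows "(\<Sum>L\<in>low_idx r N. \<iota> (shift K c L) * monom_at x L)
    = monom_at x K * (\<Sum>I\<in>low_idx r (N - mdeg K). \<iota> (c I) * monom_at x I)"
  using assms by (intro sum_shift finite_low_idx) (auto simp: low_idx_def keys_add_nat mdeg_add)

lemma sum_shift_hom:
  assumes "Poly_Mapping.keys K \<subseteq> {..<r}" "\<iota> 0 = (0::'a::comm_semiring_1)"
  shows "(\<Sum>L\<in>hom_idx r (N + mdeg K). \<iota> (shift K c L) * monom_at x L)
    = monom_at x K * (\<Sum>I\<in>hom_idx r N. \<iota> (c I) * monom_at x I)"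
  using assms by (intro sum_shift finite_hom_idx) (auto simp: hom_idx_def keys_add_nat mdeg_add)

text \<open>That the nonunits form an ideal is an assumption here; at the points of the model it is
  read off from local parameters, which generate \<open>maxid P\<close>.\<close>

locale local_point = comm_ring_hom \<iota> for \<iota> :: "'k::field \<Rightarrow> 'K::field" +
  fixes P :: "'K set"
  assumes subring: "is_subring P"
    and scalar_in: "\<And>c. \<iota> c \<in> P"
    and maxid_ideal: "is_ideal P (maxid P)"
    and rational: "\<And>g. g \<in> P \<Longrightarrow> \<exists>c. g - \<iota> c \<in> maxid P"
begin

lemmas P_intros = is_subringD[OF subring] is_subring_sum[OF subring] is_subring_prod[OF subring]
  is_subring_power[OF subring] scalar_in

lemma one_notin_maxid: "1 \<notin> maxid P"
  using is_subringD(2)[OF subring] by (simp add: maxid_def runits_def)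

lemma unit_if: "u \<in> P \<Longrightarrow> u \<notin> maxid P \<Longrightarrow> u \<noteq> 0 \<and> 1 / u \<in> P"
  by (simp add: maxid_def runits_def)

lemma maxid_in: "u \<in> maxid P \<Longrightarrow> u \<in> P"
  by (simp add: maxid_def)

lemma scalar_zero_if: "\<iota> c \<in> maxid P \<Longrightarrow> c = 0"
proof (rule ccontr)
  assume "\<iota> c \<in> maxid P" "c \<noteq> 0"
  then have "\<iota> (inverse c) * \<iota> c \<in> maxid P"
    using is_idealD(4)[OF maxid_ideal] scalar_in by blast
  then show False using \<open>c \<noteq> 0\<close> one_notin_maxid by (simp flip: hom_mult)
qed

lemma value_at_eqI:
  assumes "h - \<iota> c \<in> maxid P"
  shows "value_at \<iota> P h = c"
  unfolding value_at_def
proof (rule the_equality)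
  fix c' assume "h - \<iota> c' \<in> maxid P"
  from is_ideal_diff[OF subring maxid_ideal assms this] show "c' = c"
    using scalar_zero_if[of "c' - c"] by (simp add: hom_minus)
qed (fact assms)

lemma value_at:
  assumes "h \<in> P"
  shows "h - \<iota> (value_at \<iota> P h) \<in> maxid P"
  using rational[OF assms] value_at_eqI by auto

end

locale param_point = local_point \<iota> P for \<iota> :: "'k::field \<Rightarrow> 'K::field" and P :: "'K set" +
  fixes r :: nat and x :: "nat \<Rightarrow> 'K"
  assumes params: "local_params r P x"
begin

lemma x_in: "j < r \<Longrightarrow> x j \<in> P"
  using params by (auto simp: local_params_def)

lemma maxid_span: "maxid P = span_of P x r"
  using params ideal_gen_image[OF subring, of r x] x_in by (simp add: local_params_def)

lemma x_maxid: "j < r \<Longrightarrow> x j \<in> maxid P"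
  using span_of_generator[of P 1 j r x] P_intros(1,2) by (simp add: maxid_span)

abbreviation mp :: "nat \<Rightarrow> 'K set" where "mp \<equiv> maxid_power P"

lemma mp_gens: "{\<Prod>i<N. y i |y. \<forall>i<N. y i \<in> maxid P} \<subseteq> P"
  using maxid_in by (auto intro!: P_intros)

lemma mp_ideal: "is_ideal P (mp N)"
  unfolding maxid_power_def by (intro ideal_gen_ideal[OF subring] mp_gens)

lemma mp_0: "mp 0 = P"
  using ideal_gen_superset[OF subring mp_gens[of 0]] is_idealD(1)[OF mp_ideal, of 0] is_idealD(4)[OF mp_ideal, of _ 1 0]
  by (auto simp: maxid_power_def)

text \<open>Turns the powers of m, defined by products of N elements, into the recursion m^(N+1) =
  m^N x_0 + ... + m^N x_(r-1), on which the later inductions run.\<close>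

lemma mp_Suc: "mp (Suc N) = span_of (mp N) x r"
proof
  have gens: "(\<Prod>i<N. y i) \<in> mp N" if "\<forall>i<N. y i \<in> maxid P" for y N
    using ideal_gen_superset[OF subring mp_gens[of N]] that by (auto simp: maxid_power_def)
  show "mp (Suc N) \<subseteq> span_of (mp N) x r"
    unfolding maxid_power_def[of _ "Suc N"]
  proof (intro ideal_gen_least[OF subring mp_gens])
    show "is_ideal P (span_of (mp N) x r)"
      using x_in by (intro span_of_ideal[OF mp_ideal subring]) auto
    show "{\<Prod>i<Suc N. y i |y. \<forall>i<Suc N. y i \<in> maxid P} \<subseteq> span_of (mp N) x r"
    proof clarify
      fix y assume y: "\<forall>i<Suc N. y i \<in> maxid P"
      then obtain b where b: "\<And>j. j < r \<Longrightarrow> b j \<in> P" "y N = (\<Sum>j<r. b j * x j)"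
        unfolding maxid_span by (auto elim!: span_ofE)
      have "(\<Prod>i<Suc N. y i) = (\<Sum>j<r. (b j * (\<Prod>i<N. y i)) * x j)"
        by (simp add: b sum_distrib_left mult_ac)
      then show "(\<Prod>i<Suc N. y i) \<in> span_of (mp N) x r"
        using gens[of N y] y b(1) by (auto intro!: span_ofI is_idealD(4)[OF mp_ideal])
    qed
  qed
  \<comment> \<open>The multipliers that carry \<open>x j\<close> into m^(N+1) form an ideal, so it
    suffices to test the generators of m^N.\<close>
  have "mp N \<subseteq> {u \<in> P. u * x j \<in> mp (Suc N)}" if "j < r" for j
    unfolding maxid_power_def[of _ N]
  proof (intro ideal_gen_least[OF subring mp_gens])
    show "is_ideal P {u \<in> P. u * x j \<in> mp (Suc N)}"
      using is_idealD[OF mp_ideal[of "Suc N"]]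
      by (auto simp: is_ideal_def ring_distribs mult.assoc P_intros)
    show "{\<Prod>i<N. y i |y. \<forall>i<N. y i \<in> maxid P} \<subseteq> {u \<in> P. u * x j \<in> mp (Suc N)}"
    proof clarify
      fix y assume y: "\<forall>i<N. y i \<in> maxid P"
      then show "(\<Prod>i<N. y i) \<in> P \<and> (\<Prod>i<N. y i) * x j \<in> mp (Suc N)"
        using gens[of "Suc N" "y(N := x j)"] x_maxid[OF that] maxid_in
        by (auto intro!: P_intros)
    qed
  qed
  then show "span_of (mp N) x r \<subseteq> mp (Suc N)"
    by (auto elim!: span_ofE intro!: is_ideal_sum[OF mp_ideal])
qed

lemma mp_in: "g \<in> mp N \<Longrightarrow> g \<in> P"
  using is_idealD(1)[OF mp_ideal] by auto

lemmas mp_intros = is_idealD(2,3)[OF mp_ideal] is_ideal_diff[OF subring mp_ideal]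
  is_ideal_uminus[OF subring mp_ideal] is_ideal_sum[OF mp_ideal]
lemmas mp_mult = is_idealD(4,5)[OF mp_ideal]

lemma mp_x_mult: "g \<in> mp N \<Longrightarrow> j < r \<Longrightarrow> x j * g \<in> mp (Suc N)"
  using span_of_generator[of "mp N" g j r x] mp_intros(1) by (simp add: mp_Suc mult.commute)

lemma mp_maxid_mult:
  assumes "u \<in> maxid P" "g \<in> mp N"
  shows "u * g \<in> mp (Suc N)"
proof -
  obtain b where "\<And>j. j < r \<Longrightarrow> b j \<in> P" "u = (\<Sum>j<r. b j * x j)"
    using assms(1) unfolding maxid_span by (auto elim!: span_ofE)
  then show ?thesis
    using mp_x_mult[OF assms(2)] mp_mult by (auto simp: sum_distrib_right mult.assoc intro!: mp_intros)
qed

lemma mp_1: "mp (Suc 0) = maxid P"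
  by (simp add: mp_Suc mp_0 maxid_span)

lemma mp_Suc_subset: "mp (Suc N) \<subseteq> mp N"
  using mp_mult(2) x_in by (auto simp: mp_Suc elim!: span_ofE intro!: mp_intros)

lemma mp_mono: "M \<le> N \<Longrightarrow> mp N \<subseteq> mp M"
  by (rule lift_Suc_antimono_le[of mp, OF mp_Suc_subset])

lemma mp_monom_mult:
  assumes "Poly_Mapping.keys I \<subseteq> {..<r}" "g \<in> mp N"
  shows "monom_at x I * g \<in> mp (mdeg I + N)"
proof -
  have pow: "x j ^ a * g \<in> mp (a + N)" if "j < r" "g \<in> mp N" for j a g N
    using that by (induction a) (auto simp: mult.assoc intro: mp_x_mult)
  have "(\<Prod>i\<in>A. x i ^ l i) * g \<in> mp ((\<Sum>i\<in>A. l i) + N)" if "finite A" "A \<subseteq> {..<r}" for A and l :: "nat \<Rightarrow> nat"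
    using that
  proof (induction A)
    case (insert i A)
    then show ?case using pow[of i "prod (\<lambda>i. x i ^ l i) A * g" _ "l i"] by (simp add: mult.assoc add.assoc)
  qed (use assms in simp)
  then show ?thesis using assms by (simp add: monom_at_def mdeg_def)
qed

lemma mp_monom: "Poly_Mapping.keys I \<subseteq> {..<r} \<Longrightarrow> monom_at x I \<in> mp (mdeg I)"
  using mp_monom_mult[of I 1 0] P_intros(2) by (simp add: mp_0)

definition hsum :: "nat \<Rightarrow> ((nat \<Rightarrow>\<^sub>0 nat) \<Rightarrow> 'k) \<Rightarrow> 'K" where
  "hsum d c = (\<Sum>I\<in>hom_idx r d. \<iota> (c I) * monom_at x I)"

definition lsum :: "nat \<Rightarrow> ((nat \<Rightarrow>\<^sub>0 nat) \<Rightarrow> 'k) \<Rightarrow> 'K" where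
  "lsum N c = (\<Sum>I\<in>low_idx r N. \<iota> (c I) * monom_at x I)"

lemma lsum_Suc: "lsum (Suc N) c = lsum N c + hsum N c"
  by (simp add: lsum_def hsum_def sum_low_idx_Suc)

lemma lsum_0 [simp]: "lsum 0 c = 0"
  by (simp add: lsum_def)

lemma hsum_in: "hsum d c \<in> mp d"
  unfolding hsum_def using mp_monom
  by (intro mp_intros mp_mult scalar_in) (auto simp: hom_idx_def)

lemma hsum_sum: "hsum d (\<lambda>I. \<Sum>j\<in>A. c j I) = (\<Sum>j\<in>A. hsum d (c j))"
  unfolding hsum_def by (subst sum.swap) (simp add: hom_sum sum_distrib_right)

lemma hsum_shift_var: "j < r \<Longrightarrow> hsum (Suc d) (shift (Poly_Mapping.single j 1) c) = x j * hsum d c"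
  using sum_shift_hom[where K = "Poly_Mapping.single j 1" and r = r and \<iota> = \<iota> and N = d and c = c and x = x]
  by (simp add: hsum_def)

text \<open>Rationality of the point is the case of degree 0. In the step, the coefficients of the
  x_j lie one power lower, are approximated by forms there, and multiplication by x_j shifts these
  forms.\<close>

lemma approx_homogeneous: "g \<in> mp d \<Longrightarrow> \<exists>c. g - hsum d c \<in> mp (Suc d)"
proof (induction d arbitrary: g)
  case 0
  then obtain c where "g - \<iota> c \<in> maxid P" using rational by (auto simp: mp_0)
  then show ?case by (auto simp: hsum_def hom_idx_0 mp_1 intro!: exI[of _ "\<lambda>_. c"])
next
  case (Suc d)
  then obtain b where b: "\<And>j. j < r \<Longrightarrow> b j \<in> mp d" "g = (\<Sum>j<r. b j * x j)"
    by (auto simp: mp_Suc elim!: span_ofE)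
  from b(1) Suc.IH have "\<forall>j. \<exists>c. j < r \<longrightarrow> b j - hsum d c \<in> mp (Suc d)" by blast
  then obtain c where c: "\<And>j. j < r \<Longrightarrow> b j - hsum d (c j) \<in> mp (Suc d)" by metis
  have "g - hsum (Suc d) (\<lambda>I. \<Sum>j<r. shift (Poly_Mapping.single j 1) (c j) I)
      = (\<Sum>j<r. x j * (b j - hsum d (c j)))"
    unfolding hsum_sum b(2) sum_subtractf[symmetric]
    by (intro sum.cong refl) (simp add: hsum_shift_var algebra_simps del: One_nat_def)
  also have "\<dots> \<in> mp (Suc (Suc d))" using c mp_x_mult by (intro mp_intros) auto
  finally show ?case by blast
qed

text \<open>The coefficients may still depend on N; they become coherent once
  \<open>approx_unique\<close> is available.\<close>

lemma approx:
  assumes "g \<in> P"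
  shows "\<exists>c. g - lsum N c \<in> mp N"
proof (induction N)
  case 0
  then show ?case using assms by (simp add: mp_0)
next
  case (Suc N)
  then obtain c where "g - lsum N c \<in> mp N" by blast
  then obtain e where e: "g - lsum N c - hsum N e \<in> mp (Suc N)" using approx_homogeneous by blast
  let ?c = "\<lambda>I. if mdeg I < N then c I else e I"
  have "lsum N ?c = lsum N c" "hsum N ?c = hsum N e"
    by (auto simp: lsum_def hsum_def low_idx_def hom_idx_def intro!: sum.cong)
  then show ?case using e by (auto simp: lsum_Suc algebra_simps intro!: exI[of _ ?c])
qed

end


section \<open>Orders of vanishing of polynomials\<close>

text \<open>The N-th power of the ideal of the origin. Polynomials modulo \<open>ord N\<close> stand
  for truncated power series.\<close>

definition ord :: "nat \<Rightarrow> 'k::comm_ring_1 mpol set" where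
  "ord N = {G. \<forall>I\<in>Poly_Mapping.keys G. N \<le> mdeg I}"

lemma ord_mult: "F \<in> ord M \<Longrightarrow> G \<in> ord N \<Longrightarrow> F * G \<in> ord (M + N)"
  using keys_mult[of F G] unfolding ord_def by (fastforce simp: mdeg_add)

lemma ord_0: "ord 0 = UNIV"
  by (simp add: ord_def)

lemma ord_mono: "M \<le> N \<Longrightarrow> ord N \<subseteq> ord M"
  by (auto simp: ord_def)

lemma is_subring_UNIV: "is_subring UNIV"
  by (simp add: is_subring_def)

lemma ord_ideal: "is_ideal UNIV (ord N)"
  unfolding is_ideal_def
proof (intro conjI ballI)
  fix F G :: "'a mpol" assume "F \<in> ord N" "G \<in> ord N"
  then show "F + G \<in> ord N" using keys_add[of F G] by (auto simp: ord_def)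
next
  fix F G :: "'a mpol" assume "G \<in> ord N"
  then show "F * G \<in> ord N" using ord_mult[of F 0 G N] by (simp add: ord_0)
qed (simp_all add: ord_def)

lemmas ord_intros = is_idealD(2,3)[OF ord_ideal] is_ideal_diff[OF is_subring_UNIV ord_ideal]
  is_ideal_uminus[OF is_subring_UNIV ord_ideal] is_ideal_sum[OF ord_ideal]
  is_idealD(4,5)[OF ord_ideal UNIV_I]

lemma mvar_ord: "mvar j \<in> ord (Suc 0)"
  by (simp add: mvar_def ord_def)

section \<open>Values, derivatives and Newton iteration at a point of affine space\<close>

interpretation con: comm_ring_hom mcon
  by (rule mcon_hom)

definition peval :: "(nat \<Rightarrow> 'k::comm_ring_1) \<Rightarrow> 'k mpol \<Rightarrow> 'k" where
  "peval = eval_at (\<lambda>a. a)"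

definition pdir :: "(nat \<Rightarrow> 'k::comm_ring_1) \<Rightarrow> (nat \<Rightarrow> 'k) \<Rightarrow> 'k mpol \<Rightarrow> 'k" where
  "pdir = ddir (\<lambda>a. a)"

lemma peval_con [simp]: "peval c (mcon a) = a"
  using comm_ring_hom.eval_single[OF id_hom, of c 0 a] by (simp add: peval_def)

lemmas peval_var [simp] = comm_ring_hom.eval_var[OF id_hom, folded peval_def]
lemmas peval_zero [simp] = comm_ring_hom.eval_zero[OF id_hom, folded peval_def]
lemmas peval_add = comm_ring_hom.eval_add[OF id_hom, folded peval_def]
lemmas peval_mult = comm_ring_hom.eval_mult[OF id_hom, folded peval_def]
lemmas pdir_con [simp] = comm_ring_hom.ddir_con[OF id_hom, folded pdir_def]
lemmas pdir_var [simp] = comm_ring_hom.ddir_var[OF id_hom, folded pdir_def]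
lemmas pdir_zero [simp] = comm_ring_hom.ddir_zero[OF id_hom, folded pdir_def]
lemmas pdir_add = comm_ring_hom.ddir_add[OF id_hom, folded pdir_def]
lemmas pdir_minus = comm_ring_hom.ddir_minus[OF id_hom, folded pdir_def]
lemmas pdir_sum = comm_ring_hom.ddir_sum[OF id_hom, folded pdir_def]
lemmas pdir_mult = comm_ring_hom.ddir_mult[OF id_hom, folded peval_def pdir_def]

text \<open>The N-th power of the maximal ideal of the point \<open>c\<close> in the polynomial ring
  in m variables, given by generation so that rule induction applies.\<close>

inductive npow :: "(nat \<Rightarrow> 'k::comm_ring_1) \<Rightarrow> nat \<Rightarrow> nat \<Rightarrow> 'k mpol \<Rightarrow> bool" for c m where
  npow_0: "in_vars m E \<Longrightarrow> npow c m 0 E"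
| npow_add: "npow c m N A \<Longrightarrow> npow c m N B \<Longrightarrow> npow c m N (A + B)"
| npow_Suc: "npow c m N A \<Longrightarrow> in_vars m B \<Longrightarrow> peval c B = 0 \<Longrightarrow> npow c m (Suc N) (A * B)"

lemma npow_in_vars: "npow c m N E \<Longrightarrow> in_vars m E"
  by (induction rule: npow.induct) auto

lemma npow_mult: "npow c m N A \<Longrightarrow> in_vars m B \<Longrightarrow> npow c m N (A * B)"
proof (induction rule: npow.induct)
  case (npow_Suc N A B')
  then have "npow c m (Suc N) (A * (B' * B))" by (intro npow.npow_Suc) (auto simp: peval_mult)
  then show ?case by (simp add: mult.assoc)
qed (auto simp: ring_distribs intro: npow.intros)

lemma npow_zero: "npow c m N 0"
proof (cases N)
  case (Suc N')
  have "npow c m N' 0" by (induction N') (use npow_Suc[of c m _ 0 0] npow_0[of m 0] in auto)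
  then show ?thesis using npow_Suc[of c m N' 0 0] Suc by simp
qed (simp add: npow_0)

text \<open>The case 2 is what allows first-order terms to be compared modulo the square of the
  ideal of the point.\<close>

lemma npow_vanish:
  assumes "npow c m N E"
  shows "(1 \<le> N \<longrightarrow> peval c E = 0) \<and> (2 \<le> N \<longrightarrow> pdir c v E = 0)"
  using assms by (induction rule: npow.induct)
    (auto simp: peval_add pdir_add peval_mult pdir_mult)

text \<open>A substitution of polynomials that sends the origin to the point
  \<open>c\<close>.\<close>

definition centered :: "(nat \<Rightarrow> 'k::comm_ring_1) \<Rightarrow> nat \<Rightarrow> (nat \<Rightarrow> 'k mpol) \<Rightarrow> bool" where
  "centered c m \<tau> \<longleftrightarrow> (\<forall>j<m. \<tau> j - mcon (c j) \<in> ord (Suc 0))"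

lemma eval_mcon_const:
  assumes "centered c m \<tau>" "in_vars m G"
  shows "eval_at mcon \<tau> G - mcon (peval c G) \<in> ord (Suc 0)"
  using assms(2)
proof (induction G rule: mpol_induct)
  case (var j)
  then show ?case using assms(1) by (simp add: centered_def)
next
  case (add F G)
  have "eval_at mcon \<tau> (F + G) - mcon (peval c (F + G))
      = (eval_at mcon \<tau> F - mcon (peval c F)) + (eval_at mcon \<tau> G - mcon (peval c G))"
    by (simp add: con.eval_add peval_add single_add)
  then show ?case using add by (simp only: ord_intros)
next
  case (mult F G)
  have "eval_at mcon \<tau> (F * G) - mcon (peval c (F * G))
      = eval_at mcon \<tau> F * (eval_at mcon \<tau> G - mcon (peval c G))
      + (eval_at mcon \<tau> F - mcon (peval c F)) * mcon (peval c G)"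
    by (simp add: con.eval_mult peval_mult con.hom_mult algebra_simps)
  then show ?case using mult by (simp only: ord_intros)
qed (simp add: ord_intros)

text \<open>Converts vanishing at \<open>c\<close> into a condition on coefficients: each factor
  that vanishes at \<open>c\<close> loses its constant term under the substitution.\<close>

lemma npow_ord:
  assumes "npow c m N E" "centered c m \<tau>"
  shows "eval_at mcon \<tau> E \<in> ord N"
  using assms(1)
proof (induction rule: npow.induct)
  case (npow_Suc N A B)
  have "eval_at mcon \<tau> B \<in> ord (Suc 0)"
    using eval_mcon_const[OF assms(2) npow_Suc(2)] npow_Suc(3) by simp
  then show ?case using ord_mult[OF npow_Suc.IH, of _ "Suc 0"] by (simp add: con.eval_mult)
qed (auto simp: con.eval_add ord_0 intro: ord_intros)

text \<open>The derivatives are taken at the constant point \<open>c\<close> instead of at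
  \<open>\<tau>\<close>. The difference has order 1 and meets a factor \<open>\<epsilon> j\<close>
  of order N, so it disappears in the error of order N+1.\<close>

lemma taylor:
  assumes \<tau>: "centered c m \<tau>" and \<epsilon>: "\<And>j. j < m \<Longrightarrow> \<epsilon> j \<in> ord N" and "1 \<le> N" and "in_vars m G"
  shows "eval_at mcon (\<lambda>j. \<tau> j + \<epsilon> j) G - eval_at mcon \<tau> G
      - (\<Sum>j<m. mcon (pdir c (unitv j) G) * \<epsilon> j) \<in> ord (Suc N)"
  using assms(4)
proof (induction G rule: mpol_induct)
  case (con c)
  then show ?case by (simp add: ord_intros)
next
  case (var j)
  have "(\<Sum>i<m. mcon (pdir c (unitv i) (mvar j)) * \<epsilon> i) = (\<Sum>i<m. if j = i then \<epsilon> i else 0)"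
    by (intro sum.cong refl) auto
  then show ?case using var by (simp add: ord_intros)
next
  case (add F G)
  let ?e = "eval_at mcon (\<lambda>j. \<tau> j + \<epsilon> j)" and ?d = "\<lambda>F. \<Sum>j<m. mcon (pdir c (unitv j) F) * \<epsilon> j"
  have "?e (F + G) - eval_at mcon \<tau> (F + G) - ?d (F + G)
      = (?e F - eval_at mcon \<tau> F - ?d F) + (?e G - eval_at mcon \<tau> G - ?d G)"
    by (simp add: con.eval_add pdir_add single_add ring_distribs sum.distrib)
  then show ?case using add by (simp only: ord_intros)
next
  case (mult F G)
  let ?e = "eval_at mcon (\<lambda>j. \<tau> j + \<epsilon> j)" and ?t = "eval_at mcon \<tau>" and ?c = "\<lambda>F. mcon (peval c F)"
  let ?d = "\<lambda>F. \<Sum>j<m. mcon (pdir c (unitv j) F) * \<epsilon> j"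
  have "ord N \<subseteq> ord (Suc 0)" using \<open>1 \<le> N\<close> by (intro ord_mono) simp
  then have "\<tau> j + \<epsilon> j - mcon (c j) \<in> ord (Suc 0)" if "j < m" for j
    using ord_intros(2)[of "\<tau> j - mcon (c j)" "Suc 0" "\<epsilon> j"] \<tau> \<epsilon>[OF that] that
    by (auto simp: centered_def algebra_simps)
  then have \<tau>': "centered c m (\<lambda>j. \<tau> j + \<epsilon> j)" by (simp add: centered_def)
  have d: "?d F \<in> ord N" for F using \<epsilon> by (intro ord_intros) auto
  have dF: "?d (F * G) = ?c F * ?d G + ?c G * ?d F"
    by (simp add: pdir_mult single_add con.hom_mult ring_distribs sum.distrib sum_distrib_left mult.assoc)
  \<comment> \<open>In each of the four summands one factor is an induction error of order N+1, or a
    difference of order 1 meets a first-order term of order N.\<close>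
  have "?e (F * G) - ?t (F * G) - ?d (F * G)
      = ?e F * (?e G - ?t G - ?d G) + (?e F - ?c F) * ?d G + ?t G * (?e F - ?t F - ?d F) + (?t G - ?c G) * ?d F"
    unfolding dF by (simp add: con.eval_mult algebra_simps)
  moreover have "(?e F - ?c F) * ?d G \<in> ord (Suc N)" "(?t G - ?c G) * ?d F \<in> ord (Suc N)"
    using ord_mult[OF eval_mcon_const[OF \<tau>' mult(1)] d] ord_mult[OF eval_mcon_const[OF \<tau> mult(2)] d]
    by simp_all
  ultimately show ?case using mult by (simp only: ord_intros)
qed

text \<open>Newton iteration with the inverse Jacobian matrix \<open>A\<close> at the center kept
  fixed. Each round gains one order only, but no inverse over polynomials is ever formed.\<close>

lemma hensel:
  fixes y :: "nat \<Rightarrow> 'k::comm_ring_1 mpol"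
  assumes y: "\<And>k. k < m \<Longrightarrow> in_vars m (y k)" "\<And>k. k < m \<Longrightarrow> peval c (y k) = 0"
    and Y: "\<And>k. k < m \<Longrightarrow> Y k \<in> ord (Suc 0)"
    and A: "\<And>i k. i < m \<Longrightarrow> k < m \<Longrightarrow>
      (\<Sum>j<m. pdir c (unitv j) (y i) * A j k) = (if i = k then 1 else 0)"
  shows "\<exists>\<tau>. centered c m \<tau> \<and> (\<forall>k<m. eval_at mcon \<tau> (y k) - Y k \<in> ord (Suc N))"
proof (induction N)
  case 0
  have \<tau>: "centered c m (\<lambda>j. mcon (c j))" by (simp add: centered_def ord_intros)
  have "eval_at mcon (\<lambda>j. mcon (c j)) (y k) - Y k \<in> ord (Suc 0)" if "k < m" for k
    using eval_mcon_const[OF \<tau> y(1)[OF that]] y(2)[OF that] Y[OF that] by (simp add: ord_intros)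
  then show ?case using \<tau> by blast
next
  case (Suc N)
  then obtain \<tau> where \<tau>: "centered c m \<tau>" "\<And>k. k < m \<Longrightarrow> eval_at mcon \<tau> (y k) - Y k \<in> ord (Suc N)" by blast
  define e where "e k = eval_at mcon \<tau> (y k) - Y k" for k
  \<comment> \<open>The correction solves the linearized system: its image under the Jacobian matrix
    at the center is the negative of the error \<open>e\<close>.\<close>
  define \<epsilon> where "\<epsilon> j = - (\<Sum>k<m. mcon (A j k) * e k)" for j
  have \<epsilon>: "\<epsilon> j \<in> ord (Suc N)" for j
    unfolding \<epsilon>_def using \<tau>(2) by (intro ord_intros) (auto simp: e_def)
  have "ord (Suc N) \<subseteq> ord (Suc 0)" by (intro ord_mono) simp
  then have "\<tau> j + \<epsilon> j - mcon (c j) \<in> ord (Suc 0)" if "j < m" for j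
    using ord_intros(2)[of "\<tau> j - mcon (c j)" "Suc 0" "\<epsilon> j"] \<tau>(1) \<epsilon>[of j] that
    by (auto simp: centered_def algebra_simps)
  then have \<tau>': "centered c m (\<lambda>j. \<tau> j + \<epsilon> j)" by (simp add: centered_def)
  have "eval_at mcon (\<lambda>j. \<tau> j + \<epsilon> j) (y i) - Y i \<in> ord (Suc (Suc N))" if "i < m" for i
  proof -
    let ?J = "\<lambda>j. pdir c (unitv j) (y i)"
    have "(\<Sum>j<m. mcon (?J j) * \<epsilon> j) = - (\<Sum>j<m. \<Sum>k<m. mcon (?J j * A j k) * e k)"
      by (simp add: \<epsilon>_def sum_negf sum_distrib_left con.hom_mult mult.assoc)
    also have "\<dots> = - (\<Sum>k<m. mcon (\<Sum>j<m. ?J j * A j k) * e k)"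
      by (subst sum.swap) (simp add: con.hom_sum sum_distrib_right)
    also have "\<dots> = - (\<Sum>k<m. if i = k then e k else 0)"
      by (intro arg_cong[of _ _ uminus] sum.cong refl) (use A[OF that] in auto)
    also have "\<dots> = - e i" using that by simp
    finally show ?thesis
      using taylor[where \<epsilon> = \<epsilon>, OF \<tau>(1) \<epsilon> _ y(1)[OF that]] by (simp add: e_def)
  qed
  then show ?case using \<tau>' by blast
qed

lemma power_diff_ideal:
  assumes "is_subring A" "is_ideal A J" "g \<in> A" "h \<in> A" "g - h \<in> J"
  shows "g ^ n - h ^ n \<in> J"
  using prod_diff_ideal[of A J "{..<n}" "\<lambda>_. g" "\<lambda>_. h"] assms by simp

lemma monom_at_diff_ideal:
  assumes "is_subring A" "is_ideal A J" "\<And>j. j < r \<Longrightarrow> g j \<in> A" "\<And>j. j < r \<Longrightarrow> h j \<in> A"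
    "\<And>j. j < r \<Longrightarrow> g j - h j \<in> J" "Poly_Mapping.keys I \<subseteq> {..<r}"
  shows "monom_at g I - monom_at h I \<in> J"
  unfolding monom_at_def using assms(3-)
  by (intro prod_diff_ideal[OF assms(1,2)] power_diff_ideal[OF assms(1,2)] is_subring_power[OF assms(1)]) auto


section \<open>Local structure at a smooth rational point\<close>

lemma sum_lessThan_split:
  fixes g :: "nat \<Rightarrow> 'a::comm_monoid_add"
  assumes "r \<le> m"
  shows "(\<Sum>i<m. g i) = (\<Sum>i<m - r. g i) + (\<Sum>i<r. g (m - r + i))"
proof -
  have "(\<Sum>i<n + r. g i) = (\<Sum>i<n. g i) + (\<Sum>i<r. g (n + i))" for n
    by (induction r) (simp_all add: add.assoc)
  from this[of "m - r"] assms show ?thesis by simp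
qed

text \<open>The equations generate the relations only up to a factor that is a unit at the point;
  hence the multipliers in the factorizations that follow.\<close>

locale presented_point = local_point \<iota> P for \<iota> :: "'k::field \<Rightarrow> 'K::field" and P :: "'K set" +
  fixes r m :: nat and s :: "nat \<Rightarrow> 'K" and F :: "nat \<Rightarrow> 'k mpol"
  assumes r_le_m: "r \<le> m"
    and s_in: "\<And>j. j < m \<Longrightarrow> s j \<in> P"
    and F_in_vars: "\<And>l. l < m - r \<Longrightarrow> in_vars m (F l)"
    and F_zero: "\<And>l. l < m - r \<Longrightarrow> eval_at \<iota> s (F l) = 0"
    and fractions: "\<And>g. g \<in> P \<Longrightarrow> \<exists>G H. in_vars m G \<and> in_vars m H \<and> eval_at \<iota> s H \<notin> maxid P \<and>
      g = eval_at \<iota> s G / eval_at \<iota> s H"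
    and relations: "\<And>G. in_vars m G \<Longrightarrow> eval_at \<iota> s G = 0 \<Longrightarrow>
      \<exists>H Q. in_vars m H \<and> eval_at \<iota> s H \<notin> maxid P \<and> (\<forall>l<m - r. in_vars m (Q l)) \<and>
        H * G = (\<Sum>l<m - r. Q l * F l)"
begin

definition center :: "nat \<Rightarrow> 'k" where
  "center j = value_at \<iota> P (s j)"

lemma center: "j < m \<Longrightarrow> s j - \<iota> (center j) \<in> maxid P"
  unfolding center_def by (intro value_at s_in)

lemma ev_in: "in_vars m G \<Longrightarrow> eval_at \<iota> s G \<in> P"
  by (induction G rule: mpol_induct) (auto simp: eval_add eval_mult intro: P_intros s_in)

lemma ev_peval: "in_vars m G \<Longrightarrow> eval_at \<iota> s G - \<iota> (peval center G) \<in> maxid P"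
proof (induction G rule: mpol_induct)
  case (add F G)
  have "eval_at \<iota> s (F + G) - \<iota> (peval center (F + G))
      = (eval_at \<iota> s F - \<iota> (peval center F)) + (eval_at \<iota> s G - \<iota> (peval center G))"
    by (simp add: eval_add peval_add hom_add)
  then show ?case using add is_idealD(3)[OF maxid_ideal] by simp
next
  case (mult F G)
  have "eval_at \<iota> s (F * G) - \<iota> (peval center (F * G))
      = eval_at \<iota> s F * (eval_at \<iota> s G - \<iota> (peval center G)) + (eval_at \<iota> s F - \<iota> (peval center F)) * \<iota> (peval center G)"
    by (simp add: eval_mult peval_mult hom_mult algebra_simps)
  then show ?case
    using mult is_idealD(3-5)[OF maxid_ideal] ev_in scalar_in by simp
qed (use is_idealD(2)[OF maxid_ideal] center in simp_all)

text \<open>At a rational point a scalar, the value at \<open>center\<close>, decides whether a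
  polynomial expression is a unit.\<close>

lemma ev_maxid_iff: "in_vars m G \<Longrightarrow> eval_at \<iota> s G \<in> maxid P \<longleftrightarrow> peval center G = 0"
  using ev_peval[of G] is_ideal_diff[OF subring maxid_ideal, of "eval_at \<iota> s G" "eval_at \<iota> s G - \<iota> (peval center G)"]
    scalar_zero_if[of "peval center G"] by auto

lemma fractions_peval:
  assumes "g \<in> P"
  obtains G H where "in_vars m G" "in_vars m H" "peval center H \<noteq> 0" "eval_at \<iota> s H \<noteq> 0"
    "eval_at \<iota> s H * g = eval_at \<iota> s G"
proof -
  obtain G H where GH: "in_vars m G" "in_vars m H" "eval_at \<iota> s H \<notin> maxid P" "g = eval_at \<iota> s G / eval_at \<iota> s H"
    using fractions[OF assms] by blast
  then have "eval_at \<iota> s H \<noteq> 0" using is_idealD(2)[OF maxid_ideal] by auto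
  then show thesis using that[of G H] GH ev_maxid_iff by simp
qed

end

locale smooth_point = presented_point \<iota> P r m s F + param_point \<iota> P r x
  for \<iota> :: "'k::field \<Rightarrow> 'K::field" and P r m s F x
begin

text \<open>Elements of m^N are lifted to affine space after clearing denominators that do not
  vanish at \<open>center\<close>: each parameter contributes a numerator vanishing there, hence one
  more order.\<close>

lemma mp_npow:
  "g \<in> mp N \<Longrightarrow> \<exists>H E. in_vars m H \<and> peval center H \<noteq> 0 \<and> npow center m N E \<and> eval_at \<iota> s H * g = eval_at \<iota> s E"
proof (induction N arbitrary: g)
  case 0
  then have "g \<in> P" by (simp add: mp_0)
  from fractions_peval[OF this] show ?case by (metis npow_0)
next
  case (Suc N)
  then obtain b where b: "\<And>j. j < r \<Longrightarrow> b j \<in> mp N" "g = (\<Sum>j<r. b j * x j)"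
    by (auto simp: mp_Suc elim!: span_ofE)
  \<comment> \<open>The summands come with different denominators, so the sum is built up one term
    at a time with a growing common denominator.\<close>
  have "\<exists>H E. in_vars m H \<and> peval center H \<noteq> 0 \<and> npow center m (Suc N) E \<and>
      eval_at \<iota> s H * (\<Sum>j<l. b j * x j) = eval_at \<iota> s E" if "l \<le> r" for l
    using that
  proof (induction l)
    case 0
    show ?case by (rule exI[of _ 1], rule exI[of _ 0]) (simp add: npow_zero peval_def comm_ring_hom.eval_one[OF id_hom])
  next
    case (Suc l)
    then obtain H E where HE: "in_vars m H" "peval center H \<noteq> 0" "npow center m (Suc N) E"
      "eval_at \<iota> s H * (\<Sum>j<l. b j * x j) = eval_at \<iota> s E" by auto
    have l: "l < r" using Suc by simp
    obtain H' E' where HE': "in_vars m H'" "peval center H' \<noteq> 0" "npow center m N E'"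
      "eval_at \<iota> s H' * b l = eval_at \<iota> s E'" using Suc.prems \<open>g \<in> mp (Suc N)\<close> b(1)[OF l] \<open>\<And>g. g \<in> mp N \<Longrightarrow> _\<close> by blast
    obtain G H'' where GH: "in_vars m G" "in_vars m H''" "peval center H'' \<noteq> 0"
      "eval_at \<iota> s H'' * x l = eval_at \<iota> s G" using fractions_peval[OF x_in[OF l]] by metis
    have "eval_at \<iota> s G \<in> maxid P"
      unfolding GH(4)[symmetric] by (intro is_idealD(4)[OF maxid_ideal] ev_in GH x_maxid l)
    then have "peval center G = 0" using GH ev_maxid_iff by simp
    then have "npow center m (Suc N) (E' * G)" using HE' GH by (intro npow.npow_Suc)
    then have "npow center m (Suc N) (E * (H' * H'') + (E' * G) * H)"
      using HE HE' GH by (intro npow_add npow_mult[of _ _ _ E] npow_mult[of _ _ _ "E' * G"]) auto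
    moreover have "eval_at \<iota> s (H * (H' * H'')) * (\<Sum>j<Suc l. b j * x j) = eval_at \<iota> s (E * (H' * H'') + (E' * G) * H)"
      by (simp add: eval_add eval_mult HE(4)[symmetric] HE'(4)[symmetric] GH(4)[symmetric] algebra_simps)
    moreover have "in_vars m (H * (H' * H''))" "peval center (H * (H' * H'')) \<noteq> 0"
      using HE HE' GH by (auto simp: peval_mult)
    ultimately show ?case by blast
  qed
  then show ?case using b(2) by blast
qed

text \<open>Up to a factor that is nonzero at \<open>center\<close>, the preimage of m^N is the
  ideal of the equations plus the N-th power of the ideal of \<open>center\<close>. First-order and
  leading-form questions thus become questions about polynomials.\<close>

lemma lift:
  assumes "in_vars m G" "eval_at \<iota> s G \<in> mp N"
  obtains U Q E where "in_vars m U" "peval center U \<noteq> 0" "\<And>l. l < m - r \<Longrightarrow> in_vars m (Q l)"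
    "npow center m N E" "U * G = (\<Sum>l<m - r. Q l * F l) + E"
proof -
  obtain H E where HE: "in_vars m H" "peval center H \<noteq> 0" "npow center m N E"
    "eval_at \<iota> s H * eval_at \<iota> s G = eval_at \<iota> s E" using mp_npow[OF assms(2)] by blast
  have "eval_at \<iota> s (H * G - E) = 0" by (simp add: eval_minus eval_mult HE)
  moreover have "in_vars m (H * G - E)" using HE assms(1) npow_in_vars[OF HE(3)] by auto
  ultimately obtain H' Q where Q: "in_vars m H'" "eval_at \<iota> s H' \<notin> maxid P" "\<forall>l<m - r. in_vars m (Q l)"
    "H' * (H * G - E) = (\<Sum>l<m - r. Q l * F l)" using relations by blast
  show thesis
  proof (rule that[of "H' * H" Q "E * H'"])
    show "peval center (H' * H) \<noteq> 0" using HE Q ev_maxid_iff by (simp add: peval_mult)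
    show "H' * H * G = (\<Sum>l<m - r. Q l * F l) + E * H'"
      unfolding Q(4)[symmetric] by (simp add: algebra_simps)
  qed (use HE Q in \<open>auto intro: npow_mult\<close>)
qed

text \<open>A parameter is only a fraction in the coordinates \<open>s\<close>; modulo m^2 a
  polynomial can take its place.\<close>

definition approx_param :: "nat \<Rightarrow> 'k mpol" where
  "approx_param i = (SOME T. in_vars m T \<and> eval_at \<iota> s T - x i \<in> mp 2)"

lemma approx_param:
  assumes "i < r"
  shows "in_vars m (approx_param i)" "eval_at \<iota> s (approx_param i) - x i \<in> mp 2"
proof -
  obtain G H where GH: "in_vars m G" "in_vars m H" "peval center H \<noteq> 0"
    "eval_at \<iota> s H * x i = eval_at \<iota> s G" using fractions_peval[OF x_in[OF assms]] by metis
  let ?a = "peval center H"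
  let ?X = "G * mcon (inverse ?a)"
  \<comment> \<open>Replacing the denominator by its value at \<open>center\<close> costs a multiple
    of a difference in m times \<open>x i\<close>, hence an element of m^2.\<close>
  have "eval_at \<iota> s ?X - x i = (eval_at \<iota> s H - \<iota> ?a) * \<iota> (inverse ?a) * x i"
    using GH(3) by (simp add: eval_mult GH(4)[symmetric] algebra_simps flip: hom_mult)
  also have "\<dots> \<in> mp (Suc (Suc 0))"
    using x_maxid[OF assms] ev_peval[OF GH(2)] scalar_in is_idealD(5)[OF maxid_ideal]
    by (intro mp_maxid_mult) (auto simp: mp_1)
  finally have "in_vars m ?X \<and> eval_at \<iota> s ?X - x i \<in> mp 2"
    using GH(1) by (auto simp: numeral_2_eq_2)
  then have "in_vars m (approx_param i) \<and> eval_at \<iota> s (approx_param i) - x i \<in> mp 2"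
    unfolding approx_param_def by (rule someI)
  then show "in_vars m (approx_param i)" "eval_at \<iota> s (approx_param i) - x i \<in> mp 2" by auto
qed

text \<open>These generate the ideal of the point \<open>center\<close> of affine m-space to first order.\<close>

definition ambient_param :: "nat \<Rightarrow> 'k mpol" where
  "ambient_param k = (if k < m - r then F k else approx_param (k - (m - r)))"

lemma ambient_param_simps [simp]:
  "l < m - r \<Longrightarrow> ambient_param l = F l" "ambient_param (m - r + i) = approx_param i"
  by (simp_all add: ambient_param_def)

lemma approx_param_maxid: "i < r \<Longrightarrow> eval_at \<iota> s (approx_param i) \<in> maxid P"
  using is_idealD(3)[OF maxid_ideal, of "eval_at \<iota> s (approx_param i) - x i" "x i"]
    approx_param(2)[of i] x_maxid[of i] mp_mono[of 1 2] by (auto simp: mp_1)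

lemma ambient_param:
  assumes "k < m"
  shows "in_vars m (ambient_param k)" "peval center (ambient_param k) = 0"
proof -
  have k: "k - (m - r) < r" if "\<not> k < m - r" using that assms by simp
  show 1: "in_vars m (ambient_param k)"
    using F_in_vars approx_param(1) k by (auto simp: ambient_param_def)
  show "peval center (ambient_param k) = 0"
    using approx_param_maxid k F_zero is_idealD(2)[OF maxid_ideal]
    unfolding ev_maxid_iff[OF 1, symmetric] by (auto simp: ambient_param_def)
qed

text \<open>Because the parameters generate m, each coordinate minus its value is, modulo m^2, a
  scalar combination of the \<open>approx_param i\<close>. Lifted to affine space and differentiated
  at \<open>center\<close>, this writes the j-th unit covector through the differentials of the
  \<open>ambient_param i\<close>.\<close>

lemma jacobian_left_inverse:
  assumes "j < m"
  shows "\<exists>L. \<forall>k<m. (\<Sum>i<m. L i * pdir center (unitv k) (ambient_param i)) = (if j = k then 1 else 0)"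
proof -
  obtain b where b: "\<And>i. i < r \<Longrightarrow> b i \<in> P" "s j - \<iota> (center j) = (\<Sum>i<r. b i * x i)"
    using center[OF assms] unfolding maxid_span by (auto elim!: span_ofE)
  define \<beta> where "\<beta> i = value_at \<iota> P (b i)" for i
  have \<beta>: "b i - \<iota> (\<beta> i) \<in> maxid P" if "i < r" for i
    unfolding \<beta>_def using value_at b(1)[OF that] by simp
  \<comment> \<open>The coordinate minus its first-order part; its value at \<open>s\<close> lies in
    m^2.\<close>
  define G where "G = mvar j - mcon (center j) - (\<Sum>i<r. mcon (\<beta> i) * approx_param i)"
  have G: "in_vars m G" unfolding G_def using assms by (auto intro!: in_vars_minus in_vars_sum in_vars_mult approx_param(1))
  have "eval_at \<iota> s G = (\<Sum>i<r. b i * x i) - (\<Sum>i<r. \<iota> (\<beta> i) * eval_at \<iota> s (approx_param i))"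
    by (simp add: G_def eval_minus eval_sum eval_mult b(2))
  also have "\<dots> = (\<Sum>i<r. (b i - \<iota> (\<beta> i)) * x i - \<iota> (\<beta> i) * (eval_at \<iota> s (approx_param i) - x i))"
    by (simp add: algebra_simps flip: sum_subtractf sum.distrib)
  also have "\<dots> \<in> mp (Suc (Suc 0))"
  proof (intro mp_intros)
    fix i assume "i \<in> {..<r}"
    then have i: "i < r" by simp
    show "(b i - \<iota> (\<beta> i)) * x i \<in> mp (Suc (Suc 0))"
      using \<beta>[OF i] x_maxid[OF i] by (intro mp_maxid_mult) (simp_all add: mp_1)
    show "\<iota> (\<beta> i) * (eval_at \<iota> s (approx_param i) - x i) \<in> mp (Suc (Suc 0))"
      using mp_mult(1)[OF scalar_in approx_param(2)[OF i]] by (simp add: numeral_2_eq_2)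
  qed
  finally have G2: "eval_at \<iota> s G \<in> mp 2" by (simp add: numeral_2_eq_2)
  from G this obtain U Q E where U: "in_vars m U" "peval center U \<noteq> 0" "\<And>l. l < m - r \<Longrightarrow> in_vars m (Q l)"
    "npow center m 2 E" "U * G = (\<Sum>l<m - r. Q l * F l) + E" by (rule lift) (rule that)
  have G0: "peval center G = 0"
    using G2 mp_mono[of 1 2] ev_maxid_iff[OF G] by (auto simp: mp_1)
  have F0: "peval center (F l) = 0" if "l < m - r" for l
    using ambient_param(2)[of l] that by simp
  \<comment> \<open>The equations contribute their coefficients at \<open>center\<close>, divided by
    the value of the multiplier; the parameters contribute the scalars
    \<open>\<beta>\<close>.\<close>
  define L where "L i = (if i < m - r then peval center (Q i) / peval center U else \<beta> (i - (m - r)))" for i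
  have "(\<Sum>i<m. L i * pdir center (unitv k) (ambient_param i)) = (if j = k then 1 else 0)" if "k < m" for k
  proof -
    let ?D = "pdir center (unitv k)"
    \<comment> \<open>At \<open>center\<close> both \<open>G\<close> and the equations vanish, and
      \<open>E\<close> vanishes to second order; the product rule leaves only terms in which
      \<open>G\<close> or an equation is differentiated.\<close>
    have "?D (U * G) = peval center U * ?D G" by (simp add: pdir_mult G0)
    moreover have "?D (U * G) = (\<Sum>l<m - r. peval center (Q l) * ?D (F l))"
      unfolding U(5) using npow_vanish[OF U(4)] by (simp add: pdir_add pdir_sum pdir_mult F0)
    ultimately have "?D G = (\<Sum>l<m - r. peval center (Q l) / peval center U * ?D (F l))"
      using U(2) by (simp add: sum_divide_distrib[symmetric] field_simps)
    moreover have "?D G = (if j = k then 1 else 0) - (\<Sum>i<r. \<beta> i * ?D (approx_param i))"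
      by (simp add: G_def pdir_minus pdir_sum pdir_mult)
    ultimately have "(if j = k then 1 else 0) = (\<Sum>l<m - r. peval center (Q l) / peval center U * ?D (F l))
        + (\<Sum>i<r. \<beta> i * ?D (approx_param i))" by (simp add: algebra_simps)
    then show ?thesis by (simp add: sum_lessThan_split[OF r_le_m] L_def)
  qed
  then show ?thesis by blast
qed

text \<open>The m - r equations and r parameters make the matrix square, so its left inverse is also
  a right inverse.\<close>

lemma jacobian_right_inverse:
  obtains A where "\<And>i k. i < m \<Longrightarrow> k < m \<Longrightarrow>
    (\<Sum>j<m. pdir center (unitv j) (ambient_param i) * A j k) = (if i = k then 1 else 0)"
proof -
  define L where "L j = (SOME L. \<forall>k<m. (\<Sum>i<m. L i * pdir center (unitv k) (ambient_param i))
      = (if j = k then 1 else 0))" for j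
  have L: "(\<Sum>i<m. L j i * pdir center (unitv k) (ambient_param i)) = (if j = k then 1 else 0)"
    if "j < m" "k < m" for j k
    using someI_ex[OF jacobian_left_inverse[OF that(1)]] that(2) unfolding L_def by blast
  let ?L = "mat m m (\<lambda>(j, i). L j i)" and ?J = "mat m m (\<lambda>(i, k). pdir center (unitv k) (ambient_param i))"
  have "?L * ?J = 1\<^sub>m m"
    by (rule eq_matI) (simp_all add: scalar_prod_def L flip: lessThan_atLeast0)
  then have JL: "?J * ?L = 1\<^sub>m m" by (intro mat_mult_left_right_inverse[of ?L m ?J] mat_carrier)
  have "(\<Sum>j<m. pdir center (unitv j) (ambient_param i) * L j k) = (if i = k then 1 else 0)"
    if "i < m" "k < m" for i k
  proof -
    have "(?J * ?L) $$ (i, k) = (\<Sum>j<m. pdir center (unitv j) (ambient_param i) * L j k)"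
      using that by (simp add: scalar_prod_def flip: lessThan_atLeast0)
    then show ?thesis using that by (simp add: JL)
  qed
  then show thesis by (rule that)
qed

end

section \<open>Leading forms and the associated graded ring\<close>

context param_point
begin

lemma mp_mult_mp: "f \<in> mp M \<Longrightarrow> g \<in> mp N \<Longrightarrow> f * g \<in> mp (M + N)"
proof (induction M arbitrary: f)
  case 0
  then show ?case by (simp add: mp_0 mp_mult)
next
  case (Suc M)
  then obtain b where b: "\<And>j. j < r \<Longrightarrow> b j \<in> mp M" "f = (\<Sum>j<r. b j * x j)"
    by (auto simp: mp_Suc elim!: span_ofE)
  have "f * g = (\<Sum>j<r. x j * (b j * g))" by (simp add: b(2) sum_distrib_left mult_ac)
  also have "\<dots> \<in> mp (Suc (M + N))" using Suc b(1) by (intro mp_intros mp_x_mult) auto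
  finally show ?case by simp
qed

text \<open>Equality of classes in m^d/m^(d+1).\<close>

definition same_leading :: "nat \<Rightarrow> 'K \<Rightarrow> 'K \<Rightarrow> bool" where
  "same_leading d f g \<longleftrightarrow> f \<in> mp d \<and> g \<in> mp d \<and> f - g \<in> mp (Suc d)"

lemma same_leading_mult:
  assumes "same_leading a f f'" "same_leading b g g'"
  shows "same_leading (a + b) (f * g) (f' * g')"
proof -
  have "f * g - f' * g' = f * (g - g') + (f - f') * g'" by (simp add: algebra_simps)
  then show ?thesis
    using assms mp_mult_mp[of f a "g - g'" "Suc b"] mp_mult_mp[of "f - f'" "Suc a" g' b]
    by (auto simp: same_leading_def intro: mp_mult_mp mp_intros)
qed

lemma same_leading_one: "same_leading 0 1 1"
  using P_intros(2) mp_intros(1) by (simp add: same_leading_def mp_0)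

lemma same_leading_monom:
  assumes "\<And>j. j < r \<Longrightarrow> same_leading 1 (u j) (w j)" "Poly_Mapping.keys I \<subseteq> {..<r}"
  shows "same_leading (mdeg I) (monom_at u I) (monom_at w I)"
proof -
  have pow: "same_leading a (u j ^ a) (w j ^ a)" if "j < r" for j a
    using same_leading_mult[OF assms(1)[OF that]] by (induction a) (simp_all add: same_leading_one)
  have "same_leading (\<Sum>i\<in>A. l i) (\<Prod>i\<in>A. u i ^ l i) (\<Prod>i\<in>A. w i ^ l i)"
    if "finite A" "A \<subseteq> {..<r}" for A and l :: "nat \<Rightarrow> nat"
    using that by (induction A) (simp_all add: same_leading_one same_leading_mult pow)
  then show ?thesis using assms(2) by (simp add: monom_at_def mdeg_def)
qed

end

context smooth_point
begin

text \<open>A substitution that kills the equations and sends the lifted parameters to the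
  variables, up to order d+1, turns the relation into one between polynomials: a series with nonzero
  constant term times the form with coefficients \<open>e\<close> has order at least d+1. A form of
  degree d with this property is zero.\<close>

lemma hsum_leading:
  assumes e: "hsum d e \<in> mp (Suc d)" and I: "I \<in> hom_idx r d"
  shows "e I = 0"
proof -
  \<comment> \<open>The same form in the polynomial lifts; its value at \<open>s\<close> differs
    from \<open>hsum d e\<close> only in m^(d+1).\<close>
  define G where "G = (\<Sum>I\<in>hom_idx r d. mcon (e I) * monom_at approx_param I)"
  have "in_vars m (monom_at approx_param I)" if "I \<in> hom_idx r d" for I
  proof -
    have pow: "in_vars m (approx_param i ^ a)" if "i < r" for i a
      using approx_param(1)[OF that] by (induction a) auto
    have "in_vars m (\<Prod>i\<in>A. approx_param i ^ l i)" if "finite A" "A \<subseteq> {..<r}" for A and l :: "nat \<Rightarrow> nat"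
      using that pow by (induction A) auto
    then show ?thesis using that by (simp add: monom_at_def hom_idx_def)
  qed
  then have G: "in_vars m G" unfolding G_def by (auto intro!: in_vars_sum)
  have ev_monom: "comm_ring_hom h \<Longrightarrow> eval_at h t (monom_at approx_param I) = monom_at (\<lambda>i. eval_at h t (approx_param i)) I"
    for h :: "'k \<Rightarrow> 'b::comm_ring_1" and t I
  proof -
    assume "comm_ring_hom h"
    then interpret h: comm_ring_hom h .
    have "eval_at h t (F ^ a) = eval_at h t F ^ a" for F a
      by (induction a) (simp_all add: h.eval_mult)
    moreover have "eval_at h t (prod f A) = (\<Prod>i\<in>A. eval_at h t (f i))" for f and A :: "nat set"
      by (induction A rule: infinite_finite_induct) (simp_all add: h.eval_mult)
    ultimately show ?thesis by (simp add: monom_at_def)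
  qed
  have lead: "same_leading 1 (eval_at \<iota> s (approx_param i)) (x i)" if "i < r" for i
    using approx_param(2)[OF that] x_maxid[OF that] approx_param_maxid[OF that]
    by (simp add: same_leading_def mp_1 numeral_2_eq_2)
  have "eval_at \<iota> s G - hsum d e
      = (\<Sum>I\<in>hom_idx r d. \<iota> (e I) * (monom_at (\<lambda>i. eval_at \<iota> s (approx_param i)) I - monom_at x I))"
    by (simp add: G_def hsum_def eval_sum eval_mult ev_monom[OF comm_ring_hom_axioms] right_diff_distrib sum_subtractf)
  also have "\<dots> \<in> mp (Suc d)"
    using same_leading_monom[OF lead] scalar_in
    by (intro mp_intros(5) mp_mult(1)) (auto simp: hom_idx_def same_leading_def)
  finally have "eval_at \<iota> s G \<in> mp (Suc d)" using mp_intros(2)[OF _ e] by fastforce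
  from G this obtain U Q E where U: "in_vars m U" "peval center U \<noteq> 0" "\<And>l. l < m - r \<Longrightarrow> in_vars m (Q l)"
    "npow center m (Suc d) E" "U * G = (\<Sum>l<m - r. Q l * F l) + E" by (rule lift) (rule that)
  obtain A where A: "\<And>i k. i < m \<Longrightarrow> k < m \<Longrightarrow>
    (\<Sum>j<m. pdir center (unitv j) (ambient_param i) * A j k) = (if i = k then 1 else 0)"
    using jacobian_right_inverse by blast
  \<comment> \<open>The targets of the Newton iteration: 0 for an equation, the i-th variable for
    the i-th parameter.\<close>
  define Y :: "nat \<Rightarrow> 'k mpol" where "Y k = (if k < m - r then 0 else mvar (k - (m - r)))" for k
  have Y: "Y k \<in> ord (Suc 0)" for k by (simp add: Y_def mvar_ord ord_intros)
  have "\<exists>\<tau>. centered center m \<tau> \<and> (\<forall>k<m. eval_at mcon \<tau> (ambient_param k) - Y k \<in> ord (Suc d))"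
    by (rule hensel[where A = A]) (simp_all add: ambient_param Y A)
  then obtain \<tau> where \<tau>: "centered center m \<tau>" "\<And>k. k < m \<Longrightarrow> eval_at mcon \<tau> (ambient_param k) - Y k \<in> ord (Suc d)"
    by blast
  interpret con: comm_ring_hom "mcon :: 'k \<Rightarrow> 'k mpol" by (rule mcon_hom)
  have F\<tau>: "eval_at mcon \<tau> (F l) \<in> ord (Suc d)" if "l < m - r" for l
    using \<tau>(2)[of l] that by (simp add: Y_def)
  have X\<tau>: "eval_at mcon \<tau> (approx_param i) - mvar i \<in> ord (Suc d)" if "i < r" for i
  proof -
    have "m - r + i < m" using that r_le_m by simp
    moreover have "Y (m - r + i) = mvar i" by (simp add: Y_def)
    ultimately show ?thesis using \<tau>(2)[of "m - r + i"] by simp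
  qed
  \<comment> \<open>Under the substitution every equation has order above d, and \<open>E\<close>
    does by its order at \<open>center\<close>.\<close>
  have UG: "eval_at mcon \<tau> U * eval_at mcon \<tau> G \<in> ord (Suc d)"
    using npow_ord[OF U(4) \<tau>(1)] F\<tau>
    by (simp only: con.eval_mult[symmetric] U(5) con.eval_add con.eval_sum)
      (auto simp: con.eval_mult intro!: ord_intros(2,5,6))
  define W where "W = (\<Sum>I\<in>hom_idx r d. Poly_Mapping.single I (e I))"
  have "eval_at mcon \<tau> G - W
      = (\<Sum>I\<in>hom_idx r d. mcon (e I) * (monom_at (\<lambda>i. eval_at mcon \<tau> (approx_param i)) I - monom_at mvar I))"
    by (simp add: G_def W_def con.eval_sum con.eval_mult ev_monom[OF mcon_hom] right_diff_distrib
        sum_subtractf monom_at_mvar mult_single)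
  also have "\<dots> \<in> ord (Suc d)"
  proof (intro ord_intros(5,6))
    fix I assume "I \<in> hom_idx r d"
    then show "monom_at (\<lambda>i. eval_at mcon \<tau> (approx_param i)) I - monom_at mvar I \<in> ord (Suc d)"
      using X\<tau> by (intro monom_at_diff_ideal[OF is_subring_UNIV ord_ideal, of r]) (auto simp: hom_idx_def)
  qed
  finally have GW: "eval_at mcon \<tau> G - W \<in> ord (Suc d)" .
  have W: "W \<in> ord d" unfolding W_def by (intro ord_intros(5)) (auto simp: ord_def hom_idx_def)
  \<comment> \<open>As \<open>W\<close> has order d, only the constant term of the multiplier
    \<open>U\<close> counts modulo order d+1.\<close>
  have "(eval_at mcon \<tau> U - mcon (peval center U)) * W \<in> ord (Suc d)"
    using ord_mult[OF eval_mcon_const[OF \<tau>(1) U(1)] W] by simp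
  moreover have "mcon (peval center U) * W = eval_at mcon \<tau> U * eval_at mcon \<tau> G
      - eval_at mcon \<tau> U * (eval_at mcon \<tau> G - W) - (eval_at mcon \<tau> U - mcon (peval center U)) * W"
    by (simp add: algebra_simps)
  ultimately have cW: "mcon (peval center U) * W \<in> ord (Suc d)"
    using UG GW by (simp only: ord_intros)
  have coeff: "Poly_Mapping.lookup (mcon (peval center U) * W) I = peval center U * e I"
  proof -
    have "mcon (peval center U) * W = (\<Sum>L\<in>hom_idx r d. Poly_Mapping.single L (peval center U * e L))"
      by (simp add: W_def sum_distrib_left mult_single)
    then show ?thesis using I by (simp add: lookup_sum lookup_single when_def)
  qed
  from cW have "I \<notin> Poly_Mapping.keys (mcon (peval center U) * W) \<or> Suc d \<le> mdeg I"
    unfolding ord_def by blast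
  moreover have "mdeg I = d" using I by (simp add: hom_idx_def)
  ultimately have "Poly_Mapping.lookup (mcon (peval center U) * W) I = 0" by (simp add: in_keys_iff)
  with coeff have "peval center U * e I = 0" by simp
  then show ?thesis using U(2) by simp
qed

end


section \<open>Power series expansions\<close>

context param_point
begin

lemma expands_to_iff:
  "expands_to \<iota> r P x g c \<longleftrightarrow>
    (\<forall>I. \<not> Poly_Mapping.keys I \<subseteq> {..<r} \<longrightarrow> c I = 0) \<and> (\<forall>N. g - lsum N c \<in> mp N)"
  by (simp add: expands_to_def lsum_def low_idx_def)

text \<open>The monomials of degree N generate m^N. The ideal stays arbitrary in the induction
  because the step uses the quotient of \<open>J\<close> by a parameter.\<close>

lemma mp_subset_ideal:
  assumes "is_ideal P J" "\<And>I. I \<in> hom_idx r N \<Longrightarrow> monom_at x I \<in> J"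
  shows "mp N \<subseteq> J"
  using assms
proof (induction N arbitrary: J)
  case 0
  then have "1 \<in> J" by (simp add: hom_idx_0)
  then show ?case using is_idealD(4)[OF 0(1), of _ 1] by (auto simp: mp_0)
next
  case (Suc N)
  have sub: "mp N \<subseteq> {u \<in> P. u * x j \<in> J}" if j: "j < r" for j
  proof (rule Suc.IH)
    show "is_ideal P {u \<in> P. u * x j \<in> J}"
      using is_idealD[OF Suc.prems(1)] by (auto simp: is_ideal_def ring_distribs mult.assoc P_intros)
    fix I assume I: "I \<in> hom_idx r N"
    then have "I + Poly_Mapping.single j 1 \<in> hom_idx r (Suc N)"
      using j by (auto simp: hom_idx_def keys_add_nat mdeg_add)
    from Suc.prems(2)[OF this] show "monom_at x I \<in> {u \<in> P. u * x j \<in> J}"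
      using I mp_monom[of I] mp_in by (auto simp: monom_at_add hom_idx_def)
  qed
  then show ?case by (auto simp: mp_Suc elim!: span_ofE intro!: is_ideal_sum[OF Suc.prems(1)])
qed

abbreviation power_ideal :: "nat \<Rightarrow> 'K set" where
  "power_ideal b \<equiv> span_of P (\<lambda>i. x i ^ b) r"

lemma power_ideal: "is_ideal P (power_ideal b)"
  using x_in by (intro span_of_ideal is_ideal_self subring) (auto intro: P_intros)

lemma monom_in_power_ideal:
  assumes "Poly_Mapping.keys I \<subseteq> {..<r}" "k < r" "b \<le> Poly_Mapping.lookup I k"
  shows "monom_at x I \<in> power_ideal b"
proof -
  let ?M = "I - Poly_Mapping.single k b"
  have I: "I = ?M + Poly_Mapping.single k b"
    by (rule poly_mapping_eqI) (use assms(3) in \<open>auto simp: lookup_add lookup_minus lookup_single when_def\<close>)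
  have "Poly_Mapping.keys ?M \<subseteq> {..<r}"
    using assms(1) by (auto simp: in_keys_iff lookup_minus subset_iff)
  then have "monom_at x ?M \<in> P" using mp_monom mp_in by blast
  then have "monom_at x ?M * x k ^ b \<in> power_ideal b"
    using span_of_generator[OF P_intros(1) _ assms(2), of _ "\<lambda>i. x i ^ b"] by blast
  then show ?thesis by (subst I) (simp add: monom_at_add)
qed

text \<open>Pigeonhole on the exponents of a monomial. The bound is not sharp; the successor keeps r
  = 0 correct, where \<open>mp 0\<close> is the whole ring and the power ideal is zero.\<close>

lemma mp_subset_power_ideal: "mp (Suc (r * b)) \<subseteq> power_ideal b"
proof (rule mp_subset_ideal[OF power_ideal])
  fix I assume I: "I \<in> hom_idx r (Suc (r * b))"
  have "\<exists>k<r. b \<le> Poly_Mapping.lookup I k"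
  proof (rule ccontr)
    assume "\<not> (\<exists>k<r. b \<le> Poly_Mapping.lookup I k)"
    then have "(\<Sum>i<r. Poly_Mapping.lookup I i) \<le> (\<Sum>i<r. b)" by (intro sum_mono) auto
    then show False using I mdeg_superset[of "{..<r}" I] by (simp add: hom_idx_def)
  qed
  then show "monom_at x I \<in> power_ideal b" using I monom_in_power_ideal by (auto simp: hom_idx_def)
qed

end

context smooth_point
begin

text \<open>Coefficients vanish degree by degree: once the lower ones are zero, the top form alone
  lies in the next power and \<open>hsum_leading\<close> applies.\<close>

lemma lsum_zero_imp: "lsum N c \<in> mp N \<Longrightarrow> I \<in> low_idx r N \<Longrightarrow> c I = 0"
proof (induction N arbitrary: I)
  case (Suc N)
  have "lsum (Suc N) c - hsum N c \<in> mp N"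
    using Suc.prems(1) mp_Suc_subset hsum_in by (intro mp_intros(3)) auto
  then have low: "c J = 0" if "J \<in> low_idx r N" for J
    using Suc.IH that by (simp add: lsum_Suc)
  then have "lsum N c = 0" by (simp add: lsum_def)
  then have "hsum N c \<in> mp (Suc N)" using Suc.prems by (simp add: lsum_Suc)
  then show ?case using low hsum_leading[of N c I] Suc.prems by (auto simp: low_idx_Suc)
qed simp

lemma lsum_diff: "lsum N (\<lambda>I. c I - e I) = lsum N c - lsum N e"
  by (simp add: lsum_def hom_minus algebra_simps sum_subtractf)

lemma lsum_add: "lsum N (\<lambda>I. c I + e I) = lsum N c + lsum N e"
  by (simp add: lsum_def hom_add algebra_simps sum.distrib)

lemma lsum_scale: "lsum N (\<lambda>I. a * e I) = \<iota> a * lsum N e"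
  by (simp add: lsum_def hom_mult sum_distrib_left mult_ac)

lemma approx_unique:
  assumes "g - lsum N c \<in> mp N" "g - lsum N e \<in> mp N" "I \<in> low_idx r N"
  shows "c I = e I"
proof -
  have "(g - lsum N e) - (g - lsum N c) \<in> mp N" by (rule mp_intros(3)[OF assms(2,1)])
  then have "lsum N (\<lambda>I. c I - e I) \<in> mp N" by (simp add: lsum_diff)
  then show ?thesis using lsum_zero_imp[of N "\<lambda>I. c I - e I" I] assms(3) by simp
qed

lemma expands_to_unique:
  assumes "expands_to \<iota> r P x g c" "expands_to \<iota> r P x g e"
  shows "c = e"
proof
  fix I
  show "c I = e I"
  proof (cases "Poly_Mapping.keys I \<subseteq> {..<r}")
    case True
    then show ?thesis
      using assms approx_unique[of g "Suc (mdeg I)" c e I] by (simp add: expands_to_iff low_idx_def)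
  qed (use assms in \<open>simp add: expands_to_iff\<close>)
qed

text \<open>Approximations of different orders agree on their common range by uniqueness, so they
  glue to one series.\<close>

lemma expands_to_exists:
  assumes "g \<in> P"
  shows "\<exists>c. expands_to \<iota> r P x g c"
proof -
  obtain e where e: "\<And>N. g - lsum N (e N) \<in> mp N" using approx[OF assms] by metis
  \<comment> \<open>Order \<open>Suc (mdeg I)\<close> is the first whose approximation contains the
    index \<open>I\<close>.\<close>
  define c where "c I = (if Poly_Mapping.keys I \<subseteq> {..<r} then e (Suc (mdeg I)) I else 0)" for I
  have agree: "e M I = e N I" if "I \<in> low_idx r M" "M \<le> N" for I M N
  proof -
    have eq: "lsum N (e N) = lsum M (e N) + (\<Sum>I\<in>low_idx r N - low_idx r M. \<iota> (e N I) * monom_at x I)"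
    proof -
      have "low_idx r M \<subseteq> low_idx r N" using that(2) by (auto simp: low_idx_def)
      from sum.subset_diff[OF this finite_low_idx] show ?thesis by (simp add: lsum_def add.commute)
    qed
    have "(\<Sum>I\<in>low_idx r N - low_idx r M. \<iota> (e N I) * monom_at x I) \<in> mp M"
    proof (intro mp_intros(5) mp_mult(1) scalar_in)
      fix I assume "I \<in> low_idx r N - low_idx r M"
      then have "Poly_Mapping.keys I \<subseteq> {..<r}" "M \<le> mdeg I" by (auto simp: low_idx_def)
      then show "monom_at x I \<in> mp M" using mp_monom mp_mono by blast
    qed
    from mp_intros(2)[OF _ this, of "g - lsum N (e N)"] have "g - lsum M (e N) \<in> mp M"
      using e[of N] mp_mono[OF that(2)] by (simp add: eq subset_iff)
    then show ?thesis using approx_unique e[of M] that(1) by blast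
  qed
  have "lsum N c = lsum N (e N)" for N
    unfolding lsum_def
  proof (intro sum.cong refl)
    fix I assume I: "I \<in> low_idx r N"
    then show "\<iota> (c I) * monom_at x I = \<iota> (e N I) * monom_at x I"
      using agree[of I "Suc (mdeg I)" N] by (simp add: c_def low_idx_def)
  qed
  then have "expands_to \<iota> r P x g c" using e by (simp add: expands_to_iff c_def)
  then show ?thesis by blast
qed

abbreviation ex :: "'K \<Rightarrow> (nat \<Rightarrow>\<^sub>0 nat) \<Rightarrow> 'k" where
  "ex \<equiv> expansion \<iota> r P x"

lemma expansion_eqI: "expands_to \<iota> r P x g c \<Longrightarrow> ex g = c"
  unfolding expansion_def using expands_to_unique by blast

lemma expands_to_expansion: "g \<in> P \<Longrightarrow> expands_to \<iota> r P x g (ex g)"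
  using expands_to_exists expansion_eqI by blast

lemma expansion_outside: "g \<in> P \<Longrightarrow> \<not> Poly_Mapping.keys I \<subseteq> {..<r} \<Longrightarrow> ex g I = 0"
  using expands_to_expansion by (auto simp: expands_to_iff)

lemma expansion_approx: "g \<in> P \<Longrightarrow> g - lsum N (ex g) \<in> mp N"
  using expands_to_expansion by (auto simp: expands_to_iff)

lemma expansion_add: "g \<in> P \<Longrightarrow> h \<in> P \<Longrightarrow> ex (g + h) = (\<lambda>I. ex g I + ex h I)"
  using expansion_approx[of g] expansion_approx[of h] mp_intros(2)
  by (intro expansion_eqI) (auto simp: expands_to_iff expansion_outside lsum_add add_diff_add)

lemma expansion_zero: "ex 0 = (\<lambda>_. 0)"
  using mp_intros(1) by (intro expansion_eqI) (simp add: expands_to_iff lsum_def)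

lemma expansion_sum: "(\<And>j. j \<in> A \<Longrightarrow> g j \<in> P) \<Longrightarrow> ex (\<Sum>j\<in>A. g j) = (\<lambda>I. \<Sum>j\<in>A. ex (g j) I)"
  by (induction A rule: infinite_finite_induct) (simp_all add: expansion_zero expansion_add P_intros)

lemma expansion_scale: "g \<in> P \<Longrightarrow> ex (\<iota> a * g) = (\<lambda>I. a * ex g I)"
  using expansion_approx[of g] mp_mult(1)[OF scalar_in]
  by (intro expansion_eqI)
    (auto simp: expands_to_iff expansion_outside lsum_scale simp flip: right_diff_distrib)

text \<open>Monomials are the only nonconstant factors whose effect on expansions is used, so a
  general product of series can be avoided.\<close>

lemma expansion_monom_mult:
  assumes "g \<in> P" and K: "Poly_Mapping.keys K \<subseteq> {..<r}"
  shows "ex (monom_at x K * g) = shift K (ex g)"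
proof (rule expansion_eqI, unfold expands_to_iff, intro conjI allI impI)
  fix I :: "nat \<Rightarrow>\<^sub>0 nat" assume "\<not> Poly_Mapping.keys I \<subseteq> {..<r}"
  then have "\<not> Poly_Mapping.keys M \<subseteq> {..<r}" if "I = K + M" for M
    using K that by (simp add: keys_add_nat)
  then show "shift K (ex g) I = 0"
    using expansion_outside[OF assms(1)] by (auto simp: shift_def)
next
  fix N
  \<comment> \<open>The monomial raises the order by \<open>mdeg K\<close>, so the other factor is
    needed to order \<open>N - mdeg K\<close> only; truncated subtraction covers small N.\<close>
  have eq: "lsum N (shift K (ex g)) = monom_at x K * lsum (N - mdeg K) (ex g)"
    unfolding lsum_def by (rule sum_shift_low[where \<iota> = \<iota>, OF K hom_zero])
  have "monom_at x K * (g - lsum (N - mdeg K) (ex g)) \<in> mp (mdeg K + (N - mdeg K))"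
    using expansion_approx[OF assms(1)] by (rule mp_monom_mult[OF K])
  also have "\<dots> \<subseteq> mp N" by (rule mp_mono) simp
  finally show "monom_at x K * g - lsum N (shift K (ex g)) \<in> mp N"
    by (simp add: eq right_diff_distrib)
qed

text \<open>The coefficient of u at I is that of x^K u at K + I, and \<open>q k * x k ^ b\<close>
  contributes only to indices with k-th exponent at least b. The choices of K as 0, as b in one
  place and as e in all places give the three facts on power ideals below.\<close>

lemma expansion_zero_if_monom_mult:
  assumes "u \<in> P" "Poly_Mapping.keys K \<subseteq> {..<r}" "\<And>k. k < r \<Longrightarrow> q k \<in> P"
    and eq: "monom_at x K * u = (\<Sum>k<r. q k * x k ^ b)"
    and small: "\<And>k. k < r \<Longrightarrow> Poly_Mapping.lookup (K + I) k < b \<or> q k = 0"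
  shows "ex u I = 0"
proof -
  have "ex u I = ex (monom_at x K * u) (K + I)"
    using assms(1,2) by (simp add: expansion_monom_mult)
  also have "\<dots> = (\<Sum>k<r. ex (monom_at x (Poly_Mapping.single k b) * q k) (K + I))"
    unfolding eq by (subst expansion_sum) (auto intro!: P_intros x_in assms(3) simp: mult.commute)
  also have "\<dots> = 0"
  proof (intro sum.neutral ballI)
    fix k assume "k \<in> {..<r}"
    then have k: "k < r" by simp
    have "K + I \<notin> range ((+) (Poly_Mapping.single k b))" if "Poly_Mapping.lookup (K + I) k < b"
    proof
      assume "K + I \<in> range ((+) (Poly_Mapping.single k b))"
      then obtain M where "K + I = Poly_Mapping.single k b + M" by auto
      then have "b \<le> Poly_Mapping.lookup (K + I) k" by (simp add: lookup_add)
      then show False using that by simp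
    qed
    moreover have "Poly_Mapping.keys (Poly_Mapping.single k b) \<subseteq> {..<r}" using k by simp
    ultimately show "ex (monom_at x (Poly_Mapping.single k b) * q k) (K + I) = 0"
      using small[OF k] assms(3)[OF k] by (auto simp: expansion_monom_mult expansion_zero shift_def simp del: monom_at_single)
  qed
  finally show ?thesis .
qed

text \<open>Beyond degree r b every term lies in the power ideal, and below that degree each
  monomial with some exponent at least b does; the remaining coefficients decide.\<close>

lemma power_idealI:
  assumes "u \<in> P"
    and zero: "\<And>I. Poly_Mapping.keys I \<subseteq> {..<r} \<Longrightarrow> \<forall>k<r. Poly_Mapping.lookup I k < b \<Longrightarrow> ex u I = 0"
  shows "u \<in> power_ideal b"
proof -
  let ?N = "Suc (r * b)"
  have "u - lsum ?N (ex u) \<in> power_ideal b"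
    using expansion_approx[OF assms(1)] mp_subset_power_ideal by blast
  moreover have "lsum ?N (ex u) \<in> power_ideal b"
    unfolding lsum_def
  proof (rule is_ideal_sum[OF power_ideal])
    fix I assume "I \<in> low_idx r ?N"
    then have I: "Poly_Mapping.keys I \<subseteq> {..<r}" by (simp add: low_idx_def)
    show "\<iota> (ex u I) * monom_at x I \<in> power_ideal b"
    proof (cases "\<forall>k<r. Poly_Mapping.lookup I k < b")
      case True
      then show ?thesis using zero[OF I] is_idealD(2)[OF power_ideal] by simp
    next
      case False
      then obtain k where "k < r" "b \<le> Poly_Mapping.lookup I k" by (meson not_less)
      then show ?thesis using monom_in_power_ideal[OF I] is_idealD(4)[OF power_ideal scalar_in] by blast
    qed
  qed
  ultimately show ?thesis using is_idealD(3)[OF power_ideal] by fastforce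
qed

lemma power_ideal_expansion:
  assumes "u \<in> power_ideal b" "\<forall>k<r. Poly_Mapping.lookup I k < b"
  shows "ex u I = 0"
proof -
  obtain q where q: "\<And>k. k < r \<Longrightarrow> q k \<in> P" "u = (\<Sum>k<r. q k * x k ^ b)"
    using assms(1) by (auto elim!: span_ofE)
  show ?thesis
    using is_idealD(1)[OF power_ideal] assms q
    by (intro expansion_zero_if_monom_mult[of u 0 q b]) auto
qed

text \<open>The condition \<open>q i = 0\<close> says that the product lies in the ideal of the
  other powers; this is the colon property of a regular sequence in the form needed for
  determinants.\<close>

lemma power_colon:
  assumes "i < r" "u \<in> P" "\<And>k. k < r \<Longrightarrow> q k \<in> P" "q i = 0" "x i ^ b * u = (\<Sum>k<r. q k * x k ^ b)"
  shows "u \<in> power_ideal b"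
proof (rule power_idealI[OF assms(2)])
  fix I assume I: "Poly_Mapping.keys I \<subseteq> {..<r}" "\<forall>k<r. Poly_Mapping.lookup I k < b"
  show "ex u I = 0"
    using assms I
    by (intro expansion_zero_if_monom_mult[of u "Poly_Mapping.single i b" q b])
      (auto simp: lookup_add lookup_single when_def)
qed

text \<open>The way back from the enlarged exponents: division by the product of all
  \<open>x i ^ e\<close> lowers every exponent of the power ideal by e.\<close>

lemma power_ideal_cancel:
  assumes "u \<in> P" "(\<Prod>i<r. x i ^ e) * u \<in> power_ideal (a + e)"
  shows "u \<in> power_ideal a"
proof (rule power_idealI[OF assms(1)])
  fix I assume I: "Poly_Mapping.keys I \<subseteq> {..<r}" "\<forall>k<r. Poly_Mapping.lookup I k < a"
  let ?K = "\<Sum>i<r. Poly_Mapping.single i e"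
  have K: "Poly_Mapping.lookup ?K k = (if k < r then e else 0)" for k
    by (auto simp: lookup_sum lookup_single when_def)
  then have keys: "Poly_Mapping.keys ?K \<subseteq> {..<r}" by (auto simp: in_keys_iff split: if_splits)
  have monom: "monom_at x ?K = (\<Prod>i<r. x i ^ e)"
    unfolding monom_at_superset[OF finite_lessThan keys] by (simp add: K)
  obtain q where q: "\<And>k. k < r \<Longrightarrow> q k \<in> P" "(\<Prod>i<r. x i ^ e) * u = (\<Sum>k<r. q k * x k ^ (a + e))"
    using assms(2) by (auto elim!: span_ofE)
  show "ex u I = 0"
    using I(2) q monom
    by (intro expansion_zero_if_monom_mult[OF assms(1) keys, of q "a + e"]) (auto simp: lookup_add K)
qed

end

section \<open>Independence of the transition matrix\<close>

text \<open>Cofactors along row k do not see that row, so Laplace expansion shows linearity in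
  it.\<close>

lemma det_row_diff:
  assumes "k < n"
  shows "det (mat n n (\<lambda>(i, j). if i = k then u j else M i j)) - det (mat n n (\<lambda>(i, j). if i = k then v j else M i j))
    = det (mat n n (\<lambda>(i, j). if i = k then u j - v j else M i j))"
proof -
  let ?C = "\<lambda>u. mat n n (\<lambda>(i, j). if i = k then u j else M i j)"
  have del: "mat_delete (?C u) k j = mat_delete (?C v) k j" for u v j
    using assms by (intro eq_matI) (auto simp: mat_delete_def)
  have cof: "cofactor (?C u) k j = cofactor (?C v) k j" for u v j
    unfolding cofactor_def by (simp only: del[of u j v])
  have lap: "det (?C w) = (\<Sum>j<n. w j * cofactor (?C v) k j)" for w
    using laplace_expansion_row[of "?C w" n k] assms cof[of w _ v] by simp
  show ?thesis
    unfolding lap by (simp add: left_diff_distrib sum_subtractf)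
qed

context smooth_point
begin

lemma transition_det_unique:
  assumes f: "\<And>j. j < r \<Longrightarrow> f j \<in> P"
    and A: "\<And>i j. i < r \<Longrightarrow> j < r \<Longrightarrow> A i j \<in> P" "\<And>i. i < r \<Longrightarrow> x i ^ b = (\<Sum>j<r. A i j * f j)"
    and B: "\<And>i j. i < r \<Longrightarrow> j < r \<Longrightarrow> B i j \<in> P" "\<And>i. i < r \<Longrightarrow> x i ^ b = (\<Sum>j<r. B i j * f j)"
  shows "det (mat r r (\<lambda>(i, j). A i j)) - det (mat r r (\<lambda>(i, j). B i j)) \<in> power_ideal b"
proof -
  \<comment> \<open>Hybrid matrices with the first k rows from A and the others from B; consecutive
    ones differ in a single row.\<close>
  define C where "C k i j = (if i < k then A i j else B i j)" for k i j
  have C: "C k i j \<in> P" "(\<Sum>j<r. C k i j * f j) = x i ^ b" if "i < r" "j < r" for i j k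
    using A(1)[OF that] B(1)[OF that] A(2)[OF that(1)] B(2)[OF that(1)] by (cases "i < k"; simp add: C_def)+
  have step: "det (mat r r (\<lambda>(i, j). C (Suc k) i j)) - det (mat r r (\<lambda>(i, j). C k i j)) \<in> power_ideal b"
    if k: "k < r" for k
  proof -
    \<comment> \<open>Its row k is a difference of two representations of \<open>x k ^ b\<close>,
      hence annihilates f; the other rows still yield the powers of the parameters.\<close>
    define W where "W = mat r r (\<lambda>(i, j). if i = k then A k j - B k j else C k i j)"
    have W: "W \<in> carrier_mat r r" by (simp add: W_def)
    have W_in: "W $$ (i, j) \<in> P" if "i < r" "j < r" for i j
      using that C A(1) B(1) by (auto simp: W_def intro: P_intros)
    have "(\<lambda>(i, j). C (Suc k) i j) = (\<lambda>(i, j). if i = k then A k j else C k i j)"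
      "(\<lambda>(i, j). C k i j) = (\<lambda>(i, j). if i = k then B k j else C k i j)"
      by (auto simp: C_def fun_eq_iff)
    then have diff: "det (mat r r (\<lambda>(i, j). C (Suc k) i j)) - det (mat r r (\<lambda>(i, j). C k i j)) = det W"
      using det_row_diff[OF k, of "A k" "C k" "B k"] by (simp only: W_def)
    have Wf: "(\<Sum>j<r. W $$ (i, j) * f j) = (if i = k then 0 else x i ^ b)" if "i < r" for i
      using that C(2)[of i i k] A(2)[of k] B(2)[of k] k by (auto simp: W_def left_diff_distrib sum_subtractf)
    \<comment> \<open>Row k of W maps f to 0, so \<open>x k ^ b\<close> does not occur on the
      right-hand side. This is recorded as \<open>q k = 0\<close> for the colon property.\<close>
    define q where "q i = (if i = k then 0 else \<Sum>l<r. B k l * adj_mat W $$ (l, i))" for i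
    have "x k ^ b * det W = (\<Sum>l<r. B k l * (det W * f l))"
      by (simp add: B(2)[OF k] sum_distrib_left mult_ac)
    also have "\<dots> = (\<Sum>l<r. \<Sum>i<r. B k l * (adj_mat W $$ (l, i) * (if i = k then 0 else x i ^ b)))"
      by (simp add: cramer_sum[OF W] Wf sum_distrib_left)
    also have "\<dots> = (\<Sum>i<r. q i * x i ^ b)"
      by (subst sum.swap, intro sum.cong refl) (auto simp: q_def sum_distrib_right mult.assoc)
    finally have "x k ^ b * det W = (\<Sum>i<r. q i * x i ^ b)" .
    moreover have "q i \<in> P" if "i < r" for i
      using that k B(1) adj_mat_in_subring[OF subring W W_in] by (auto simp: q_def intro!: P_intros)
    ultimately have "det W \<in> power_ideal b"
      using det_in_subring[OF subring W W_in] by (intro power_colon[OF k, of _ q]) (auto simp: q_def)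
    then show ?thesis by (simp only: diff)
  qed
  have "det (mat r r (\<lambda>(i, j). C k i j)) - det (mat r r (\<lambda>(i, j). B i j)) \<in> power_ideal b" if "k \<le> r" for k
    using that
  proof (induction k)
    case 0
    then show ?case using is_idealD(2)[OF power_ideal] by (simp add: C_def)
  next
    case (Suc k)
    then show ?case using is_idealD(3)[OF power_ideal step[of k]] by fastforce
  qed
  from this[of r] have "det (mat r r (\<lambda>(i, j). C r i j)) - det (mat r r (\<lambda>(i, j). B i j)) \<in> power_ideal b" by simp
  moreover have "mat r r (\<lambda>(i, j). C r i j) = mat r r (\<lambda>(i, j). A i j)"
    by (rule eq_matI) (auto simp: C_def)
  ultimately show ?thesis by simp
qed

end


section \<open>Alternating forms\<close>

lemma DerD:
  assumes "\<delta> \<in> Der \<iota>"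
  shows "\<delta> (a + b) = \<delta> a + \<delta> b" "\<delta> (a * b) = a * \<delta> b + b * \<delta> a" "\<delta> (\<iota> c) = 0"
  using assms by (auto simp: Der_def)

lemma Der_zero: "(\<lambda>_. 0) \<in> Der \<iota>"
  by (simp add: Der_def)

lemma Der_add: "D \<in> Der \<iota> \<Longrightarrow> E \<in> Der \<iota> \<Longrightarrow> (\<lambda>z. D z + E z) \<in> Der \<iota>"
  by (simp add: Der_def ring_distribs)

lemma Der_scale: "D \<in> Der \<iota> \<Longrightarrow> (\<lambda>z. a * D z) \<in> Der \<iota>"
  by (simp add: Der_def ring_distribs mult_ac)

lemma Der_sum: "(\<And>k. k \<in> S \<Longrightarrow> E k \<in> Der \<iota>) \<Longrightarrow> (\<lambda>z. \<Sum>k\<in>S. a k * E k z) \<in> Der \<iota>"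
  by (induction S rule: infinite_finite_induct) (simp_all add: Der_zero Der_add Der_scale)

context
  fixes \<iota> :: "'k::field \<Rightarrow> 'K::field" and r :: nat and \<omega> :: "'K dform"
  assumes \<omega>: "\<omega> \<in> forms \<iota> r"
begin

lemma form_cong: "(\<And>i. i < r \<Longrightarrow> \<delta> i = \<delta>' i) \<Longrightarrow> \<omega> \<delta> = \<omega> \<delta>'"
  using \<omega> unfolding forms_def by blast

lemma form_not_Der: "i < r \<Longrightarrow> \<delta> i \<notin> Der \<iota> \<Longrightarrow> \<omega> \<delta> = 0"
  using \<omega> unfolding forms_def by blast

lemma form_add: "i < r \<Longrightarrow> D \<in> Der \<iota> \<Longrightarrow> E \<in> Der \<iota> \<Longrightarrow>
    \<omega> (\<delta>(i := (\<lambda>z. D z + E z))) = \<omega> (\<delta>(i := D)) + \<omega> (\<delta>(i := E))"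
  using \<omega> unfolding forms_def by blast

lemma form_scale: "i < r \<Longrightarrow> D \<in> Der \<iota> \<Longrightarrow> \<omega> (\<delta>(i := (\<lambda>z. a * D z))) = a * \<omega> (\<delta>(i := D))"
  using \<omega> unfolding forms_def by blast

lemma form_alternating: "i < r \<Longrightarrow> j < r \<Longrightarrow> i \<noteq> j \<Longrightarrow> \<delta> i = \<delta> j \<Longrightarrow> \<omega> \<delta> = 0"
  using \<omega> unfolding forms_def by blast

lemma form_sum:
  assumes "i < r" "\<And>k. k \<in> S \<Longrightarrow> E k \<in> Der \<iota>" "finite S"
  shows "\<omega> (\<delta>(i := (\<lambda>z. \<Sum>k\<in>S. a k * E k z))) = (\<Sum>k\<in>S. a k * \<omega> (\<delta>(i := E k)))"
  using assms(3,2)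
proof (induction S)
  case empty
  show ?case using form_scale[OF assms(1) Der_zero, of \<delta> 0] by (simp add: fun_upd_def)
next
  case (insert k S)
  have "\<omega> (\<delta>(i := (\<lambda>z. a k * E k z + (\<Sum>k\<in>S. a k * E k z))))
      = \<omega> (\<delta>(i := (\<lambda>z. a k * E k z))) + \<omega> (\<delta>(i := (\<lambda>z. \<Sum>k\<in>S. a k * E k z)))"
    using insert.prems by (intro form_add[OF assms(1)] Der_scale[of "E k"] Der_sum[of S E]) auto
  then show ?case using insert form_scale[OF assms(1), of "E k" \<delta> "a k"] by (simp add: fun_upd_def)
qed

text \<open>Polarization: with the sum of two derivations in both places, alternation kills the
  total and the two terms with equal arguments. Stated through equal arguments, alternation also
  covers characteristic 2.\<close>

lemma form_swap:
  assumes "a < r" "b < r" "a \<noteq> b" and \<delta>: "\<And>i. i < r \<Longrightarrow> \<delta> i \<in> Der \<iota>"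
  shows "\<omega> (\<lambda>i. \<delta> (transpose a b i)) = - \<omega> \<delta>"
proof -
  define g where "g A B = \<omega> (\<delta>(a := A, b := B))" for A B
  have g': "g A B = \<omega> (\<delta>(b := B, a := A))" for A B
    using assms(3) by (simp add: g_def fun_upd_twist)
  let ?A = "\<delta> a" and ?B = "\<delta> b"
  have A: "?A \<in> Der \<iota>" and B: "?B \<in> Der \<iota>" using \<delta> assms by auto
  let ?S = "\<lambda>z. ?A z + ?B z"
  have "g ?S ?S = g ?A ?S + g ?B ?S"
    unfolding g' by (rule form_add[OF assms(1) A B])
  also have "\<dots> = g ?A ?A + g ?A ?B + (g ?B ?A + g ?B ?B)"
    unfolding g_def by (simp add: form_add[OF assms(2) A B])
  finally have "g ?A ?B + g ?B ?A = 0"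
    using form_alternating[OF assms(1-3)] assms(3) by (simp add: g_def)
  moreover have "g ?A ?B = \<omega> \<delta>" by (simp add: g_def)
  moreover have "g ?B ?A = \<omega> (\<lambda>i. \<delta> (transpose a b i))"
    unfolding g_def by (rule arg_cong[of _ _ \<omega>]) (auto simp: fun_eq_iff transpose_def)
  ultimately show ?thesis by (simp add: eq_neg_iff_add_eq_0 add.commute)
qed

lemma form_permute:
  assumes "p permutes {..<r}" and "\<And>i. i < r \<Longrightarrow> \<delta> i \<in> Der \<iota>"
  shows "\<omega> (\<lambda>i. \<delta> (p i)) = of_int (sign p) * \<omega> \<delta>"
proof -
  have "\<forall>\<delta>. (\<forall>i<r. \<delta> i \<in> Der \<iota>) \<longrightarrow> \<omega> (\<lambda>i. \<delta> (p i)) = of_int (sign p) * \<omega> \<delta>"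
    using assms(1) finite_lessThan[of r]
  proof (induction p rule: permutes_induct)
    case id
    then show ?case by simp
  next
    case (swap a b p)
    have "permutation p" using swap permutation_permutes by blast
    then have sgn: "sign (transpose a b \<circ> p) = - sign p"
      using swap by (simp add: sign_compose permutation_swap_id sign_swap_id)
    show ?case
    proof (intro allI impI)
      fix \<delta> :: "nat \<Rightarrow> 'K \<Rightarrow> 'K" assume \<delta>: "\<forall>i<r. \<delta> i \<in> Der \<iota>"
      then have "\<forall>i<r. \<delta> (transpose a b i) \<in> Der \<iota>" using swap by (auto simp: transpose_def)
      from swap.IH[rule_format, of "\<lambda>i. \<delta> (transpose a b i)"] this
      have "\<omega> (\<lambda>i. \<delta> (transpose a b (p i))) = of_int (sign p) * \<omega> (\<lambda>i. \<delta> (transpose a b i))"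
        by simp
      also have "\<dots> = - (of_int (sign p) * \<omega> \<delta>)"
        using form_swap[of a b \<delta>] swap \<delta> by simp
      finally show "\<omega> (\<lambda>i. \<delta> ((transpose a b \<circ> p) i)) = of_int (sign (transpose a b \<circ> p)) * \<omega> \<delta>"
        by (simp add: sgn)
    qed
  qed
  then show ?thesis using assms(2) by blast
qed

text \<open>Only the first n arguments are expanded; the others are held in an arbitrary
  \<open>\<eta>\<close>, so that the induction can store the vector already chosen for place n
  there.\<close>

lemma form_expand:
  assumes "n \<le> r" "\<And>i. i < r \<Longrightarrow> \<delta> i \<in> Der \<iota>"
  shows "\<omega> (\<lambda>i. if i < n then (\<lambda>z. \<Sum>k<r. A i k * \<delta> k z) else \<eta> i)
    = (\<Sum>p\<in>{..<n} \<rightarrow>\<^sub>E {..<r}. (\<Prod>i<n. A i (p i)) * \<omega> (\<lambda>i. if i < n then \<delta> (p i) else \<eta> i))"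
  using assms(1)
proof (induction n arbitrary: \<eta>)
  case (Suc n)
  let ?c = "\<lambda>i z. \<Sum>k<r. A i k * \<delta> k z"
  have "\<omega> (\<lambda>i. if i < Suc n then ?c i else \<eta> i)
      = \<omega> ((\<lambda>i. if i < n then ?c i else \<eta> i)(n := ?c n))"
    by (rule arg_cong[of _ _ \<omega>]) (auto simp: fun_eq_iff)
  also have "\<dots> = (\<Sum>k<r. A n k * \<omega> ((\<lambda>i. if i < n then ?c i else \<eta> i)(n := \<delta> k)))"
    using Suc.prems assms(2) by (intro form_sum) auto
  also have "\<dots> = (\<Sum>k<r. A n k * \<omega> (\<lambda>i. if i < n then ?c i else (\<eta>(n := \<delta> k)) i))"
    by (intro sum.cong refl arg_cong[of _ _ "\<lambda>u. _ * u"] arg_cong[of _ _ \<omega>]) (auto simp: fun_eq_iff)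
  also have "\<dots> = (\<Sum>k<r. A n k * (\<Sum>p\<in>{..<n} \<rightarrow>\<^sub>E {..<r}. (\<Prod>i<n. A i (p i)) *
      \<omega> (\<lambda>i. if i < n then \<delta> (p i) else (\<eta>(n := \<delta> k)) i)))"
    using Suc by simp
  also have "\<dots> = (\<Sum>(k, p)\<in>{..<r} \<times> ({..<n} \<rightarrow>\<^sub>E {..<r}). A n k * ((\<Prod>i<n. A i (p i)) *
      \<omega> (\<lambda>i. if i < n then \<delta> (p i) else (\<eta>(n := \<delta> k)) i)))"
    by (simp add: sum_distrib_left sum.cartesian_product)
  also have "\<dots> = (\<Sum>(k, p)\<in>{..<r} \<times> ({..<n} \<rightarrow>\<^sub>E {..<r}). (\<Prod>i<Suc n. A i ((p(n := k)) i)) *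
      \<omega> (\<lambda>i. if i < Suc n then \<delta> ((p(n := k)) i) else \<eta> i))"
  proof (intro sum.cong refl, clarify)
    fix k p
    have "(\<Prod>i<Suc n. A i ((p(n := k)) i)) = (\<Prod>i<n. A i (p i)) * A n k" by simp
    moreover have "(\<lambda>i. if i < n then \<delta> (p i) else (\<eta>(n := \<delta> k)) i)
        = (\<lambda>i. if i < Suc n then \<delta> ((p(n := k)) i) else \<eta> i)" by (auto simp: fun_eq_iff)
    ultimately show "A n k * ((\<Prod>i<n. A i (p i)) * \<omega> (\<lambda>i. if i < n then \<delta> (p i) else (\<eta>(n := \<delta> k)) i))
      = (\<Prod>i<Suc n. A i ((p(n := k)) i)) * \<omega> (\<lambda>i. if i < Suc n then \<delta> ((p(n := k)) i) else \<eta> i)"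
      by (simp add: mult_ac)
  qed
  also have "\<dots> = (\<Sum>p\<in>{..<Suc n} \<rightarrow>\<^sub>E {..<r}. (\<Prod>i<Suc n. A i (p i)) *
      \<omega> (\<lambda>i. if i < Suc n then \<delta> (p i) else \<eta> i))"
    unfolding lessThan_Suc PiE_insert_eq using inj_combinator[of n "{..<n}" "\<lambda>_. {..<r}"]
    by (subst sum.reindex) (simp_all add: case_prod_beta')
  finally show ?case .
qed simp

text \<open>After multilinear expansion, choices with a repetition vanish by alternation and the
  others are permutations, which gives the Leibniz formula.\<close>

lemma form_det:
  assumes \<delta>: "\<And>i. i < r \<Longrightarrow> \<delta> i \<in> Der \<iota>" and D: "\<And>i. i < r \<Longrightarrow> D i = (\<lambda>z. \<Sum>k<r. A i k * \<delta> k z)"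
  shows "\<omega> D = det (mat r r (\<lambda>(i, k). A i k)) * \<omega> \<delta>"
proof -
  \<comment> \<open>Permutations are the identity off the index set, while the functions in the
    expansion are undefined there; restriction matches the two.\<close>
  let ?R = "\<lambda>p. restrict p {..<r}"
  have "\<omega> D = \<omega> (\<lambda>i. if i < r then (\<lambda>z. \<Sum>k<r. A i k * \<delta> k z) else D i)"
    using D by (intro form_cong) auto
  also have "\<dots> = (\<Sum>p\<in>{..<r} \<rightarrow>\<^sub>E {..<r}. (\<Prod>i<r. A i (p i)) * \<omega> (\<lambda>i. \<delta> (p i)))"
    unfolding form_expand[where A = A and \<eta> = D and \<delta> = \<delta>, OF order_refl \<delta>, simplified]
    by (intro sum.cong refl arg_cong[of _ _ "\<lambda>u. _ * u"] form_cong) auto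
  also have "\<dots> = (\<Sum>p\<in>?R ` {p. p permutes {..<r}}. (\<Prod>i<r. A i (p i)) * \<omega> (\<lambda>i. \<delta> (p i)))"
  proof (rule sum.mono_neutral_right)
    show "?R ` {p. p permutes {..<r}} \<subseteq> {..<r} \<rightarrow>\<^sub>E {..<r}"
      using permutes_in_image by fastforce
    show "\<forall>p\<in>({..<r} \<rightarrow>\<^sub>E {..<r}) - ?R ` {p. p permutes {..<r}}. (\<Prod>i<r. A i (p i)) * \<omega> (\<lambda>i. \<delta> (p i)) = 0"
    proof
      fix p assume p: "p \<in> ({..<r} \<rightarrow>\<^sub>E {..<r}) - ?R ` {p. p permutes {..<r}}"
      \<comment> \<open>An injective choice, extended by the identity, would be one of the
        permutations removed from the sum.\<close>
      have "\<not> inj_on p {..<r}"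
      proof
        assume inj: "inj_on p {..<r}"
        moreover have "p ` {..<r} \<subseteq> {..<r}" using p by auto
        ultimately have "bij_betw p {..<r} {..<r}"
          by (simp add: bij_betw_def endo_inj_surj)
        then have "bij_betw (\<lambda>i. if i < r then p i else i) {..<r} {..<r}"
          by (subst bij_betw_cong[of _ _ p]) auto
        then have "(\<lambda>i. if i < r then p i else i) permutes {..<r}"
          by (rule bij_imp_permutes) auto
        moreover have "p = ?R (\<lambda>i. if i < r then p i else i)"
          using p by (auto simp: fun_eq_iff PiE_def extensional_def)
        ultimately show False using p by blast
      qed
      then obtain i j where "i < r" "j < r" "i \<noteq> j" "p i = p j" by (auto simp: inj_on_def)
      then show "(\<Prod>i<r. A i (p i)) * \<omega> (\<lambda>i. \<delta> (p i)) = 0"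
        using form_alternating[of i j "\<lambda>i. \<delta> (p i)"] by simp
    qed
  qed (simp add: finite_PiE)
  also have "\<dots> = (\<Sum>p\<in>{p. p permutes {..<r}}. (\<Prod>i<r. A i (?R p i)) * \<omega> (\<lambda>i. \<delta> (?R p i)))"
  proof (rule sum.reindex_cong[OF _ refl refl])
    show "inj_on ?R {p. p permutes {..<r}}"
    proof (rule inj_onI, rule ext)
      fix p q i assume "p \<in> {p. p permutes {..<r}}" "q \<in> {p. p permutes {..<r}}" "?R p = ?R q"
      then show "p i = q i"
        by (cases "i < r") (auto simp: permutes_def fun_eq_iff restrict_def split: if_splits)
    qed
  qed
  also have "\<dots> = (\<Sum>p\<in>{p. p permutes {..<r}}. (\<Prod>i<r. A i (p i)) * (of_int (sign p) * \<omega> \<delta>))"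
  proof (intro sum.cong refl)
    fix p assume p: "p \<in> {p. p permutes {..<r}}"
    have "\<omega> (\<lambda>i. \<delta> (?R p i)) = \<omega> (\<lambda>i. \<delta> (p i))" by (intro form_cong) simp
    then show "(\<Prod>i<r. A i (?R p i)) * \<omega> (\<lambda>i. \<delta> (?R p i)) = (\<Prod>i<r. A i (p i)) * (of_int (sign p) * \<omega> \<delta>)"
      using form_permute[of p \<delta>] p \<delta> by simp
  qed
  also have "\<dots> = det (mat r r (\<lambda>(i, k). A i k)) * \<omega> \<delta>"
  proof -
    have "p i < r" if "p permutes {0..<r}" "i < r" for p i
      using permutes_in_image[OF that(1), of i] that by simp
    then show ?thesis
      by (subst det_def'[of _ r]) (auto simp: sum_distrib_left lessThan_atLeast0 mult_ac intro!: sum.cong)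
  qed
  finally show ?thesis .
qed

end

lemma dwedge_det:
  assumes \<delta>: "\<And>i. i < r \<Longrightarrow> \<delta> i \<in> Der \<iota>" and D: "\<And>i. i < r \<Longrightarrow> D i = (\<lambda>z. \<Sum>k<r. A i k * \<delta> k z)"
  shows "dwedge \<iota> r b D = det (mat r r (\<lambda>(i, k). A i k)) * det (mat r r (\<lambda>(i, j). \<delta> i (b j)))"
proof -
  have "D i \<in> Der \<iota>" if "i < r" for i
    unfolding D[OF that] using \<delta> by (intro Der_sum) auto
  moreover have "mat r r (\<lambda>(i, j). D i (b j)) = mat r r (\<lambda>(i, k). A i k) * mat r r (\<lambda>(i, j). \<delta> i (b j))"
    using D by (intro eq_matI) (auto simp: scalar_prod_def lessThan_atLeast0)
  ultimately show ?thesis by (simp add: dwedge_def det_mult[of _ r])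
qed


section \<open>Differentials at a smooth rational point\<close>

lemma (in local_point) Der_ev:
  assumes "\<delta> \<in> Der \<iota>" "in_vars m G"
  shows "\<delta> (eval_at \<iota> s G) = ddir \<iota> s (\<lambda>j. \<delta> (s j)) G"
  using assms(2) by (induction G rule: mpol_induct)
    (simp_all add: DerD[OF assms(1)] eval_add eval_mult ddir_add ddir_mult)

lemma Der_mult_quotient:
  assumes "\<delta> \<in> Der \<iota>" "b * z = a"
  shows "b * \<delta> z = \<delta> a - z * \<delta> b"
  using DerD(2)[OF assms(1), of b z] assms(2) by simp

locale function_field_point = smooth_point \<iota> P r m s F x
  for \<iota> :: "'k::field \<Rightarrow> 'K::field" and P r m s F x +
  assumes quotients: "\<And>z. \<exists>a\<in>P. \<exists>b\<in>P. b \<noteq> 0 \<and> z = a / b"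
begin

section \<open>Derivations of the function field\<close>

lemma field_fractions:
  obtains G H where "in_vars m G" "in_vars m H" "eval_at \<iota> s H \<noteq> 0" "eval_at \<iota> s H * z = eval_at \<iota> s G"
proof -
  obtain a b where ab: "a \<in> P" "b \<in> P" "b \<noteq> 0" "z = a / b" using quotients by blast
  obtain G H where GH: "in_vars m G" "in_vars m H" "eval_at \<iota> s H \<noteq> 0" "eval_at \<iota> s H * a = eval_at \<iota> s G"
    using fractions_peval[OF ab(1)] by metis
  obtain G' H' where GH': "in_vars m G'" "in_vars m H'" "eval_at \<iota> s H' \<noteq> 0" "eval_at \<iota> s H' * b = eval_at \<iota> s G'"
    using fractions_peval[OF ab(2)] by metis
  show thesis
  proof (rule that[of "H' * G" "H * G'"])
    show "eval_at \<iota> s (H * G') \<noteq> 0" using GH GH' ab(3) by (simp add: eval_mult flip: GH'(4))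
    show "eval_at \<iota> s (H * G') * z = eval_at \<iota> s (H' * G)"
      using ab(3,4) by (simp add: eval_mult flip: GH(4) GH'(4))
  qed (use GH GH' in auto)
qed

text \<open>A direction tangent to the equations is tangent to every relation: since
  \<open>G\<close> vanishes at \<open>s\<close>, differentiating H G leaves H(s) times the
  derivative of \<open>G\<close>, and H(s) is nonzero.\<close>

lemma ddir_relation:
  assumes v: "\<And>l. l < m - r \<Longrightarrow> ddir \<iota> s v (F l) = 0" and G: "in_vars m G" "eval_at \<iota> s G = 0"
  shows "ddir \<iota> s v G = 0"
proof -
  obtain H Q where HQ: "eval_at \<iota> s H \<notin> maxid P" "H * G = (\<Sum>l<m - r. Q l * F l)"
    using relations[OF G] by blast
  have "eval_at \<iota> s H * ddir \<iota> s v G = ddir \<iota> s v (H * G)" by (simp add: ddir_mult G(2))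
  also have "\<dots> = 0" unfolding HQ(2) by (simp add: ddir_sum ddir_mult F_zero v)
  finally show ?thesis using HQ(1) is_idealD(2)[OF maxid_ideal] by auto
qed

text \<open>The quotient rule extends a tangent vector at the generic point to the function field;
  tangency makes the result independent of the fraction chosen.\<close>

lemma derivation_exists:
  assumes v: "\<And>l. l < m - r \<Longrightarrow> ddir \<iota> s v (F l) = 0"
  shows "\<exists>\<delta>\<in>Der \<iota>. \<forall>G. in_vars m G \<longrightarrow> \<delta> (eval_at \<iota> s G) = ddir \<iota> s v G"
proof -
  let ?e = "eval_at \<iota> s" and ?d = "ddir \<iota> s v"
  define \<delta> where "\<delta> z = (SOME d. \<exists>G H. in_vars m G \<and> in_vars m H \<and> ?e H \<noteq> 0 \<and> ?e H * z = ?e G \<and>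
    d = (?d G - z * ?d H) / ?e H)" for z
  have \<delta>: "\<delta> z = (?d G - z * ?d H) / ?e H"
    if GH: "in_vars m G" "in_vars m H" "?e H \<noteq> 0" "?e H * z = ?e G" for z G H
  proof -
    have "\<exists>G H. in_vars m G \<and> in_vars m H \<and> ?e H \<noteq> 0 \<and> ?e H * z = ?e G \<and> \<delta> z = (?d G - z * ?d H) / ?e H"
      unfolding \<delta>_def by (rule someI_ex) (use GH in blast)
    then obtain G' H' where GH': "in_vars m G'" "in_vars m H'" "?e H' \<noteq> 0" "?e H' * z = ?e G'"
      "\<delta> z = (?d G' - z * ?d H') / ?e H'" by blast
    \<comment> \<open>Two fractions for the same element give a relation between the coordinates, to
      which \<open>ddir_relation\<close> applies.\<close>
    have "?e (G * H' - G' * H) = (?e H * z) * ?e H' - (?e H' * z) * ?e H"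
      by (simp only: eval_minus eval_mult GH(4) GH'(4))
    then have zero: "?e (G * H' - G' * H) = 0" by (simp only: mult_ac diff_self)
    have "in_vars m (G * H' - G' * H)"
      using GH(1,2) GH'(1,2) by auto
    from ddir_relation[OF v this zero] have "?d (G * H' - G' * H) = 0" .
    moreover have "?d (G * H' - G' * H) = (?d G - z * ?d H) * ?e H' - (?d G' - z * ?d H') * ?e H"
      by (simp add: ddir_minus ddir_mult algebra_simps flip: GH(4) GH'(4))
    ultimately have "(?d G - z * ?d H) * ?e H' = (?d G' - z * ?d H') * ?e H" by simp
    then show ?thesis unfolding GH'(5) using GH(3) GH'(3) by (simp add: frac_eq_eq)
  qed
  have ev: "\<delta> (?e G) = ?d G" if "in_vars m G" for G
    using \<delta>[of G 1 "?e G"] ddir_con[of s v 1] that by simp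
  have "\<delta> \<in> Der \<iota>"
    unfolding Der_def
  proof (intro CollectI conjI allI)
    fix c show "\<delta> (\<iota> c) = 0" using ev[of "mcon c"] by simp
  next
    fix a b
    obtain G H where GH: "in_vars m G" "in_vars m H" "?e H \<noteq> 0" "?e H * a = ?e G"
      by (rule field_fractions)
    obtain G' H' where GH': "in_vars m G'" "in_vars m H'" "?e H' \<noteq> 0" "?e H' * b = ?e G'"
      by (rule field_fractions)
    have H: "in_vars m (H * H')" "?e (H * H') \<noteq> 0" using GH(2,3) GH'(2,3) by (auto simp: eval_mult)
    have "\<delta> (a + b) = (?d (G * H' + G' * H) - (a + b) * ?d (H * H')) / ?e (H * H')"
    proof (rule \<delta>[OF _ H])
      show "in_vars m (G * H' + G' * H)" using GH(1,2) GH'(1,2) by auto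
      show "?e (H * H') * (a + b) = ?e (G * H' + G' * H)"
        by (simp add: eval_mult eval_add algebra_simps flip: GH(4) GH'(4))
    qed
    also have "\<dots> = \<delta> a + \<delta> b"
    proof -
      have "?d (G * H' + G' * H) - (a + b) * ?d (H * H')
          = (?d G - a * ?d H) * ?e H' + (?d G' - b * ?d H') * ?e H"
        by (simp add: ddir_add ddir_mult algebra_simps flip: GH(4) GH'(4))
      then show ?thesis
        unfolding \<delta>[OF GH] \<delta>[OF GH'] add_frac_eq[OF GH(3) GH'(3)] by (simp only: eval_mult)
    qed
    finally show "\<delta> (a + b) = \<delta> a + \<delta> b" .
    have "\<delta> (a * b) = (?d (G * G') - (a * b) * ?d (H * H')) / ?e (H * H')"
    proof (rule \<delta>[OF _ H])
      show "in_vars m (G * G')" using GH(1) GH'(1) by auto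
      show "?e (H * H') * (a * b) = ?e (G * G')"
        by (simp add: eval_mult mult_ac flip: GH(4) GH'(4))
    qed
    also have "\<dots> = a * \<delta> b + b * \<delta> a"
    proof -
      have "?d (G * G') - (a * b) * ?d (H * H')
          = (a * (?d G' - b * ?d H')) * ?e H + (b * (?d G - a * ?d H)) * ?e H'"
        by (simp add: ddir_mult algebra_simps flip: GH(4) GH'(4))
      then show ?thesis
        unfolding \<delta>[OF GH] \<delta>[OF GH'] times_divide_eq_right add_frac_eq[OF GH'(3) GH(3)]
        by (simp only: eval_mult mult.commute[of "?e H"])
    qed
    finally show "\<delta> (a * b) = a * \<delta> b + b * \<delta> a" .
  qed
  then show ?thesis using ev by blast
qed

lemma derivation_preserves:
  assumes "\<delta> \<in> Der \<iota>" "\<And>j. j < m \<Longrightarrow> \<delta> (s j) \<in> P" "g \<in> P"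
  shows "\<delta> g \<in> P"
proof -
  have ev: "\<delta> (eval_at \<iota> s G) \<in> P" if "in_vars m G" for G
    using that by (induction G rule: mpol_induct)
      (auto simp: DerD[OF assms(1)] eval_add eval_mult intro!: P_intros assms(2) ev_in)
  obtain G H where GH: "in_vars m G" "in_vars m H" "peval center H \<noteq> 0" "eval_at \<iota> s H \<noteq> 0"
    "eval_at \<iota> s H * g = eval_at \<iota> s G" by (rule fractions_peval[OF assms(3)])
  have "1 / eval_at \<iota> s H \<in> P" using unit_if ev_in[OF GH(2)] ev_maxid_iff[OF GH(2)] GH(3) by blast
  then have "(1 / eval_at \<iota> s H) * (\<delta> (eval_at \<iota> s G) - g * \<delta> (eval_at \<iota> s H)) \<in> P"
    using ev GH assms(3) by (intro P_intros) auto
  moreover have "\<delta> g = (1 / eval_at \<iota> s H) * (\<delta> (eval_at \<iota> s G) - g * \<delta> (eval_at \<iota> s H))"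
    using Der_mult_quotient[OF assms(1) GH(5)] GH(4) by (simp add: field_simps)
  ultimately show ?thesis by (simp only:)
qed

text \<open>The coordinates generate the function field, so the quotient rule propagates an identity
  of derivations from them to all elements.\<close>

lemma derivation_expand:
  assumes D: "D \<in> Der \<iota>" and \<delta>: "\<And>i. i < n \<Longrightarrow> \<delta> i \<in> Der \<iota>"
    and eq: "\<And>j. j < m \<Longrightarrow> D (s j) = (\<Sum>i<n. a i * \<delta> i (s j))"
  shows "D z = (\<Sum>i<n. a i * \<delta> i z)"
proof -
  let ?E = "\<lambda>z. \<Sum>i<n. a i * \<delta> i z"
  have E: "?E \<in> Der \<iota>" using \<delta> by (intro Der_sum) auto
  have ev: "D (eval_at \<iota> s G) = ?E (eval_at \<iota> s G)" if "in_vars m G" for G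
    unfolding Der_ev[OF D that] Der_ev[OF E that] using that eq by (rule ddir_cong)
  obtain G H where GH: "in_vars m G" "in_vars m H" "eval_at \<iota> s H \<noteq> 0" "eval_at \<iota> s H * z = eval_at \<iota> s G"
    by (rule field_fractions)
  have "eval_at \<iota> s H * D z = eval_at \<iota> s H * ?E z"
    unfolding Der_mult_quotient[OF D GH(4)] Der_mult_quotient[OF E GH(4)] by (simp only: ev GH(1,2))
  then show ?thesis using GH(3) by simp
qed

lemma ddir_in:
  assumes "in_vars m G"
  shows "ddir \<iota> s (unitv j) G \<in> P" "ddir \<iota> s (unitv j) G - \<iota> (pdir center (unitv j) G) \<in> maxid P"
proof -
  have "ddir \<iota> s (unitv j) G \<in> P \<and> ddir \<iota> s (unitv j) G - \<iota> (pdir center (unitv j) G) \<in> maxid P"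
    using assms
  proof (induction G rule: mpol_induct)
    case (add F G)
    have "ddir \<iota> s (unitv j) (F + G) - \<iota> (pdir center (unitv j) (F + G))
      = (ddir \<iota> s (unitv j) F - \<iota> (pdir center (unitv j) F)) + (ddir \<iota> s (unitv j) G - \<iota> (pdir center (unitv j) G))"
      by (simp add: ddir_add pdir_add hom_add)
    also have "\<dots> \<in> maxid P" using add by (intro is_idealD(3)[OF maxid_ideal]) auto
    finally show ?case using add by (auto simp: ddir_add intro: P_intros)
  next
    case (mult F G)
    have "ddir \<iota> s (unitv j) (F * G) - \<iota> (pdir center (unitv j) (F * G))
      = (eval_at \<iota> s F * (ddir \<iota> s (unitv j) G - \<iota> (pdir center (unitv j) G))
        + (eval_at \<iota> s F - \<iota> (peval center F)) * \<iota> (pdir center (unitv j) G))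
      + (eval_at \<iota> s G * (ddir \<iota> s (unitv j) F - \<iota> (pdir center (unitv j) F))
        + (eval_at \<iota> s G - \<iota> (peval center G)) * \<iota> (pdir center (unitv j) F))"
      by (simp add: ddir_mult pdir_mult hom_add hom_mult algebra_simps)
    also have "\<dots> \<in> maxid P"
      using mult ev_in ev_peval scalar_in
      by (intro is_idealD(3)[OF maxid_ideal])
        (auto intro: is_idealD(4)[OF maxid_ideal] is_idealD(5)[OF maxid_ideal])
    finally show ?case using mult ev_in by (auto simp: ddir_mult intro!: P_intros)
  qed (use is_idealD(2)[OF maxid_ideal] P_intros(1,2) in auto)
  then show "ddir \<iota> s (unitv j) G \<in> P" "ddir \<iota> s (unitv j) G - \<iota> (pdir center (unitv j) G) \<in> maxid P" by auto
qed

lemma det_notin_maxid: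
  assumes "M \<in> carrier_mat n n" "\<And>i j. i < n \<Longrightarrow> j < n \<Longrightarrow> M $$ (i, j) \<in> P"
    and N: "N \<in> carrier_mat n n" "det N \<noteq> 0"
    and "\<And>i j. i < n \<Longrightarrow> j < n \<Longrightarrow> M $$ (i, j) - \<iota> (N $$ (i, j)) \<in> maxid P"
  shows "det M \<in> P" "det M \<notin> maxid P"
proof -
  show in_P: "det M \<in> P" by (rule det_in_subring[OF subring assms(1,2)])
  have "det M - det (map_mat \<iota> N) \<in> maxid P"
    using assms scalar_in by (intro det_diff_ideal[OF subring maxid_ideal]) auto
  then have "det M - \<iota> (det N) \<in> maxid P" by simp
  then show "det M \<notin> maxid P"
    using is_ideal_diff[OF subring maxid_ideal, of "det M" "det M - \<iota> (det N)"] scalar_zero_if[of "det N"] N(2)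
    by auto
qed

text \<open>Modulo m the Jacobian matrix at \<open>s\<close> reduces to the invertible one at
  \<open>center\<close>. Its determinant is therefore a unit of P, and the adjugate gives an inverse
  with entries in P.\<close>

lemma jacobian_inverse_in:
  obtains B where "\<And>i j. i < m \<Longrightarrow> j < m \<Longrightarrow> B i j \<in> P"
    "\<And>i k. i < m \<Longrightarrow> k < m \<Longrightarrow> (\<Sum>j<m. ddir \<iota> s (unitv j) (ambient_param i) * B j k) = (if i = k then 1 else 0)"
    "\<And>i k. i < m \<Longrightarrow> k < m \<Longrightarrow> (\<Sum>j<m. B i j * ddir \<iota> s (unitv k) (ambient_param j)) = (if i = k then 1 else 0)"
proof -
  obtain A where A: "\<And>i k. i < m \<Longrightarrow> k < m \<Longrightarrow>
    (\<Sum>j<m. pdir center (unitv j) (ambient_param i) * A j k) = (if i = k then 1 else 0)"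
    by (rule jacobian_right_inverse) (rule that)
  let ?A = "mat m m (\<lambda>(j, k). A j k)" and ?Jc = "mat m m (\<lambda>(i, j). pdir center (unitv j) (ambient_param i))"
  let ?J = "mat m m (\<lambda>(i, j). ddir \<iota> s (unitv j) (ambient_param i))"
  have "?Jc * ?A = 1\<^sub>m m"
    by (rule eq_matI) (simp_all add: scalar_prod_def A flip: lessThan_atLeast0)
  then have "det ?Jc * det ?A = 1" using det_mult[of ?Jc m ?A] by simp
  then have Jc: "det ?Jc \<noteq> 0" by auto
  have J: "?J \<in> carrier_mat m m" by simp
  have J_in: "i < m \<Longrightarrow> j < m \<Longrightarrow> ?J $$ (i, j) \<in> P" for i j
    by (simp add: ddir_in ambient_param)
  have "det ?J \<in> P" "det ?J \<notin> maxid P"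
    using J_in ddir_in(2)[OF ambient_param(1)] Jc by (intro det_notin_maxid[OF J _ _ Jc]; simp)+
  then have unit: "det ?J \<noteq> 0" "1 / det ?J \<in> P" using unit_if by auto
  let ?B = "\<lambda>i j. 1 / det ?J * adj_mat ?J $$ (i, j)"
  have B1: "(\<Sum>j<m. ?B i j * ddir \<iota> s (unitv k) (ambient_param j)) = (if i = k then 1 else 0)"
    if "i < m" "k < m" for i k
  proof -
    have "(\<Sum>j<m. ?B i j * ddir \<iota> s (unitv k) (ambient_param j))
        = 1 / det ?J * (\<Sum>j<m. adj_mat ?J $$ (i, j) * ?J $$ (j, k))"
      unfolding sum_distrib_left using that by (intro sum.cong) (auto simp: mult.assoc)
    then show ?thesis using adj_mat_mult_index[OF J that] unit by simp
  qed
  let ?BM = "mat m m (\<lambda>(i, j). ?B i j)"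
  have "?BM * ?J = 1\<^sub>m m"
    by (rule eq_matI) (use B1 in \<open>simp_all add: scalar_prod_def flip: lessThan_atLeast0\<close>)
  then have JB: "?J * ?BM = 1\<^sub>m m" by (intro mat_mult_left_right_inverse[of ?BM m ?J] mat_carrier)
  have B2: "(\<Sum>j<m. ddir \<iota> s (unitv j) (ambient_param i) * ?B j k) = (if i = k then 1 else 0)"
    if "i < m" "k < m" for i k
  proof -
    have "(\<Sum>j<m. ddir \<iota> s (unitv j) (ambient_param i) * ?B j k) = (?J * ?BM) $$ (i, k)"
      using that by (simp add: scalar_prod_def flip: lessThan_atLeast0)
    also have "\<dots> = (1\<^sub>m m :: 'K mat) $$ (i, k)" by (simp only: JB)
    also have "\<dots> = (if i = k then 1 else 0)" using that by simp
    finally show ?thesis .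
  qed
  show thesis
  proof (rule that[of ?B])
    show "?B i j \<in> P" if "i < m" "j < m" for i j
      using adj_mat_in_subring[OF subring J J_in that] unit(2) by (intro P_intros(4))
  qed (fact B2 B1)+
qed

end


context function_field_point
begin

text \<open>The last r columns of the inverse Jacobian matrix are tangent to the equations and dual
  to the lifted parameters. The expansion of a derivation therefore has its values on the lifts as
  coefficients, while the pairing with \<open>x\<close> itself is the identity only modulo
  m.\<close>

lemma derivation_basis:
  obtains \<delta> where "\<And>i. i < r \<Longrightarrow> \<delta> i \<in> Der \<iota>" "\<And>i g. i < r \<Longrightarrow> g \<in> P \<Longrightarrow> \<delta> i g \<in> P"
    "\<And>D z. D \<in> Der \<iota> \<Longrightarrow> D z = (\<Sum>i<r. D (eval_at \<iota> s (approx_param i)) * \<delta> i z)"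
    "det (mat r r (\<lambda>(i, j). \<delta> i (x j))) \<notin> maxid P"
proof -
  let ?J = "\<lambda>i j. ddir \<iota> s (unitv j) (ambient_param i)"
  obtain B where B: "\<And>i j. i < m \<Longrightarrow> j < m \<Longrightarrow> B i j \<in> P"
    "\<And>i k. i < m \<Longrightarrow> k < m \<Longrightarrow> (\<Sum>j<m. ?J i j * B j k) = (if i = k then 1 else 0)"
    "\<And>i k. i < m \<Longrightarrow> k < m \<Longrightarrow> (\<Sum>j<m. B i j * ?J j k) = (if i = k then 1 else 0)"
    by (rule jacobian_inverse_in) (rule that)
  \<comment> \<open>Column m - r + i of the inverse: it annihilates all other ambient parameters, in
    particular the equations.\<close>
  define v where "v i j = B j (m - r + i)" for i j
  have less: "m - r + i < m" if "i < r" for i using that r_le_m by simp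
  have dv: "ddir \<iota> s (v i) (ambient_param k) = (if k = m - r + i then 1 else 0)" if "i < r" "k < m" for i k
    using B(2)[OF that(2) less[OF that(1)]]
    by (simp add: ddir_expand[OF ambient_param(1)[OF that(2)], of s "v i"] v_def mult.commute)
  have "ddir \<iota> s (v i) (F l) = 0" if "i < r" "l < m - r" for i l
    using dv[OF that(1), of l] that(2) by simp
  then have "\<forall>i. \<exists>\<delta>. i < r \<longrightarrow> \<delta> \<in> Der \<iota> \<and> (\<forall>G. in_vars m G \<longrightarrow> \<delta> (eval_at \<iota> s G) = ddir \<iota> s (v i) G)"
    using derivation_exists by blast
  from choice[OF this] obtain \<delta> where \<delta>: "\<And>i. i < r \<Longrightarrow> \<delta> i \<in> Der \<iota>"
    "\<And>i G. i < r \<Longrightarrow> in_vars m G \<Longrightarrow> \<delta> i (eval_at \<iota> s G) = ddir \<iota> s (v i) G" by blast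
  have \<delta>s: "\<delta> i (s j) = B j (m - r + i)" if "i < r" "j < m" for i j
    using \<delta>(2)[OF that(1), of "mvar j"] that(2) by (simp add: v_def)
  have \<delta>P: "\<delta> i g \<in> P" if "i < r" "g \<in> P" for i g
    by (rule derivation_preserves[OF \<delta>(1)[OF that(1)] _ that(2)])
      (simp add: \<delta>s[OF that(1)] B(1)[OF _ less[OF that(1)]])
  show thesis
  proof (rule that[OF \<delta>(1) \<delta>P])
    fix D z assume D: "D \<in> Der \<iota>"
    let ?a = "\<lambda>k. D (eval_at \<iota> s (ambient_param k))"
    have a: "?a l = (\<Sum>k<m. ?J l k * D (s k))" if "l < m" for l
      unfolding Der_ev[OF D ambient_param(1)[OF that]]
      by (subst ddir_expand[OF ambient_param(1)[OF that]]) (simp add: mult.commute)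
    have "D 0 = 0" using DerD(3)[OF D, of 0] by simp
    \<comment> \<open>A derivation kills the equations because their values at \<open>s\<close> are
      zero; only the r parameter terms survive.\<close>
    then have a0: "D (eval_at \<iota> s (F l)) = 0" if "l < m - r" for l using F_zero[OF that] by simp
    show "D z = (\<Sum>i<r. D (eval_at \<iota> s (approx_param i)) * \<delta> i z)"
    proof (rule derivation_expand[OF D \<delta>(1)])
      fix j assume j: "j < m"
      have "D (s j) = (\<Sum>k<m. (if j = k then 1 else 0) * D (s k))"
        using j by (simp add: if_distrib[of "\<lambda>c. c * _"] cong: if_cong)
      also have "\<dots> = (\<Sum>k<m. (\<Sum>l<m. B j l * ?J l k) * D (s k))"
        using B(3)[OF j] by (intro sum.cong refl) simp
      also have "\<dots> = (\<Sum>l<m. \<Sum>k<m. B j l * (?J l k * D (s k)))"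
        unfolding sum_distrib_right by (subst sum.swap) (simp only: mult.assoc)
      also have "\<dots> = (\<Sum>l<m. B j l * ?a l)"
        by (intro sum.cong refl) (simp add: a sum_distrib_left)
      also have "\<dots> = (\<Sum>i<r. B j (m - r + i) * ?a (m - r + i))"
        unfolding sum_lessThan_split[OF r_le_m] by (simp add: a0)
      finally show "D (s j) = (\<Sum>i<r. D (eval_at \<iota> s (approx_param i)) * \<delta> i (s j))"
        using j by (simp add: \<delta>s mult.commute)
    qed
  next
    \<comment> \<open>By the product rule a derivation that preserves P maps m^2 into m, so passing
      from the lift to \<open>x\<close> changes the pairing only by elements of m.\<close>
    have maxid: "\<delta> i w \<in> maxid P" if i: "i < r" and w: "w \<in> mp 2" for i w
    proof -
      obtain b where b: "\<And>j. j < r \<Longrightarrow> b j \<in> maxid P" "w = (\<Sum>j<r. b j * x j)"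
        using w by (auto simp: numeral_2_eq_2 mp_Suc[of "Suc 0"] mp_1 elim!: span_ofE)
      have "\<delta> i 0 = 0" using DerD(3)[OF \<delta>(1)[OF i], of 0] by simp
      then have "\<delta> i w = (\<Sum>j<r. \<delta> i (b j * x j))"
        unfolding b(2) using DerD(1)[OF \<delta>(1)[OF i]]
        by (induction r) simp_all
      also have "\<dots> \<in> maxid P"
      proof (rule is_ideal_sum[OF maxid_ideal])
        fix j assume "j \<in> {..<r}"
        then have j: "j < r" by simp
        show "\<delta> i (b j * x j) \<in> maxid P"
          unfolding DerD(2)[OF \<delta>(1)[OF i]]
          using \<delta>P[OF i] b(1)[OF j] x_maxid[OF j] maxid_in
          by (intro is_idealD(3)[OF maxid_ideal] is_idealD(5)[OF maxid_ideal]) auto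
      qed
      finally show ?thesis .
    qed
    show "det (mat r r (\<lambda>(i, j). \<delta> i (x j))) \<notin> maxid P"
    proof (rule det_notin_maxid(2)[where N = "1\<^sub>m r"])
      fix i j assume ij: "i < r" "j < r"
      let ?w = "eval_at \<iota> s (approx_param j) - x j"
      have "\<delta> i (x j + ?w) = \<delta> i (x j) + \<delta> i ?w" by (rule DerD(1)[OF \<delta>(1)[OF ij(1)]])
      then have "\<delta> i (x j) + \<delta> i ?w = \<delta> i (eval_at \<iota> s (approx_param j))" by simp
      also have "\<dots> = (if i = j then 1 else 0)"
        unfolding \<delta>(2)[OF ij(1) approx_param(1)[OF ij(2)]] using dv[OF ij(1) less[OF ij(2)]] by auto
      finally have "\<delta> i (x j) - (if i = j then 1 else 0) = - \<delta> i ?w" by (simp add: algebra_simps)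
      also have "\<dots> \<in> maxid P"
        using maxid[OF ij(1) approx_param(2)[OF ij(2)]] by (rule is_ideal_uminus[OF subring maxid_ideal])
      finally show "mat r r (\<lambda>(i, j). \<delta> i (x j)) $$ (i, j) - \<iota> (1\<^sub>m r $$ (i, j)) \<in> maxid P"
        using ij by (cases "i = j") simp_all
    qed (use \<delta>P x_in in auto)
  qed
qed

section \<open>Top forms and regular forms at the point\<close>

lemma dwedge_not_Der: "i < r \<Longrightarrow> D i \<notin> Der \<iota> \<Longrightarrow> dwedge \<iota> r b D = 0"
  by (auto simp: dwedge_def)

text \<open>A change of derivations multiplies every top form by the same determinant, so a form is
  fixed by its value on one basis, where \<open>dwedge \<iota> r x\<close> is nonzero.\<close>

lemma form_multiple:
  assumes "\<omega> \<in> forms \<iota> r"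
  shows "\<exists>w. \<omega> = fscale w (dwedge \<iota> r x)"
proof -
  obtain \<delta> where \<delta>: "\<And>i. i < r \<Longrightarrow> \<delta> i \<in> Der \<iota>" "\<And>i g. i < r \<Longrightarrow> g \<in> P \<Longrightarrow> \<delta> i g \<in> P"
    "\<And>D z. D \<in> Der \<iota> \<Longrightarrow> D z = (\<Sum>i<r. D (eval_at \<iota> s (approx_param i)) * \<delta> i z)"
    "det (mat r r (\<lambda>(i, j). \<delta> i (x j))) \<notin> maxid P" by (rule derivation_basis) (rule that)
  let ?d = "det (mat r r (\<lambda>(i, j). \<delta> i (x j)))"
  have d: "?d \<noteq> 0" using \<delta>(4) is_idealD(2)[OF maxid_ideal] by auto
  have "\<omega> D = \<omega> \<delta> / ?d * dwedge \<iota> r x D" for D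
  proof (cases "\<forall>i<r. D i \<in> Der \<iota>")
    case True
    let ?A = "\<lambda>i k. D i (eval_at \<iota> s (approx_param k))"
    have D: "D i = (\<lambda>z. \<Sum>k<r. ?A i k * \<delta> k z)" if "i < r" for i
      using \<delta>(3)[of "D i"] True that by blast
    show ?thesis
      using d by (simp add: form_det[where A = ?A, OF assms \<delta>(1) D] dwedge_det[where A = ?A, OF \<delta>(1) D])
  next
    case False
    then show ?thesis using form_not_Der[OF assms] dwedge_not_Der by auto
  qed
  then have "\<omega> = fscale (\<omega> \<delta> / ?d) (dwedge \<iota> r x)" unfolding fscale_def by (rule ext)
  then show ?thesis by blast
qed

text \<open>The determinant of the basis on \<open>x\<close> is a unit of P, so the quotient of the
  two determinants stays in P.\<close>

lemma dwedge_multiple: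
  assumes "\<And>j. j < r \<Longrightarrow> b j \<in> P"
  shows "\<exists>a\<in>P. dwedge \<iota> r b = fscale a (dwedge \<iota> r x)"
proof -
  obtain \<delta> where \<delta>: "\<And>i. i < r \<Longrightarrow> \<delta> i \<in> Der \<iota>" "\<And>i g. i < r \<Longrightarrow> g \<in> P \<Longrightarrow> \<delta> i g \<in> P"
    "\<And>D z. D \<in> Der \<iota> \<Longrightarrow> D z = (\<Sum>i<r. D (eval_at \<iota> s (approx_param i)) * \<delta> i z)"
    "det (mat r r (\<lambda>(i, j). \<delta> i (x j))) \<notin> maxid P" by (rule derivation_basis) (rule that)
  let ?d = "det (mat r r (\<lambda>(i, j). \<delta> i (x j)))" and ?e = "det (mat r r (\<lambda>(i, j). \<delta> i (b j)))"
  have "?d \<in> P" "?e \<in> P"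
    using \<delta>(2) x_in assms by (auto intro!: det_in_subring[OF subring mat_carrier])
  then have d: "?d \<noteq> 0" "?e * (1 / ?d) \<in> P" using unit_if[OF _ \<delta>(4)] P_intros(4) by blast+
  have "dwedge \<iota> r b D = ?e * (1 / ?d) * dwedge \<iota> r x D" for D
  proof (cases "\<forall>i<r. D i \<in> Der \<iota>")
    case True
    let ?A = "\<lambda>i k. D i (eval_at \<iota> s (approx_param k))"
    have D: "D i = (\<lambda>z. \<Sum>k<r. ?A i k * \<delta> k z)" if "i < r" for i
      using \<delta>(3)[of "D i"] True that by blast
    show ?thesis
      using d by (simp add: dwedge_det[where A = ?A, OF \<delta>(1) D])
  next
    case False
    then show ?thesis using dwedge_not_Der by auto
  qed
  then show ?thesis using d(2) by (auto simp: fscale_def intro!: bexI[of _ "?e * (1 / ?d)"])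
qed

lemma dwedge_cancel:
  assumes "fscale w (dwedge \<iota> r x) = fscale w' (dwedge \<iota> r x)"
  shows "w = w'"
proof -
  obtain \<delta> where \<delta>: "\<And>i. i < r \<Longrightarrow> \<delta> i \<in> Der \<iota>" "\<And>i g. i < r \<Longrightarrow> g \<in> P \<Longrightarrow> \<delta> i g \<in> P"
    "\<And>D z. D \<in> Der \<iota> \<Longrightarrow> D z = (\<Sum>i<r. D (eval_at \<iota> s (approx_param i)) * \<delta> i z)"
    "det (mat r r (\<lambda>(i, j). \<delta> i (x j))) \<notin> maxid P" by (rule derivation_basis) (rule that)
  have "dwedge \<iota> r x \<delta> \<noteq> 0"
    using \<delta>(1,4) is_idealD(2)[OF maxid_ideal] by (auto simp: dwedge_def)
  then show ?thesis using fun_cong[OF assms, of \<delta>] by (simp add: fscale_def)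
qed

lemma form_quot_eqI: "\<omega> = fscale w (dwedge \<iota> r x) \<Longrightarrow> form_quot \<iota> r \<omega> x = w"
  unfolding form_quot_def using dwedge_cancel by blast

lemma form_quot: "\<omega> \<in> forms \<iota> r \<Longrightarrow> \<omega> = fscale (form_quot \<iota> r \<omega> x) (dwedge \<iota> r x)"
  using form_multiple form_quot_eqI by metis

lemma form_quot_fscale: "\<omega> \<in> forms \<iota> r \<Longrightarrow> form_quot \<iota> r (fscale g \<omega>) x = g * form_quot \<iota> r \<omega> x"
  by (rule form_quot_eqI) (subst form_quot, assumption, simp add: fscale_def mult.assoc)

text \<open>Shows that \<open>form_quot\<close> by local parameters is a local equation of the
  divisor of the form in the sense of \<open>div_form\<close>.\<close>

lemma regular_forms_eq: "regular_forms \<iota> r P = {fscale a (dwedge \<iota> r x) |a. a \<in> P}"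
proof (intro equalityI subsetI)
  fix \<omega> assume "\<omega> \<in> regular_forms \<iota> r P"
  then obtain N :: nat and a b where \<omega>: "\<omega> = (\<lambda>\<delta>. \<Sum>l<N. a l * dwedge \<iota> r (b l) \<delta>)"
    "\<And>l. l < N \<Longrightarrow> a l \<in> P" "\<And>l i. l < N \<Longrightarrow> i < r \<Longrightarrow> b l i \<in> P"
    unfolding regular_forms_def by blast
  have "\<forall>l. \<exists>e. l < N \<longrightarrow> e \<in> P \<and> dwedge \<iota> r (b l) = fscale e (dwedge \<iota> r x)"
    using dwedge_multiple \<omega>(3) by blast
  from choice[OF this] obtain e where e: "\<And>l. l < N \<Longrightarrow> e l \<in> P"
    "\<And>l. l < N \<Longrightarrow> dwedge \<iota> r (b l) = fscale (e l) (dwedge \<iota> r x)" by blast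
  have "\<omega> = fscale (\<Sum>l<N. a l * e l) (dwedge \<iota> r x)"
    unfolding \<omega>(1) using e(2) by (auto simp: fscale_def sum_distrib_right mult.assoc)
  moreover have "(\<Sum>l<N. a l * e l) \<in> P" using \<omega>(2) e(1) by (auto intro!: P_intros)
  ultimately show "\<omega> \<in> {fscale a (dwedge \<iota> r x) |a. a \<in> P}" by blast
next
  fix \<omega> assume "\<omega> \<in> {fscale a (dwedge \<iota> r x) |a. a \<in> P}"
  then obtain a where "a \<in> P" "\<omega> = (\<lambda>\<delta>. \<Sum>l<Suc 0. a * dwedge \<iota> r x \<delta>)"
    by (auto simp: fscale_def)
  then show "\<omega> \<in> regular_forms \<iota> r P"
    unfolding regular_forms_def using x_in by (intro CollectI exI[of _ "Suc 0"] exI[of _ "\<lambda>_. a"] exI[of _ "\<lambda>_. x"]) simp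
qed

section \<open>Change of parameters\<close>

text \<open>Exposes the matrix whose determinant the choice operator hides.\<close>

lemma transition_matrix:
  assumes "admissible_exponent r P x f a" "\<And>j. j < r \<Longrightarrow> f j \<in> P"
  obtains M where "\<And>i j. i < r \<Longrightarrow> j < r \<Longrightarrow> M i j \<in> P" "\<And>i. i < r \<Longrightarrow> x i ^ a = (\<Sum>j<r. M i j * f j)"
    "transition_det r P x f a = det (mat r r (\<lambda>(i, j). M i j))"
proof -
  let ?Q = "\<lambda>M. M \<in> carrier_mat r r \<and> (\<forall>i<r. (\<forall>j<r. M $$ (i, j) \<in> P) \<and> x i ^ a = (\<Sum>j<r. M $$ (i, j) * f j))"
  have "\<forall>i. \<exists>b. i < r \<longrightarrow> (\<forall>j<r. b j \<in> P) \<and> x i ^ a = (\<Sum>j<r. b j * f j)"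
  proof (intro allI)
    fix i
    have "i < r \<longrightarrow> x i ^ a \<in> span_of P f r"
      using assms ideal_gen_image[OF subring, of r f] by (simp add: admissible_exponent_def)
    then show "\<exists>b. i < r \<longrightarrow> (\<forall>j<r. b j \<in> P) \<and> x i ^ a = (\<Sum>j<r. b j * f j)"
      unfolding span_of_def by blast
  qed
  from choice[OF this] obtain M where M: "\<And>i. i < r \<Longrightarrow> (\<forall>j<r. M i j \<in> P) \<and> x i ^ a = (\<Sum>j<r. M i j * f j)" by blast
  have "?Q (mat r r (\<lambda>(i, j). M i j))" using M by auto
  define M' where "M' = (SOME M. ?Q M)"
  from \<open>?Q (mat r r (\<lambda>(i, j). M i j))\<close> have *: "?Q M'" unfolding M'_def by (rule someI[of ?Q])
  show thesis
  proof (rule that[of "\<lambda>i j. M' $$ (i, j)"])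
    have "mat r r (\<lambda>(i, j). M' $$ (i, j)) = M'" using * by (intro eq_matI) auto
    then show "transition_det r P x f a = det (mat r r (\<lambda>(i, j). M' $$ (i, j)))"
      by (simp only: transition_det_def M'_def)
  qed (use * in auto)
qed

text \<open>For b large, both parameter systems express the b-th powers of the parameters \<open>x\<close> through
  \<open>f\<close>, and the two matrices have the same determinant modulo these powers.\<close>

lemma transition_transfer:
  assumes "param_point \<iota> P r x0"
    and f0: "\<And>j. j < r \<Longrightarrow> f0 j \<in> P" and u: "\<And>j. j < r \<Longrightarrow> u j \<in> runits P" "\<And>j. j < r \<Longrightarrow> f1 j = f0 j * u j"
    and M0: "\<And>i j. i < r \<Longrightarrow> j < r \<Longrightarrow> M0 i j \<in> P" "\<And>i. i < r \<Longrightarrow> x0 i ^ a0 = (\<Sum>j<r. M0 i j * f0 j)"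
    and M1: "\<And>i j. i < r \<Longrightarrow> j < r \<Longrightarrow> M1 i j \<in> P" "\<And>i. i < r \<Longrightarrow> x i ^ a1 = (\<Sum>j<r. M1 i j * f1 j)"
    and z: "z \<in> P" "det (mat r r (\<lambda>(i, j). M0 i j)) * z \<in> span_of P (\<lambda>i. x0 i ^ a0) r"
  shows "det (mat r r (\<lambda>(i, j). M1 i j)) * z \<in> power_ideal a1"
proof -
  interpret x0: param_point \<iota> P r x0 by fact
  \<comment> \<open>Makes \<open>x i ^ ?b\<close> lie in the ideal of the \<open>x0 j ^ a0\<close>;
    the summand \<open>a1\<close> in \<open>?b\<close> leaves room for the relation through
    \<open>M1\<close>.\<close>
  define e where "e = Suc (r * a0)"
  let ?b = "a1 + e"
  have u': "u j \<noteq> 0" "1 / u j \<in> P" "u j \<in> P" if "j < r" for j using u(1)[OF that] by (auto simp: runits_def)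
  have "x i ^ ?b \<in> span_of P (\<lambda>i. x0 i ^ a0) r" if "i < r" for i
  proof -
    have "x i ^ ?b \<in> mp ?b" using mp_monom[of "Poly_Mapping.single i ?b"] that by simp
    also have "\<dots> \<subseteq> mp (Suc (r * a0))" by (rule mp_mono) (simp add: e_def)
    finally show ?thesis using x0.mp_subset_power_ideal by blast
  qed
  then have "\<forall>i. \<exists>n. i < r \<longrightarrow> (\<forall>j<r. n j \<in> P) \<and> x i ^ ?b = (\<Sum>j<r. n j * x0 j ^ a0)"
    by (auto simp: span_of_def)
  from choice[OF this] obtain N where N: "\<And>i j. i < r \<Longrightarrow> j < r \<Longrightarrow> N i j \<in> P"
    "\<And>i. i < r \<Longrightarrow> x i ^ ?b = (\<Sum>j<r. N i j * x0 j ^ a0)" by blast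
  let ?N = "mat r r (\<lambda>(i, j). N i j)" and ?M0 = "mat r r (\<lambda>(i, j). M0 i j)" and ?M1 = "mat r r (\<lambda>(i, j). M1 i j)"
  \<comment> \<open>\<open>A\<close> goes through the other parameters, with the units u correcting
    the local equations; \<open>B\<close> multiplies the given relation by \<open>x i ^ e\<close>.
    Both express \<open>x i ^ ?b\<close> through \<open>f1\<close>.\<close>
  define A where "A i j = (\<Sum>k<r. N i k * (1 / u j * M0 k j))" for i j
  define B where "B i j = x i ^ e * M1 i j" for i j
  have f1: "f1 j \<in> P" if "j < r" for j using f0[OF that] u(2)[OF that] u'(3)[OF that] by (simp add: P_intros)
  have diff: "det (mat r r (\<lambda>(i, j). A i j)) - det (mat r r (\<lambda>(i, j). B i j)) \<in> power_ideal ?b"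
  proof (rule transition_det_unique[OF f1])
    show "A i j \<in> P" if "i < r" "j < r" for i j
      unfolding A_def using that N(1) M0(1) u'(2) by (intro P_intros) auto
    show "B i j \<in> P" if "i < r" "j < r" for i j
      unfolding B_def using that M1(1) x_in by (intro P_intros) auto
    show "x i ^ ?b = (\<Sum>j<r. B i j * f1 j)" if "i < r" for i
      by (simp add: B_def power_add M1(2)[OF that] sum_distrib_left mult_ac)
    show "x i ^ ?b = (\<Sum>j<r. A i j * f1 j)" if "i < r" for i
    proof -
      have "(\<Sum>j<r. A i j * f1 j) = (\<Sum>j<r. \<Sum>k<r. N i k * (M0 k j * f0 j))"
        by (intro sum.cong refl) (simp add: A_def u(2) u'(1) sum_distrib_left mult_ac)
      also have "\<dots> = (\<Sum>k<r. N i k * (\<Sum>j<r. M0 k j * f0 j))"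
        by (subst sum.swap) (simp add: sum_distrib_left)
      finally show ?thesis by (simp add: N(2)[OF that] M0(2))
    qed
  qed
  have "mat r r (\<lambda>(i, j). A i j) = ?N * mat r r (\<lambda>(i, j). 1 / u j * M0 i j)"
    by (rule eq_matI) (simp_all add: A_def scalar_prod_def lessThan_atLeast0)
  then have detA: "det (mat r r (\<lambda>(i, j). A i j)) = det ?N * ((\<Prod>j<r. 1 / u j) * det ?M0)"
    using det_scale_cols[of r "\<lambda>j. 1 / u j" M0] by (simp add: det_mult[of _ r])
  have detB: "det (mat r r (\<lambda>(i, j). B i j)) = (\<Prod>i<r. x i ^ e) * det ?M1"
    unfolding B_def by (rule det_scale_rows)
  have N_in: "?N $$ (i, j) \<in> P" if "i < r" "j < r" for i j using that N(1) by simp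
  \<comment> \<open>By Cramer's rule the determinant of N carries the ideal of the
    \<open>x0 j ^ a0\<close> into that of the \<open>x i ^ ?b\<close>.\<close>
  have Nx: "det ?N * x0 j ^ a0 \<in> power_ideal ?b" if "j < r" for j
  proof -
    have "det ?N * x0 j ^ a0 = (\<Sum>k<r. adj_mat ?N $$ (j, k) * (\<Sum>l<r. ?N $$ (k, l) * x0 l ^ a0))"
      by (rule cramer_sum) (use that in auto)
    also have "\<dots> = (\<Sum>k<r. adj_mat ?N $$ (j, k) * x k ^ ?b)"
      by (intro sum.cong refl) (simp add: N(2))
    also have "\<dots> \<in> power_ideal ?b"
      using adj_mat_in_subring[OF subring _ N_in that] by (intro span_ofI) auto
    finally show ?thesis .
  qed
  obtain q where q: "\<And>j. j < r \<Longrightarrow> q j \<in> P" "det ?M0 * z = (\<Sum>j<r. q j * x0 j ^ a0)"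
    using z(2) by (auto elim!: span_ofE)
  have "det (mat r r (\<lambda>(i, j). A i j)) * z = (\<Prod>j<r. 1 / u j) * (\<Sum>j<r. q j * (det ?N * x0 j ^ a0))"
  proof -
    have "det (mat r r (\<lambda>(i, j). A i j)) * z = (\<Prod>j<r. 1 / u j) * (det ?N * (det ?M0 * z))"
      unfolding detA by (simp only: mult_ac)
    also have "det ?N * (det ?M0 * z) = (\<Sum>j<r. q j * (det ?N * x0 j ^ a0))"
      unfolding q(2) by (simp add: sum_distrib_left mult_ac)
    finally show ?thesis .
  qed
  also have "\<dots> \<in> power_ideal ?b"
  proof (rule is_idealD(4)[OF power_ideal])
    show "(\<Prod>j<r. 1 / u j) \<in> P" using u'(2) by (intro P_intros) auto
    show "(\<Sum>j<r. q j * (det ?N * x0 j ^ a0)) \<in> power_ideal ?b"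
      using is_idealD(4)[OF power_ideal q(1) Nx] by (intro is_ideal_sum[OF power_ideal]) simp
  qed
  finally have Az: "det (mat r r (\<lambda>(i, j). A i j)) * z \<in> power_ideal ?b" .
  \<comment> \<open>The determinant of \<open>B\<close> is the product of the \<open>x i ^ e\<close>
    times that of \<open>M1\<close>, so agreement with the determinant of \<open>A\<close> gives the
    claim up to this factor.\<close>
  have "(\<Prod>i<r. x i ^ e) * (det ?M1 * z) = det (mat r r (\<lambda>(i, j). A i j)) * z
      - (det (mat r r (\<lambda>(i, j). A i j)) - det (mat r r (\<lambda>(i, j). B i j))) * z"
    unfolding detB by (simp add: algebra_simps)
  also have "\<dots> \<in> power_ideal ?b"
    using Az diff z(1) is_ideal_diff[OF subring power_ideal] is_idealD(5)[OF power_ideal] by blast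
  finally have "(\<Prod>i<r. x i ^ e) * (det ?M1 * z) \<in> power_ideal ?b" .
  moreover have "det ?M1 * z \<in> P"
    using M1(1) z(1) by (intro P_intros(4) det_in_subring[OF subring]) auto
  ultimately show ?thesis by (intro power_ideal_cancel)
qed

end


section \<open>Points of a projective model\<close>

lemma field_embedding_hom: "field_embedding \<iota> \<Longrightarrow> comm_ring_hom \<iota>"
proof -
  assume \<iota>: "field_embedding \<iota>"
  then have "\<iota> 0 + \<iota> 0 = \<iota> 0 + 0" by (metis add_0 add.right_neutral field_embedding_def)
  then have "\<iota> 0 = 0" by (simp only: add_left_cancel)
  then show ?thesis using \<iota> by unfold_locales (simp_all add: field_embedding_def)
qed

lemma prime_inD:
  assumes A: "is_subring A" and q: "prime_in A q"
  shows "is_ideal A q" "1 \<notin> q" "a \<in> A \<Longrightarrow> b \<in> A \<Longrightarrow> a * b \<in> q \<Longrightarrow> a \<in> q \<or> b \<in> q"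
proof -
  interpret q: primeideal q "subring_of A" using q by (simp add: prime_in_def)
  show ideal: "is_ideal A q" using q.is_ideal by (simp add: ideal_subring_of[OF A])
  show "1 \<notin> q"
  proof
    assume "1 \<in> q"
    then have "A \<subseteq> q" using is_idealD(4)[OF ideal, of _ 1] by auto
    then show False using q.I_notcarr is_idealD(1)[OF ideal] by (auto simp: subring_of_def)
  qed
  show "a \<in> A \<Longrightarrow> b \<in> A \<Longrightarrow> a * b \<in> q \<Longrightarrow> a \<in> q \<or> b \<in> q"
    using q.I_prime[of a b] by (simp add: subring_of_def)
qed

lemma localization_subring:
  assumes A: "is_subring A" and q: "prime_in A q"
  shows "is_subring (localization A q)" "A \<subseteq> localization A q"
proof -
  note q' = prime_inD[OF A q]
  have nz: "b \<noteq> 0" if "b \<in> A - q" for b using that is_idealD(2)[OF q'(1)] by auto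
  have mult: "b * b' \<in> A - q" if "b \<in> A - q" "b' \<in> A - q" for b b'
    using that q'(3)[of b b'] is_subringD(4)[OF A] by auto
  have I: "a / b \<in> localization A q" if "a \<in> A" "b \<in> A - q" for a b
    using that by (auto simp: localization_def)
  show sub: "A \<subseteq> localization A q"
    using I[of _ 1] q'(2) is_subringD(2)[OF A] by auto
  show "is_subring (localization A q)"
    unfolding is_subring_def
  proof (intro conjI ballI)
    show "0 \<in> localization A q" "1 \<in> localization A q" using sub is_subringD(1,2)[OF A] by auto
  next
    fix x y assume "x \<in> localization A q" "y \<in> localization A q"
    then obtain a b a' b' where xy: "x = a / b" "y = a' / b'" "a \<in> A" "b \<in> A - q" "a' \<in> A" "b' \<in> A - q"
      by (auto simp: localization_def)
    have "a * b' + a' * b \<in> A" "a * a' \<in> A" using xy by (auto intro!: is_subringD[OF A])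
    from I[OF this(1) mult[OF xy(4,6)]] I[OF this(2) mult[OF xy(4,6)]]
    show "x + y \<in> localization A q" "x * y \<in> localization A q"
      using nz[OF xy(4)] nz[OF xy(6)] by (simp_all add: xy(1,2) add_frac_eq)
  next
    fix x assume "x \<in> localization A q"
    then obtain a b where "x = a / b" "a \<in> A" "b \<in> A - q" by (auto simp: localization_def)
    then show "- x \<in> localization A q" using I[of "- a" b] is_subringD(5)[OF A] by simp
  qed
qed

lemma chart_ring_subring:
  assumes "comm_ring_hom \<iota>"
  shows "is_subring (chart_ring \<iota> n t i)"
    "\<iota> c \<in> chart_ring \<iota> n t i" "j \<le> n \<Longrightarrow> t j / t i \<in> chart_ring \<iota> n t i"
proof -
  interpret comm_ring_hom \<iota> by fact
  have I: "eval_at \<iota> (\<lambda>j. t j / t i) F \<in> chart_ring \<iota> n t i" if "in_vars (Suc n) F" for F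
    using that by (auto simp: chart_ring_def)
  show "is_subring (chart_ring \<iota> n t i)"
    unfolding is_subring_def
  proof (intro conjI ballI)
    show "0 \<in> chart_ring \<iota> n t i" "1 \<in> chart_ring \<iota> n t i" using I[of 0] I[of 1] by simp_all
  next
    fix a b assume "a \<in> chart_ring \<iota> n t i" "b \<in> chart_ring \<iota> n t i"
    then obtain F G where FG: "in_vars (Suc n) F" "in_vars (Suc n) G"
      "a = eval_at \<iota> (\<lambda>j. t j / t i) F" "b = eval_at \<iota> (\<lambda>j. t j / t i) G"
      by (auto simp: chart_ring_def)
    show "a + b \<in> chart_ring \<iota> n t i" "a * b \<in> chart_ring \<iota> n t i"
      using I[OF in_vars_add[OF FG(1,2)]] I[OF in_vars_mult[OF FG(1,2)]]
      by (simp_all add: FG(3,4) eval_add eval_mult)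
  next
    fix a assume "a \<in> chart_ring \<iota> n t i"
    then show "- a \<in> chart_ring \<iota> n t i"
      using I[OF in_vars_uminus] by (auto simp: chart_ring_def eval_uminus)
  qed
  show "\<iota> c \<in> chart_ring \<iota> n t i" using I[of "mcon c"] by simp
  show "j \<le> n \<Longrightarrow> t j / t i \<in> chart_ring \<iota> n t i" using I[of "mvar j"] by simp
qed

definition quotients_of :: "'a::field set \<Rightarrow> 'a set" where
  "quotients_of A = {a / b |a b. a \<in> A \<and> b \<in> A \<and> b \<noteq> 0}"

lemma quotients_of_closed:
  assumes A: "is_subring A" and x: "x \<in> quotients_of A" and y: "y \<in> quotients_of A"
  shows "x + y \<in> quotients_of A" "x * y \<in> quotients_of A" "y \<noteq> 0 \<Longrightarrow> x / y \<in> quotients_of A"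
proof -
  obtain a b a' b' where xy: "x = a / b" "y = a' / b'" "a \<in> A" "b \<in> A" "b \<noteq> 0" "a' \<in> A" "b' \<in> A" "b' \<noteq> 0"
    using x y by (auto simp: quotients_of_def)
  have I: "c / d \<in> quotients_of A" if "c \<in> A" "d \<in> A" "d \<noteq> 0" for c d
    using that by (auto simp: quotients_of_def)
  show "x + y \<in> quotients_of A"
    using I[of "a * b' + a' * b" "b * b'"] xy by (simp add: add_frac_eq is_subringD[OF A])
  show "x * y \<in> quotients_of A"
    using I[of "a * a'" "b * b'"] xy by (simp add: is_subringD[OF A])
  show "x / y \<in> quotients_of A" if "y \<noteq> 0"
    using I[of "a * b'" "b * a'"] xy that by (simp add: is_subringD[OF A])
qed

text \<open>The definition provides the function field on some chart only, while the point may lie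
  on another; the fraction fields have to be compared.\<close>

lemma proj_point:
  assumes V: "integral_projective \<iota> n t" and P: "P \<in> proj_points \<iota> n t"
  shows "is_subring P" "\<iota> c \<in> P" "\<exists>a\<in>P. \<exists>b\<in>P. b \<noteq> 0 \<and> z = a / b"
proof -
  have hom: "comm_ring_hom \<iota>" using V field_embedding_hom by (auto simp: integral_projective_def)
  interpret comm_ring_hom \<iota> by (rule hom)
  let ?A = "chart_ring \<iota> n t"
  obtain i q where i: "i \<le> n" "t i \<noteq> 0" and q: "prime_in (?A i) q" and Pq: "P = localization (?A i) q"
    using P by (auto simp: proj_points_def)
  note A = chart_ring_subring[OF hom, where n = n and t = t]
  show sub: "is_subring P" unfolding Pq by (rule localization_subring(1)[OF A(1) q])
  have AP: "?A i \<subseteq> P" unfolding Pq by (rule localization_subring(2)[OF A(1) q])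
  then show "\<iota> c \<in> P" using A(2) by auto
  obtain i0 where i0: "i0 \<le> n" "t i0 \<noteq> 0" "\<And>z. \<exists>a\<in>?A i0. \<exists>b\<in>?A i0. b \<noteq> 0 \<and> z = a / b"
    using V unfolding integral_projective_def by blast
  have AQ: "a \<in> quotients_of (?A i)" if "a \<in> ?A i" for a
    using that is_subringD(2)[OF A(1)] unfolding quotients_of_def
    by (intro CollectI exI[of _ a] exI[of _ 1]) auto
  have "eval_at \<iota> (\<lambda>j. t j / t i0) F \<in> quotients_of (?A i)" if "in_vars (Suc n) F" for F
    using that
  proof (induction F rule: mpol_induct)
    case (var j)
    \<comment> \<open>The coordinates of the distinguished chart as quotients of coordinates of the
      chart of the point.\<close>
    have "(t j / t i) / (t i0 / t i) \<in> quotients_of (?A i)"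
      using var A(3) i i0 by (intro quotients_of_closed(3)[OF A(1)] AQ) auto
    then show ?case using i by simp
  qed (simp_all add: eval_add eval_mult AQ A(2) quotients_of_closed(1,2)[OF A(1)])
  then have sub0: "?A i0 \<subseteq> quotients_of (?A i)" by (auto simp: chart_ring_def)
  obtain a b where "a \<in> ?A i0" "b \<in> ?A i0" "b \<noteq> 0" "z = a / b" using i0(3) by blast
  then have "z \<in> quotients_of (?A i)" using sub0 by (auto intro: quotients_of_closed(3)[OF A(1)])
  then show "\<exists>a\<in>P. \<exists>b\<in>P. b \<noteq> 0 \<and> z = a / b" using AP unfolding quotients_of_def by blast
qed

section \<open>From the definition of smoothness to presented points\<close>

lemma in_vars_subring: "is_subring {F :: 'k::field mpol. in_vars m F}"
  by (auto simp: is_subring_def)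

text \<open>One presentation is fixed before the parameters, so that the parameters of the
  rectifying data and those chosen by the residue share it.\<close>

lemma smooth_point_exists:
  assumes V: "integral_projective \<iota> n t" and P: "P \<in> proj_points \<iota> n t"
    and "rational_point \<iota> P" and "smooth_at \<iota> r P"
  shows "\<exists>m s F. \<forall>x. local_params r P x \<longrightarrow> function_field_point \<iota> P r m s F x"
proof -
  have hom: "comm_ring_hom \<iota>" using V field_embedding_hom by (auto simp: integral_projective_def)
  note P' = proj_point[OF V P]
  obtain m s F where sm: "r \<le> m" "\<forall>j<m. s j \<in> P" "\<forall>l<m - r. in_vars m (F l) \<and> eval_at \<iota> s (F l) = 0"
     "P = {eval_at \<iota> s G / eval_at \<iota> s H |G H.
            in_vars m G \<and> in_vars m H \<and> eval_at \<iota> s H \<notin> maxid P}"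
     "\<forall>G. in_vars m G \<and> eval_at \<iota> s G = 0 \<longrightarrow>
        (\<exists>H. in_vars m H \<and> eval_at \<iota> s H \<notin> maxid P \<and>
           H * G \<in> ideal_gen {F. in_vars m F} (F ` {..<m - r}))"
    using assms(4)[unfolded smooth_at_def] by (elim exE conjE) (rule that; assumption)
  have "ideal_gen {F. in_vars m F} (F ` {..<m - r}) = span_of {F. in_vars m F} F (m - r)"
    using sm(3) by (intro ideal_gen_image in_vars_subring) simp
  then have rel: "\<exists>H Q. in_vars m H \<and> eval_at \<iota> s H \<notin> maxid P \<and> (\<forall>l<m - r. in_vars m (Q l)) \<and>
      H * G = (\<Sum>l<m - r. Q l * F l)" if "in_vars m G" "eval_at \<iota> s G = 0" for G
  proof -
    from sm(5)[rule_format, OF conjI[OF that]]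
    obtain H where H: "in_vars m H" "eval_at \<iota> s H \<notin> maxid P" "H * G \<in> ideal_gen {F. in_vars m F} (F ` {..<m - r})"
      by (elim exE conjE) (rule that; assumption)
    then have "H * G \<in> span_of {F. in_vars m F} F (m - r)"
      using \<open>ideal_gen {F. in_vars m F} (F ` {..<m - r}) = _\<close> by simp
    then obtain Q where "\<And>l. l < m - r \<Longrightarrow> in_vars m (Q l)" "H * G = (\<Sum>l<m - r. Q l * F l)"
      by (auto elim!: span_ofE)
    then show ?thesis using H(1,2) by blast
  qed
  have "function_field_point \<iota> P r m s F x" if x: "local_params r P x" for x
  proof -
    interpret comm_ring_hom \<iota> by (rule hom)
    \<comment> \<open>\<open>maxid P\<close> is defined as a set of nonunits; being generated by
      parameters makes it an ideal.\<close>
    have "is_ideal P (maxid P)"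
      using x ideal_gen_ideal[OF P'(1)] by (simp add: local_params_def)
    then have local: "local_point \<iota> P"
      using P' assms(3) by unfold_locales (auto simp: rational_point_def)
    have "\<exists>G H. in_vars m G \<and> in_vars m H \<and> eval_at \<iota> s H \<notin> maxid P \<and> g = eval_at \<iota> s G / eval_at \<iota> s H"
      if "g \<in> P" for g using that sm(4) by blast
    then have "presented_point \<iota> P r m s F"
      using local sm(1-3) rel by (intro presented_point.intro presented_point_axioms.intro) auto
    moreover have "param_point \<iota> P r x"
      using local x by (intro param_point.intro param_point_axioms.intro)
    ultimately show ?thesis
      using P'(3) by (intro function_field_point.intro smooth_point.intro function_field_point_axioms.intro)
  qed
  then show ?thesis by blast
qed

section \<open>Residues\<close>

lemma lookup_top_index: "Poly_Mapping.lookup (top_index r a) k = (if k < r then a k - 1 else 0)"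
  by (auto simp: top_index_def lookup_sum lookup_single when_def)

lemma local_equations_associated:
  assumes D: "cdivisor V D" "P \<in> V" and P: "is_subring P" and fg: "f \<in> D P" "g \<in> D P"
  shows "\<exists>u\<in>runits P. g = f * u"
proof -
  obtain f0 where f0: "f0 \<noteq> 0" "D P = {f0 * u |u. u \<in> runits P}"
    using D unfolding cdivisor_def by blast
  then obtain u w where uw: "f = f0 * u" "g = f0 * w" "u \<in> runits P" "w \<in> runits P" using fg by auto
  then have "w * (1 / u) \<in> P" "u * (1 / w) \<in> P" "u \<noteq> 0" "w \<noteq> 0"
    using is_subringD(4)[OF P] unfolding runits_def by blast+
  then have "w / u \<in> runits P" by (simp add: runits_def)
  then show ?thesis using uw \<open>u \<noteq> 0\<close> by (intro bexI[of _ "w / u"]) auto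
qed

context
  fixes \<iota> :: "'k::field \<Rightarrow> 'K::field" and P :: "'K set" and r m s F
    and V :: "'K set set" and D :: "nat \<Rightarrow> 'K cdiv"
    and x0 f0 :: "nat \<Rightarrow> 'K" and a0 :: nat
  assumes point: "\<And>x. local_params r P x \<Longrightarrow> function_field_point \<iota> P r m s F x"
    and D: "\<And>j. j < r \<Longrightarrow> cdivisor V (D j)" "\<And>j. j < r \<Longrightarrow> effective V (D j)"
    and P: "P \<in> common_points V r D"
    and x0: "local_params r P x0" and f0: "\<And>j. j < r \<Longrightarrow> f0 j \<in> D j P"
    and a0: "admissible_exponent r P x0 f0 a0"
begin

interpretation p0: function_field_point \<iota> P r m s F x0
  by (rule point[OF x0])

lemma P_in_V: "P \<in> V"
  using P by (simp add: common_points_def)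

lemma local_equation_in: "j < r \<Longrightarrow> g \<in> D j P \<Longrightarrow> g \<in> P"
  using D(2) P_in_V unfolding effective_def by blast

lemma f0_in: "j < r \<Longrightarrow> f0 j \<in> P"
  using local_equation_in f0 by blast

lemma local_equation_units:
  assumes "\<And>j. j < r \<Longrightarrow> f j \<in> D j P" "\<And>j. j < r \<Longrightarrow> g j \<in> D j P"
  obtains u where "\<And>j. j < r \<Longrightarrow> u j \<in> runits P" "\<And>j. j < r \<Longrightarrow> g j = f j * u j"
proof -
  have "\<forall>j. \<exists>u. j < r \<longrightarrow> u \<in> runits P \<and> g j = f j * u"
    using local_equations_associated[OF D(1) P_in_V p0.subring] assms by blast
  from choice[OF this] show thesis using that by blast
qed

text \<open>The given data witness that the choices in \<open>residue\<close> can be made. The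
  choices do not depend on the form, so one formula holds for all forms at once.\<close>

lemma residue_formula:
  obtains f x a where "local_params r P x" "\<And>j. j < r \<Longrightarrow> f j \<in> D j P" "admissible_exponent r P x f a"
    "\<And>\<omega>. \<omega> \<in> forms \<iota> r \<Longrightarrow> residue \<iota> r V D P \<omega>
      = expansion \<iota> r P x (transition_det r P x f a * ((\<Prod>j<r. f j) * form_quot \<iota> r \<omega> x)) (top_index r (\<lambda>_. a))"
proof -
  define f where "f = (SOME f. \<forall>j<r. f j \<in> D j P)"
  have f: "f j \<in> D j P" if "j < r" for j
  proof -
    have "\<forall>j<r. f j \<in> D j P" unfolding f_def by (rule someI[of _ f0]) (use f0 in blast)
    then show ?thesis using that by blast
  qed
  obtain u where u: "\<And>j. j < r \<Longrightarrow> u j \<in> runits P" "\<And>j. j < r \<Longrightarrow> f0 j = f j * u j"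
    using local_equation_units[of f f0] f f0 by blast
  \<comment> \<open>The chosen equations differ from \<open>f0\<close> by units, so
    \<open>x0\<close> and \<open>a0\<close> are admissible for them as well.\<close>
  have "ideal_gen P (f0 ` {..<r}) \<subseteq> ideal_gen P (f ` {..<r})"
  proof -
    have fP: "\<forall>j<r. f j \<in> P" "\<forall>j<r. f0 j \<in> P" using local_equation_in f f0 by blast+
    have "f0 j \<in> span_of P f r" if "j < r" for j
      using span_of_generator[of P "u j" j r f] that u p0.P_intros(1) by (simp add: runits_def mult.commute)
    then show ?thesis
      unfolding ideal_gen_image[OF p0.subring fP(1)] ideal_gen_image[OF p0.subring fP(2)]
      by (intro span_of_mono p0.subring fP(1)) blast
  qed
  then have adm: "admissible_exponent r P x0 f a0"
    using a0 unfolding admissible_exponent_def by blast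
  define p where "p = (SOME (x, a). local_params r P x \<and> admissible_exponent r P x f a)"
  obtain x a where p: "p = (x, a)" by (cases p)
  have "case p of (x, a) \<Rightarrow> local_params r P x \<and> admissible_exponent r P x f a"
    unfolding p_def by (rule someI[of _ "(x0, a0)"]) (use adm x0 in simp)
  then have xa: "local_params r P x" "admissible_exponent r P x f a" by (simp_all add: p)
  interpret p1: function_field_point \<iota> P r m s F x by (rule point[OF xa(1)])
  have "residue \<iota> r V D P \<omega>
      = expansion \<iota> r P x (transition_det r P x f a * ((\<Prod>j<r. f j) * form_quot \<iota> r \<omega> x)) (top_index r (\<lambda>_. a))"
    if "\<omega> \<in> forms \<iota> r" for \<omega>
  proof -
    have "fscale (transition_det r P x f a) (fscale (\<Prod>j<r. f j) \<omega>) = fscale (transition_det r P x f a * (\<Prod>j<r. f j)) \<omega>"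
      by (simp add: fscale_def mult.assoc)
    then show ?thesis
      using P p p1.form_quot_fscale[OF that]
      by (simp add: residue_def residue_params_def residue_monomial_def Let_def mult.assoc flip: f_def p_def)
  qed
  from that[OF xa(1) f xa(2) this] show thesis .
qed

text \<open>Membership is carried over to the parameters chosen by the residue, and all exponents of
  the top index are below \<open>a\<close>. It is applied with \<open>\<theta>\<close> and with
  \<open>(h - h(P)) \<theta>\<close> as z.\<close>

lemma residue_vanishes:
  assumes z: "z \<in> P" "transition_det r P x0 f0 a0 * z \<in> span_of P (\<lambda>i. x0 i ^ a0) r"
    and x: "local_params r P x" and f: "\<And>j. j < r \<Longrightarrow> f j \<in> D j P" and a: "admissible_exponent r P x f a"
    and g: "g \<in> P"
  shows "expansion \<iota> r P x (g * (transition_det r P x f a * z)) (top_index r (\<lambda>_. a)) = 0"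
proof -
  interpret p1: function_field_point \<iota> P r m s F x by (rule point[OF x])
  obtain M0 where M0: "\<And>i j. i < r \<Longrightarrow> j < r \<Longrightarrow> M0 i j \<in> P" "\<And>i. i < r \<Longrightarrow> x0 i ^ a0 = (\<Sum>j<r. M0 i j * f0 j)"
    "transition_det r P x0 f0 a0 = det (mat r r (\<lambda>(i, j). M0 i j))"
    using p0.transition_matrix[OF a0 f0_in] by blast
  have f_in: "f j \<in> P" if "j < r" for j using local_equation_in[OF that f[OF that]] .
  obtain M where M: "\<And>i j. i < r \<Longrightarrow> j < r \<Longrightarrow> M i j \<in> P" "\<And>i. i < r \<Longrightarrow> x i ^ a = (\<Sum>j<r. M i j * f j)"
    "transition_det r P x f a = det (mat r r (\<lambda>(i, j). M i j))"
    using p1.transition_matrix[OF a f_in] by blast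
  obtain u where u: "\<And>j. j < r \<Longrightarrow> u j \<in> runits P" "\<And>j. j < r \<Longrightarrow> f j = f0 j * u j"
    using local_equation_units[of f0 f] f f0 by blast
  have "transition_det r P x f a * z \<in> p1.power_ideal a"
    unfolding M(3)
    by (rule p1.transition_transfer[OF p0.param_point_axioms f0_in u M0(1,2) M(1,2) z(1) z(2)[unfolded M0(3)]])
  then have "g * (transition_det r P x f a * z) \<in> p1.power_ideal a"
    by (rule is_idealD(4)[OF p1.power_ideal g])
  then show ?thesis
    using a by (intro p1.power_ideal_expansion) (auto simp: lookup_top_index admissible_exponent_def)
qed

text \<open>Splitting h into its value and an element of m, the second part contributes a residue
  that vanishes by the first hypothesis.\<close>

lemma residue_point:
  assumes \<theta>: "\<theta> \<in> P" "\<theta> \<noteq> 0" and h: "h \<in> P" and \<omega>: "\<omega> \<in> forms \<iota> r" and reg: "regular_quot \<iota> r D \<theta> \<omega> P"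
  shows
    "(\<And>e. e \<in> maxid P \<Longrightarrow> transition_det r P x0 f0 a0 * (e * \<theta>) \<in> span_of P (\<lambda>i. x0 i ^ a0) r) \<Longrightarrow>
      residue \<iota> r V D P (fscale h \<omega>) = value_at \<iota> P h * residue \<iota> r V D P \<omega>"
    "transition_det r P x0 f0 a0 * \<theta> \<in> span_of P (\<lambda>i. x0 i ^ a0) r \<Longrightarrow> residue \<iota> r V D P \<omega> = 0"
proof -
  obtain f x a where fx: "local_params r P x" "\<And>j. j < r \<Longrightarrow> f j \<in> D j P" "admissible_exponent r P x f a"
    "\<And>\<omega>. \<omega> \<in> forms \<iota> r \<Longrightarrow> residue \<iota> r V D P \<omega>
      = expansion \<iota> r P x (transition_det r P x f a * ((\<Prod>j<r. f j) * form_quot \<iota> r \<omega> x)) (top_index r (\<lambda>_. a))"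
    by (rule residue_formula) (rule that)
  interpret p1: function_field_point \<iota> P r m s F x by (rule point[OF fx(1)])
  let ?R = "transition_det r P x f a"
  \<comment> \<open>Regularity is given for possibly different equations and parameters; units and a
    regular Jacobian factor convert it to those of the residue.\<close>
  obtain g where g: "g \<in> P" "(\<Prod>j<r. f j) * form_quot \<iota> r \<omega> x = g * \<theta>"
  proof -
    obtain f' x' where f': "\<And>j. j < r \<Longrightarrow> f' j \<in> D j P" and x': "local_params r P x'"
      and reg': "(\<Prod>j<r. f' j) * form_quot \<iota> r \<omega> x' / \<theta> \<in> P"
      using reg by (auto simp: regular_quot_def)
    interpret p': function_field_point \<iota> P r m s F x' by (rule point[OF x'])
    obtain b where b: "b \<in> P" "dwedge \<iota> r x' = fscale b (dwedge \<iota> r x)"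
      using p1.dwedge_multiple[of x'] p'.x_in by blast
    have "\<omega> = fscale (form_quot \<iota> r \<omega> x' * b) (dwedge \<iota> r x)"
      using p'.form_quot[OF \<omega>] by (simp add: b(2) fscale_def mult.assoc)
    then have w: "form_quot \<iota> r \<omega> x = form_quot \<iota> r \<omega> x' * b" by (rule p1.form_quot_eqI)
    obtain u where u: "\<And>j. j < r \<Longrightarrow> u j \<in> runits P" "\<And>j. j < r \<Longrightarrow> f j = f' j * u j"
      using local_equation_units[of f' f] f' fx(2) by blast
    have "(\<Prod>j<r. u j) \<in> P" using u(1) by (intro p0.P_intros) (auto simp: runits_def)
    then have "((\<Prod>j<r. u j) * b) * ((\<Prod>j<r. f' j) * form_quot \<iota> r \<omega> x' / \<theta>) \<in> P"
      using b(1) reg' by (intro p0.P_intros(4))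
    moreover have "(\<Prod>j<r. f j) = (\<Prod>j<r. f' j) * (\<Prod>j<r. u j)"
      using u(2) by (simp add: prod.distrib)
    ultimately show thesis
      using \<theta>(2) w by (intro that[of "((\<Prod>j<r. u j) * b) * ((\<Prod>j<r. f' j) * form_quot \<iota> r \<omega> x' / \<theta>)"]) simp_all
  qed
  have R: "?R \<in> P"
    by (rule p1.transition_matrix[OF fx(3) local_equation_in[OF _ fx(2)]])
      (auto intro!: det_in_subring[OF p0.subring])
  have res: "residue \<iota> r V D P \<omega> = expansion \<iota> r P x (g * (?R * \<theta>)) (top_index r (\<lambda>_. a))"
    unfolding fx(4)[OF \<omega>] g(2) by (simp only: mult_ac)
  show "residue \<iota> r V D P \<omega> = 0" if "transition_det r P x0 f0 a0 * \<theta> \<in> span_of P (\<lambda>i. x0 i ^ a0) r"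
    unfolding res by (rule residue_vanishes[OF \<theta>(1) that fx(1-3) g(1)])
  assume soc: "\<And>e. e \<in> maxid P \<Longrightarrow> transition_det r P x0 f0 a0 * (e * \<theta>) \<in> span_of P (\<lambda>i. x0 i ^ a0) r"
  let ?c = "value_at \<iota> P h" and ?e = "h - \<iota> (value_at \<iota> P h)"
  have e: "?e \<in> maxid P" by (rule p0.value_at[OF h])
  then have eP: "?e * \<theta> \<in> P" using \<theta>(1) p0.maxid_in by (intro p0.P_intros(4))
  have h\<omega>: "fscale h \<omega> \<in> forms \<iota> r"
    using \<omega> by (auto simp: forms_def fscale_def ring_distribs mult_ac)
  have "residue \<iota> r V D P (fscale h \<omega>)
      = expansion \<iota> r P x (?R * ((\<Prod>j<r. f j) * (h * form_quot \<iota> r \<omega> x))) (top_index r (\<lambda>_. a))"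
    by (simp only: fx(4)[OF h\<omega>] p1.form_quot_fscale[OF \<omega>])
  also have "?R * ((\<Prod>j<r. f j) * (h * form_quot \<iota> r \<omega> x)) = h * (?R * ((\<Prod>j<r. f j) * form_quot \<iota> r \<omega> x))"
    by (simp only: mult_ac)
  also have "\<dots> = \<iota> ?c * (g * (?R * \<theta>)) + g * (?R * (?e * \<theta>))"
    unfolding g(2) by (simp add: algebra_simps)
  also have "expansion \<iota> r P x \<dots> (top_index r (\<lambda>_. a))
      = ?c * expansion \<iota> r P x (g * (?R * \<theta>)) (top_index r (\<lambda>_. a))
        + expansion \<iota> r P x (g * (?R * (?e * \<theta>))) (top_index r (\<lambda>_. a))"
    using g(1) R \<theta>(1) eP by (simp add: p1.expansion_add p1.expansion_scale p0.P_intros)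
  also have "expansion \<iota> r P x (g * (?R * (?e * \<theta>))) (top_index r (\<lambda>_. a)) = 0"
    by (rule residue_vanishes[OF eP soc[OF e] fx(1-3) g(1)])
  finally show "residue \<iota> r V D P (fscale h \<omega>) = ?c * residue \<iota> r V D P \<omega>" by (simp add: res)
qed

section \<open>The rectifying congruences as ideal membership\<close>

lemma ps_cong_coeff:
  assumes "ps_cong r a c c'" "Poly_Mapping.keys I \<subseteq> {..<r}" "\<forall>k<r. Poly_Mapping.lookup I k < a"
  shows "c I = c' I"
proof -
  obtain q where "c I - c' I = (\<Sum>j<r. if a \<le> Poly_Mapping.lookup I j then q j (I - Poly_Mapping.single j a) else 0)"
    using assms(1,2) unfolding ps_cong_def by blast
  also have "\<dots> = 0" using assms(3) by (intro sum.neutral) auto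
  finally show ?thesis by simp
qed

lemma rectifying_ideal:
  assumes \<theta>: "\<theta> \<in> P"
    and cong: "ps_cong r a0 (expansion \<iota> r P x0 (transition_det r P x0 f0 a0 * \<theta>)) (\<lambda>_. 0)"
  shows "transition_det r P x0 f0 a0 * \<theta> \<in> span_of P (\<lambda>i. x0 i ^ a0) r"
proof -
  have "transition_det r P x0 f0 a0 \<in> P"
    by (rule p0.transition_matrix[OF a0 f0_in])
      (auto intro!: det_in_subring[OF p0.subring])
  then show ?thesis
    using \<theta> ps_cong_coeff[OF cong] by (intro p0.power_idealI p0.P_intros) auto
qed

text \<open>Modulo the power ideal the product with \<open>\<theta>\<close> is a multiple of the
  monomial with all exponents \<open>a0 - 1\<close>. Every parameter kills this monomial, hence so
  does all of m: it spans the socle.\<close>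

lemma rectifying_socle:
  assumes \<theta>: "\<theta> \<in> P"
    and cong: "ps_cong r a0 (expansion \<iota> r P x0 (transition_det r P x0 f0 a0 * \<theta>))
      (\<lambda>I. if I = top_index r (\<lambda>_. a0) then c else 0)"
    and e: "e \<in> maxid P"
  shows "transition_det r P x0 f0 a0 * (e * \<theta>) \<in> span_of P (\<lambda>i. x0 i ^ a0) r"
proof -
  let ?u = "transition_det r P x0 f0 a0 * \<theta>"
  have "transition_det r P x0 f0 a0 \<in> P"
    by (rule p0.transition_matrix[OF a0 f0_in])
      (auto intro!: det_in_subring[OF p0.subring])
  then have u: "?u \<in> P" using \<theta> by (intro p0.P_intros)
  have x: "x0 j * ?u \<in> p0.power_ideal a0" if j: "j < r" for j
  proof (rule p0.power_idealI)
    show "x0 j * ?u \<in> P" by (rule p0.P_intros(4)[OF p0.x_in[OF j] u])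
    fix I :: "nat \<Rightarrow>\<^sub>0 nat" assume I: "Poly_Mapping.keys I \<subseteq> {..<r}" "\<forall>k<r. Poly_Mapping.lookup I k < a0"
    let ?K = "Poly_Mapping.single j (1::nat)"
    have "p0.ex (x0 j * ?u) = shift ?K (p0.ex ?u)"
      using p0.expansion_monom_mult[OF u, of ?K] j by simp
    moreover have "p0.ex ?u M = 0" if M: "I = ?K + M" for M
    proof -
      have "Poly_Mapping.keys M \<subseteq> {..<r}" using I(1) unfolding M by (simp add: keys_add_nat)
      moreover have "Poly_Mapping.lookup M k < a0" if "k < r" for k
        using I(2) that unfolding M lookup_add by (meson add_lessD1 add.commute le_add2 le_less_trans)
      \<comment> \<open>M has j-th exponent one less than I, hence below
        \<open>a0 - 1\<close>.\<close>
      moreover have "M \<noteq> top_index r (\<lambda>_. a0)"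
        using I(2)[rule_format, OF j] j unfolding M by (auto simp: lookup_add lookup_top_index)
      ultimately show ?thesis using ps_cong_coeff[OF cong, of M] by simp
    qed
    ultimately show "p0.ex (x0 j * ?u) I = 0" by (auto simp: shift_def)
  qed
  obtain b where b: "\<And>j. j < r \<Longrightarrow> b j \<in> P" "e = (\<Sum>j<r. b j * x0 j)"
    using e unfolding p0.maxid_span by (auto elim!: span_ofE)
  have "transition_det r P x0 f0 a0 * (e * \<theta>) = (\<Sum>j<r. b j * (x0 j * ?u))"
    unfolding b(2) by (simp add: sum_distrib_left sum_distrib_right mult_ac)
  also have "\<dots> \<in> p0.power_ideal a0"
    using is_idealD(4)[OF p0.power_ideal b(1) x] by (intro is_ideal_sum[OF p0.power_ideal]) simp
  finally show ?thesis .
qed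

text \<open>With \<open>\<theta>\<close> written as q/nn through its positive and negative parts,
  the condition at P bounds the quotient by q and by an equation g of G; multiplying by g and nn,
  both regular at P, yields the quotient by \<open>\<theta>\<close>.\<close>

lemma regular_quot_Omega:
  assumes G: "cdivisor V G" "1 \<in> G P \<or> G P \<subseteq> P" and \<theta>: "\<theta> \<noteq> 0"
    and pos: "positive_part V (div_fun V \<theta>) \<theta>p"
    and \<omega>: "\<omega> \<in> Omega_of \<iota> r V (div_diff (div_diff (div_sum V r D) G) \<theta>p)"
  shows "regular_quot \<iota> r D \<theta> \<omega> P"
proof (cases "\<omega> = (\<lambda>_. 0)")
  case True
  then have "form_quot \<iota> r \<omega> x0 = 0" by (intro p0.form_quot_eqI) (simp add: fscale_def)
  then show ?thesis
    unfolding regular_quot_def using f0 x0 p0.P_intros(1) by (intro exI[of _ f0] exI[of _ x0]) simp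
next
  case False
  let ?w = "form_quot \<iota> r \<omega> x0"
  have \<omega>': "\<omega> \<in> forms \<iota> r" "effective V (div_add (div_form \<iota> r V \<omega>) (div_diff (div_diff (div_sum V r D) G) \<theta>p))"
    using \<omega> False by (auto simp: Omega_of_def)
  have w: "?w \<in> div_form \<iota> r V \<omega> P"
    unfolding div_form_def using P_in_V p0.regular_forms_eq p0.form_quot[OF \<omega>'(1)] by auto
  obtain Hn where Hn: "cdivisor V \<theta>p" "cdivisor V Hn" "effective V Hn" "div_fun V \<theta> = div_diff \<theta>p Hn"
    using pos by (auto simp: positive_part_def)
  have one: "1 \<in> runits P" using p0.P_intros(2) by (simp add: runits_def)
  then have "\<theta> \<in> div_fun V \<theta> P" using P_in_V by (force simp: div_fun_def)
  then obtain q nn where q: "q \<in> \<theta>p P" "nn \<in> Hn P" "\<theta> = q / nn"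
    unfolding Hn(4) by (auto simp: div_diff_def)
  have nn: "nn \<in> P" using q(2) Hn(3) P_in_V unfolding effective_def by blast
  \<comment> \<open>Off the support of G the equation 1 is taken; otherwise any equation is regular
    by assumption.\<close>
  obtain g where g: "g \<in> G P" "g \<in> P" "g \<noteq> 0"
  proof -
    obtain f where f: "f \<noteq> 0" "G P = {f * u |u. u \<in> runits P}"
      using G(1) P_in_V unfolding cdivisor_def by blast
    then have "f \<in> G P" using one by force
    then show thesis using G(2) f(1) that[of 1] that[of f] p0.P_intros(2) by auto
  qed
  have "(\<Prod>j<r. f0 j) * 1 \<in> div_sum V r D P"
    unfolding div_sum_def using P_in_V f0 one by (auto intro!: exI[of _ f0] exI[of _ 1])
  then have "(\<Prod>j<r. f0 j) / g / q \<in> div_diff (div_diff (div_sum V r D) G) \<theta>p P"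
    unfolding div_diff_def using g(1) q(1) by fastforce
  then have "?w * ((\<Prod>j<r. f0 j) / g / q) \<in> P"
    using \<omega>'(2) w P_in_V unfolding effective_def div_add_def by blast
  then have "g * nn * (?w * ((\<Prod>j<r. f0 j) / g / q)) \<in> P"
    by (intro p0.P_intros(4)[OF p0.P_intros(4)[OF g(2) nn]])
  moreover have "g * nn * (?w * ((\<Prod>j<r. f0 j) / g / q)) = (\<Prod>j<r. f0 j) * ?w / \<theta>"
    using g(3) q(3) \<theta> by (auto simp: field_simps)
  ultimately show ?thesis
    unfolding regular_quot_def using f0 x0 by (intro exI[of _ f0] exI[of _ x0]) auto
qed

end

text \<open>In the last clause the support of G avoids only \<open>PP\<close>; at the other common
  points \<open>G P \<subseteq> P\<close> ensures that multiplication by a local equation of G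
  preserves regularity.\<close>

theorem proposition5p4:
  fixes \<iota> :: "'k::{field, finite} \<Rightarrow> 'K::field"
    and n r :: nat and t :: "nat \<Rightarrow> 'K" and V PP :: "'K set set"
    and D :: "nat \<Rightarrow> 'K cdiv" and G :: "'K cdiv"
    and x f :: "'K set \<Rightarrow> nat \<Rightarrow> 'K" and a :: "'K set \<Rightarrow> nat"
    and \<theta> h :: 'K
  assumes "smooth_projective_variety \<iota> n t r"
    and "V = proj_points \<iota> n t"
    and "\<forall>i<r. cdivisor V (D i) \<and> effective V (D i)"
    and "finite (common_points V r D)"
    and "\<forall>P\<in>common_points V r D. rational_point \<iota> P"
    and "PP \<subseteq> common_points V r D" and "finite PP"
    and "cdivisor V G" and "supp V G \<inter> PP = {}"
    and "local_data r V D x f a" and "rectifying \<iota> r V D PP x f a \<theta>"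
    and "\<forall>P\<in>common_points V r D. h \<in> P"
  shows
    "(\<forall>\<omega>\<in>forms \<iota> r. (\<forall>P\<in>common_points V r D. regular_quot \<iota> r D \<theta> \<omega> P) \<longrightarrow>
        (\<forall>P\<in>common_points V r D.
           residue \<iota> r V D P (fscale h \<omega>) = value_at \<iota> P h * residue \<iota> r V D P \<omega>) \<and>
        (\<forall>P\<in>V - PP. residue \<iota> r V D P \<omega> = 0)) \<and>
     (\<forall>\<theta>p \<omega> P. positive_part V (div_fun V \<theta>) \<theta>p \<longrightarrow>
        \<omega> \<in> Omega_of \<iota> r V (div_diff (div_diff (div_sum V r D) G) \<theta>p) \<longrightarrow>
        P \<in> common_points V r D \<longrightarrow> P \<in> PP \<or> G P \<subseteq> P \<longrightarrow> regular_quot \<iota> r D \<theta> \<omega> P)"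
proof -
  have local: "local_params r P (x P)" "j < r \<Longrightarrow> f P j \<in> D j P" "admissible_exponent r P (x P) (f P) (a P)"
    if "P \<in> common_points V r D" for P j
    using assms(10) that by (auto simp: local_data_def)
  have D: "j < r \<Longrightarrow> cdivisor V (D j)" "j < r \<Longrightarrow> effective V (D j)" for j using assms(3) by auto
  have \<theta>0: "\<theta> \<noteq> 0" using assms(11) by (simp add: rectifying_def)
  have \<theta>: "\<theta> \<in> P"
    "P \<in> PP \<Longrightarrow> \<exists>c. ps_cong r (a P) (expansion \<iota> r P (x P) (transition_det r P (x P) (f P) (a P) * \<theta>))
      (\<lambda>I. if I = top_index r (\<lambda>_. a P) then c else 0)"
    "P \<notin> PP \<Longrightarrow> ps_cong r (a P) (expansion \<iota> r P (x P) (transition_det r P (x P) (f P) (a P) * \<theta>)) (\<lambda>_. 0)"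
    if "P \<in> common_points V r D" for P
    using assms(11) that by (auto simp: rectifying_def Let_def)
  have point: "\<exists>m s F. \<forall>x. local_params r P x \<longrightarrow> function_field_point \<iota> P r m s F x"
    if "P \<in> common_points V r D" for P
    using assms(1,2,5) that
    by (intro smooth_point_exists[of \<iota> n t]) (auto simp: smooth_projective_variety_def common_points_def)
  have outside: "residue \<iota> r V D P \<omega> = 0"
    if P: "P \<in> common_points V r D" "P \<notin> PP" and \<omega>: "\<omega> \<in> forms \<iota> r" "regular_quot \<iota> r D \<theta> \<omega> P" for P \<omega>
  proof -
    obtain m s F where pt: "\<And>x. local_params r P x \<Longrightarrow> function_field_point \<iota> P r m s F x"
      using point[OF P(1)] by blast
    note ctx = pt D P(1) local[OF P(1)]
    have h: "h \<in> P" using assms(12) P(1) by blast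
    show ?thesis
      by (rule residue_point(2)[OF ctx \<theta>(1)[OF P(1)] \<theta>0 h \<omega> rectifying_ideal[OF ctx \<theta>(1)[OF P(1)] \<theta>(3)[OF P]]])
  qed
  have inside: "residue \<iota> r V D P (fscale h \<omega>) = value_at \<iota> P h * residue \<iota> r V D P \<omega>"
    if P: "P \<in> common_points V r D" and \<omega>: "\<omega> \<in> forms \<iota> r" "regular_quot \<iota> r D \<theta> \<omega> P" for P \<omega>
  proof -
    obtain m s F where pt: "\<And>x. local_params r P x \<Longrightarrow> function_field_point \<iota> P r m s F x"
      using point[OF P] by blast
    note ctx = pt D P local[OF P]
    have h: "h \<in> P" using assms(12) P by blast
    interpret function_field_point \<iota> P r m s F "x P" by (rule pt[OF local(1)[OF P]])
    \<comment> \<open>Inside \<open>PP\<close> this is the socle property; outside, the product with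
      \<open>\<theta>\<close> already lies in the ideal and the factor from m is harmless.\<close>
    have socle: "transition_det r P (x P) (f P) (a P) * (e * \<theta>) \<in> power_ideal (a P)" if e: "e \<in> maxid P" for e
    proof (cases "P \<in> PP")
      case True
      then obtain c where "ps_cong r (a P) (expansion \<iota> r P (x P) (transition_det r P (x P) (f P) (a P) * \<theta>))
        (\<lambda>I. if I = top_index r (\<lambda>_. a P) then c else 0)" using \<theta>(2)[OF P] by blast
      from rectifying_socle[OF ctx \<theta>(1)[OF P] this e] show ?thesis .
    next
      case False
      have "transition_det r P (x P) (f P) (a P) * \<theta> \<in> power_ideal (a P)"
        by (rule rectifying_ideal[OF ctx \<theta>(1)[OF P] \<theta>(3)[OF P False]])
      from is_idealD(4)[OF power_ideal maxid_in[OF e] this]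
      have "e * (transition_det r P (x P) (f P) (a P) * \<theta>) \<in> power_ideal (a P)" .
      then show ?thesis by (simp only: mult_ac)
    qed
    show ?thesis by (rule residue_point(1)[OF ctx \<theta>(1)[OF P] \<theta>0 h \<omega> socle])
  qed
  have regular: "regular_quot \<iota> r D \<theta> \<omega> P"
    if "positive_part V (div_fun V \<theta>) \<theta>p"
      "\<omega> \<in> Omega_of \<iota> r V (div_diff (div_diff (div_sum V r D) G) \<theta>p)"
      and P: "P \<in> common_points V r D" and PG: "P \<in> PP \<or> G P \<subseteq> P" for \<theta>p \<omega> P
  proof -
    obtain m s F where pt: "\<And>x. local_params r P x \<Longrightarrow> function_field_point \<iota> P r m s F x"
      using point[OF P] by blast
    \<comment> \<open>At a point of \<open>PP\<close> the constant 1 is a local equation of G, by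
      disjointness of supports.\<close>
    have GP: "1 \<in> G P \<or> G P \<subseteq> P" using PG P assms(9) by (auto simp: supp_def common_points_def)
    show ?thesis by (rule regular_quot_Omega[OF pt D P local[OF P] assms(8) GP \<theta>0 that(1,2)])
  qed
  \<comment> \<open>Away from the common points the residue is 0 by definition.\<close>
  have "residue \<iota> r V D P \<omega> = 0"
    if "P \<in> V - PP" "\<omega> \<in> forms \<iota> r" "\<forall>P\<in>common_points V r D. regular_quot \<iota> r D \<theta> \<omega> P" for P \<omega>
    using that outside by (cases "P \<in> common_points V r D") (auto simp: residue_def)
  then show ?thesis using inside regular by blast
qed

end
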